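(* Suppose $F\subset\mathrm{Sym}^2(\mathbb R^n)$ is a (not necessarily convex) ST-invariant cone subequation with Riesz characteristic $p$, $1\le p<2$. Then each $F$-subharmonic function (on an open subset of $\mathbb R^n$) is locally H\"older continuous with exponent $\alpha=2-p$. Furthermore, if $u$ is $F$-subharmonic in a neighborhood of $0\in\mathbb R^n$ and $u_r(x)=r^{p-2}(u(rx)-u(0))$, then every sequence $\{u_{r_j}\}_{j=1}^\infty$ with $r_j\downarrow0$ has a subsequence which converges locally uniformly to an $F$-subharmonic function $U$ on $\mathbb R^n$. In fact, for each $0<\beta<2-p$ there exists a subsequence which converges locally in $\beta$-H\"older norm. Finally, when $F$ is convex, this limit $U$ is $F$-harmonic on $\mathbb R^n\setminus\{0\}$.
   Context: Fix $n\ge 2$. $\mathrm{Sym}^2(\mathbb R^n)$ is the space of real symmetric $n\times n$ matrices and $\mathcal P=\{A: A\ge 0\}$. A subequation is a nonempty proper closed subset $F\subset \mathrm{Sym}^2(\mathbb R^n)$ with $F+\mathcal P\subset F$. It is a cone if $tF\subset F$ for all $t\ge 0$. It is ST-invariant if there is a subgroup $G\subset O(n)$ acting transitively on $S^{n-1}$ such that $F$ is invariant under $A\mapsto gAg^t$ for all $g\in G$. For a unit vector $e$, $P_e$ and $P_{e^\perp}=I-P_e$ are the orthogonal projections onto $\mathbb R e$ and $e^\perp$. The Riesz characteristic is $p_F=\sup\{\bar p: P_{e^\perp}-(\bar p-1)P_e\in F\}$ (independent of $e$). An upper semi-continuous $u:X\to[-\infty,\infty)$ on an open set $X$, not identically $-\infty$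 on any connected component of $X$, is $F$-subharmonic if whenever $\varphi$ is $C^2$ near $x_0\in X$ with $u\le\varphi$ near $x_0$ and equality at $x_0$, one has $D^2\varphi(x_0)\in F$. The dual subequation is $\widetilde F=\{A:-A\notin\mathrm{Int}\,F\}$; $u$ is $F$-harmonic on $X$ if $u$ is $F$-subharmonic and $-u$ is $\widetilde F$-subharmonic on $X$. If $u$ is defined on the ball of radius $\rho$ about $0$, then $u_r$ is defined on the ball of radius $\rho/r$; local convergence means convergence on each compact subset of $\mathbb R^n$. *)

theory Defs
  imports "HOL-Analysis.Analysis" "HOL-Algebra.Group"
begin

section \<open>Subequations\<close>

definition Sym2 :: "(real^'n^'n) set"
  where "Sym2 = {A. transpose A = A}"

definition psd :: "(real^'n^'n) set"
  where "psd = {A \<in> Sym2. \<forall>x. 0 \<le> x \<bullet> (A *v x)}"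

definition subequation :: "(real^'n^'n) set \<Rightarrow> bool"
  where "subequation F \<longleftrightarrow>
    F \<noteq> {} \<and> F \<subset> Sym2 \<and> closed F \<and> (\<forall>A\<in>F. \<forall>P\<in>psd. A + P \<in> F)"

definition orthogonal_group :: "(real^'n^'n) monoid"
  where "orthogonal_group = \<lparr>carrier = {g. orthogonal_matrix g}, mult = (**), one = mat 1\<rparr>"

definition ST_invariant :: "(real^'n^'n) set \<Rightarrow> bool"
  where "ST_invariant F \<longleftrightarrow>
    (\<exists>G. subgroup G orthogonal_group
       \<and> (\<forall>x\<in>sphere 0 1. \<forall>y\<in>sphere 0 1. \<exists>g\<in>G. g *v x = y)
       \<and> (\<forall>g\<in>G. \<forall>A\<in>F. g ** A ** transpose g \<in> F))"

definition line_proj :: "real^'n \<Rightarrow> real^'n^'n"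
  where "line_proj e = matrix (\<lambda>x. (e \<bullet> x) *\<^sub>R e)"

definition perp_proj :: "real^'n \<Rightarrow> real^'n^'n"
  where "perp_proj e = mat 1 - line_proj e"

text \<open>
  The Riesz characteristic computed with the unit vector \<open>e\<close>. The lemma
  \<open>riesz_characteristic_indep\<close> below shows that the choice of \<open>e\<close> is irrelevant for
  ST-invariant sets.
\<close>

definition riesz_characteristic :: "(real^'n^'n) set \<Rightarrow> real^'n \<Rightarrow> ereal"
  where "riesz_characteristic F e =
    (SUP q \<in> {q::real. perp_proj e - (q - 1) *\<^sub>R line_proj e \<in> F}. ereal q)"

text \<open>The interior is taken relative to the space of symmetric matrices; as a subset of all
  square matrices \<open>F\<close> has empty interior.\<close>

definition dual :: "(real^'n^'n) set \<Rightarrow> (real^'n^'n) set"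
  where "dual F = {A \<in> Sym2. - A \<notin> (top_of_set Sym2) interior_of F}"


section \<open>Subharmonic and harmonic functions\<close>

text \<open>\<open>\<phi>\<close> is twice continuously differentiable on the open set \<open>V\<close>, with gradient \<open>g\<close> and
  Hessian matrix \<open>H\<close>.\<close>

definition C2_with_hessian_on ::
    "(real^'n) set \<Rightarrow> (real^'n \<Rightarrow> real) \<Rightarrow> (real^'n \<Rightarrow> real^'n^'n) \<Rightarrow> bool"
  where "C2_with_hessian_on V \<phi> H \<longleftrightarrow>
    open V \<and> continuous_on V H \<and>
    (\<exists>g. \<forall>x\<in>V. (\<phi> has_derivative (\<lambda>h. g x \<bullet> h)) (at x)
             \<and> (g has_derivative (\<lambda>h. H x *v h)) (at x))"

definition usc_on :: "(real^'n) set \<Rightarrow> (real^'n \<Rightarrow> ereal) \<Rightarrow> bool"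
  where "usc_on X u \<longleftrightarrow> (\<forall>c. openin (top_of_set X) {x \<in> X. u x < c})"

text \<open>A function \<open>X \<rightarrow> [-\<infinity>, \<infinity>)\<close> is a total function of which only the values on \<open>X\<close> matter.\<close>

definition subharmonic :: "(real^'n^'n) set \<Rightarrow> (real^'n) set \<Rightarrow> (real^'n \<Rightarrow> ereal) \<Rightarrow> bool"
  where "subharmonic F X u \<longleftrightarrow>
    open X \<and> (\<forall>x\<in>X. u x < \<infinity>) \<and> usc_on X u
    \<and> (\<forall>C\<in>components X. \<exists>x\<in>C. u x \<noteq> -\<infinity>)
    \<and> (\<forall>x\<^sub>0\<in>X. \<forall>V \<phi> H.
         x\<^sub>0 \<in> V \<and> V \<subseteq> X \<and> C2_with_hessian_on V \<phi> H
         \<and> (\<forall>x\<in>V. u x \<le> ereal (\<phi> x)) \<and> u x\<^sub>0 = ereal (\<phi> x\<^sub>0)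
         \<longrightarrow> H x\<^sub>0 \<in> F)"

definition harmonic :: "(real^'n^'n) set \<Rightarrow> (real^'n) set \<Rightarrow> (real^'n \<Rightarrow> ereal) \<Rightarrow> bool"
  where "harmonic F X u \<longleftrightarrow> subharmonic F X u \<and> subharmonic (dual F) X (\<lambda>x. - u x)"


section \<open>Hoelder continuity and local convergence\<close>

definition holder_seminorm :: "real \<Rightarrow> (real^'n) set \<Rightarrow> (real^'n \<Rightarrow> real) \<Rightarrow> ennreal"
  where "holder_seminorm \<alpha> K f =
    (SUP x\<in>K. SUP y\<in>K - {x}. ennreal (\<bar>f x - f y\<bar> / norm (x - y) powr \<alpha>))"

definition holder_norm :: "real \<Rightarrow> (real^'n) set \<Rightarrow> (real^'n \<Rightarrow> real) \<Rightarrow> ennreal"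
  where "holder_norm \<alpha> K f = (SUP x\<in>K. ennreal \<bar>f x\<bar>) + holder_seminorm \<alpha> K f"

text \<open>An extended-real-valued function that is locally Hoelder continuous is in particular
  finite on \<open>X\<close>.\<close>

definition locally_holder :: "real \<Rightarrow> (real^'n) set \<Rightarrow> (real^'n \<Rightarrow> ereal) \<Rightarrow> bool"
  where "locally_holder \<alpha> X u \<longleftrightarrow>
    (\<forall>x\<in>X. \<bar>u x\<bar> \<noteq> \<infinity>) \<and>
    (\<forall>K. compact K \<and> K \<subseteq> X \<longrightarrow> holder_seminorm \<alpha> K (\<lambda>x. real_of_ereal (u x)) < \<infinity>)"

text \<open>The members of the sequences below may be meaningful only on open sets that depend on the
  index and eventually contain every given compact set; both notions of convergence ignore
  finitely many indices for each \<open>K\<close>.\<close>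

definition converges_locally_uniformly ::
    "(nat \<Rightarrow> real^'n \<Rightarrow> real) \<Rightarrow> (real^'n \<Rightarrow> real) \<Rightarrow> bool"
  where "converges_locally_uniformly f U \<longleftrightarrow>
    (\<forall>K. compact K \<longrightarrow> uniform_limit K f U sequentially)"

definition converges_locally_holder ::
    "real \<Rightarrow> (nat \<Rightarrow> real^'n \<Rightarrow> real) \<Rightarrow> (real^'n \<Rightarrow> real) \<Rightarrow> bool"
  where "converges_locally_holder \<beta> f U \<longleftrightarrow>
    (\<forall>K. compact K \<longrightarrow> (\<lambda>k. holder_norm \<beta> K (\<lambda>x. f k x - U x)) \<longlonglongrightarrow> 0)"

text \<open>\<open>u\<^sub>r(x) = r\<^sup>p\<^sup>-\<^sup>2 (u(r x) - u(0))\<close>, to be used for \<open>u\<close> finite near \<open>0\<close> and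
  \<open>r > 0\<close>; it is meaningful only where \<open>r x\<close> lies in the domain of \<open>u\<close>.\<close>

definition rescale :: "real \<Rightarrow> (real^'n \<Rightarrow> ereal) \<Rightarrow> real \<Rightarrow> real^'n \<Rightarrow> real"
  where "rescale p u r x =
    r powr (p - 2) * (real_of_ereal (u (r *\<^sub>R x)) - real_of_ereal (u 0))"


section \<open>Independence of the Riesz characteristic of the unit vector\<close>

lemma line_proj_mult_vec: "line_proj e *v x = (e \<bullet> x) *\<^sub>R (e::real^'n)"
proof -
  have "linear (\<lambda>x. (e \<bullet> x) *\<^sub>R e)"
    by (auto intro!: linearI simp: inner_right_distrib scaleR_add_left)
  then show ?thesis
    unfolding line_proj_def by (rule matrix_vector_mul(2)[THEN fun_cong])
qed

lemma line_proj_conj: "g ** line_proj e ** transpose g = line_proj (g *v (e::real^'n))"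
proof -
  have "(g ** line_proj e ** transpose g) *v x = line_proj (g *v e) *v x" for x
  proof -
    have "e \<bullet> (transpose g *v x) = (g *v e) \<bullet> x"
      by (metis dot_lmul_matrix inner_commute transpose_matrix_vector)
    then show ?thesis
      by (simp add: matrix_vector_mul_assoc[symmetric] line_proj_mult_vec
          matrix_vector_mult_scaleR)
  qed
  then show ?thesis by (simp add: matrix_eq)
qed

lemma riesz_matrix_eq: "perp_proj e - (q - 1) *\<^sub>R line_proj e = mat 1 - q *\<^sub>R line_proj e"
  by (simp add: perp_proj_def algebra_simps)

lemma riesz_characteristic_indep:
  fixes F :: "(real^'n^'n) set"
  assumes "ST_invariant F" "norm e = 1" "norm e' = 1"
  shows "riesz_characteristic F e = riesz_characteristic F e'"
proof -
  obtain G where G: "subgroup G orthogonal_group"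
    and tr: "\<forall>x\<in>sphere 0 1. \<forall>y\<in>sphere 0 1. \<exists>g\<in>G. g *v x = y"
    and inv: "\<forall>g\<in>G. \<forall>A\<in>F. g ** A ** transpose g \<in> F"
    using assms(1) unfolding ST_invariant_def by blast
  have step: "mat 1 - q *\<^sub>R line_proj b \<in> F"
    if "mat 1 - q *\<^sub>R line_proj a \<in> F" "norm a = 1" "norm b = 1" for a b :: "real^'n" and q
  proof -
    have "a \<in> sphere 0 1" "b \<in> sphere 0 1"
      using that by auto
    then obtain g where g: "g \<in> G" "g *v a = b"
      using tr by blast
    have orth: "g ** transpose g = mat 1"
      using subgroup.subset[OF G] g(1)
      by (auto simp: orthogonal_group_def orthogonal_matrix_def)
    have "g ** (mat 1 - q *\<^sub>R line_proj a) ** transpose g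
        = g ** transpose g - q *\<^sub>R (g ** line_proj a ** transpose g)"
      by (simp add: matrix_eq matrix_vector_mul_assoc[symmetric] matrix_vector_mult_scaleR
          matrix_vector_mult_diff_distrib matrix_vector_mult_diff_rdistrib
          scaleR_matrix_vector_assoc[symmetric])
    then show ?thesis
      using inv[rule_format, OF g(1) that(1)] orth g(2) by (simp add: line_proj_conj)
  qed
  show ?thesis
    unfolding riesz_characteristic_def riesz_matrix_eq
    using step assms(2,3) by (intro arg_cong[where f = "\<lambda>S. Sup (ereal ` S)"]) blast
qed

end

theory Submission
  imports Defs "HOL-Complex_Analysis.Great_Picard" "HOL-Library.Function_Algebras"
begin

text \<open>
  Write \<open>\<alpha> = 2 - p\<close>. The Hessian of \<open>|x|\<^sup>2\<^sup>-\<^sup>q\<close> at \<open>x = |x| e\<close> is, for \<open>q < 2\<close>, a positive multiple of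
  \<open>I - q P\<^sub>e\<close>, which lies outside \<open>F\<close> if \<open>q > p\<close>. So \<open>c + C |x - y|\<^sup>2\<^sup>-\<^sup>q\<close> with \<open>C > 0\<close> cannot touch an
  \<open>F\<close>-subharmonic function from above away from \<open>y\<close>, and letting \<open>q \<rightarrow> p\<close> yields \<open>pole_comparison\<close>: if
  \<open>u y \<le> m\<close> and \<open>u \<le> M\<close> on the sphere of radius \<open>R\<close> about \<open>y\<close>, where \<open>m < M\<close>, then
  \<open>u x \<le> m + (M - m) (|x - y| / R)\<^sup>\<alpha>\<close> in the ball. As \<open>p < 2\<close>, the right-hand side is continuous at the
  pole. This upper bound at \<open>x\<close> in terms of the value at \<open>y\<close> is at once a Hoelder estimate for \<open>u\<close>,
  after the value \<open>-\<infinity>\<close> has been excluded by letting \<open>m \<rightarrow> -\<infinity>\<close>.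

  The rescalings of \<open>u\<close> share one Hoelder constant, so the theorem of Arzela and Ascoli gives locally
  uniform limits. Interpolation upgrades the convergence to every smaller Hoelder exponent, and the
  limits are subharmonic by stability of viscosity subsolutions
  (\<open>subharmonic_locally_uniform_limit\<close>).

  Let \<open>F\<close> be convex. Then averages of subharmonic functions are subharmonic
  (\<open>convex_subharmonic_sum\<close>): \<open>F\<close> is an intersection of half spaces \<open>L \<bullet> A \<ge> 0\<close>, and for a linear
  operator with constant coefficients the polynomial solutions of the Dirichlet problem on balls
  whose polynomial data are slightly above the summands (\<open>polynomial_dirichlet\<close>) dominate the
  summands and can be added. Averaging \<open>u \<circ> g\<close> over finitely many \<open>g\<close> in the transitive group does not change
  the spherical means \<open>S(r)\<close> of \<open>u\<close>, and such an average can be made to exceed \<open>S(b)\<close> as little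
  as desired on the sphere of radius \<open>b\<close> (\<open>average_near_mean\<close>). Comparing
  it with a pole at the origin gives \<open>S(r) - u(0) \<le> (r / b)\<^sup>\<alpha> (S(b) - u(0))\<close> for \<open>r \<le> b\<close>. Hence
  \<open>(S(r) - u(0)) / r\<^sup>\<alpha>\<close> decreases to a limit \<open>\<Theta>\<close> as \<open>r\<close> decreases to \<open>0\<close>, and every tangent \<open>U\<close>
  arising from \<open>u\<close> has spherical means exactly \<open>\<Theta> R\<^sup>\<alpha>\<close>. If \<open>U\<close> were not harmonic at some \<open>z \<noteq> 0\<close>, it could be raised near \<open>z\<close> to another subharmonic
  function (\<open>raise_subharmonic\<close>). This increases the mean over the sphere through \<open>z\<close> but changes neither
  the value at \<open>0\<close> nor the mean over a larger sphere, contradicting the same inequality.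
\<close>

section \<open>Twice differentiable test functions\<close>

lemma C2I:
  assumes "open V" "continuous_on V H"
    and "\<And>x. x \<in> V \<Longrightarrow> (\<phi> has_derivative (\<lambda>h. g x \<bullet> h)) (at x)"
    and "\<And>x. x \<in> V \<Longrightarrow> (g has_derivative (\<lambda>h. H x *v h)) (at x)"
  shows "C2_with_hessian_on V \<phi> H"
  using assms unfolding C2_with_hessian_on_def by blast

lemma C2E:
  assumes "C2_with_hessian_on V \<phi> H"
  obtains g where "open V" "continuous_on V H"
    "\<And>x. x \<in> V \<Longrightarrow> (\<phi> has_derivative (\<lambda>h. g x \<bullet> h)) (at x)"
    "\<And>x. x \<in> V \<Longrightarrow> (g has_derivative (\<lambda>h. H x *v h)) (at x)"
  using assms unfolding C2_with_hessian_on_def by blast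

lemma C2_continuous_on: "C2_with_hessian_on V \<phi> H \<Longrightarrow> continuous_on V \<phi>"
  by (erule C2E) (meson continuous_at_imp_continuous_on has_derivative_continuous)

lemma C2_hessian_continuous_on: "C2_with_hessian_on V \<phi> H \<Longrightarrow> continuous_on V H"
  by (simp add: C2_with_hessian_on_def)

lemma C2_open: "C2_with_hessian_on V \<phi> H \<Longrightarrow> open V"
  by (simp add: C2_with_hessian_on_def)

lemma C2_subset: "C2_with_hessian_on V \<phi> H \<Longrightarrow> W \<subseteq> V \<Longrightarrow> open W \<Longrightarrow> C2_with_hessian_on W \<phi> H"
  unfolding C2_with_hessian_on_def by (meson continuous_on_subset subsetD)

lemma C2_add:
  assumes "C2_with_hessian_on V \<phi> H" "C2_with_hessian_on V \<psi> K"
  shows "C2_with_hessian_on V (\<lambda>x. \<phi> x + \<psi> x) (\<lambda>x. H x + K x)"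
proof -
  obtain g where g: "open V" "continuous_on V H"
    "\<And>x. x \<in> V \<Longrightarrow> (\<phi> has_derivative (\<lambda>h. g x \<bullet> h)) (at x)"
    "\<And>x. x \<in> V \<Longrightarrow> (g has_derivative (\<lambda>h. H x *v h)) (at x)"
    by (rule C2E[OF assms(1)]) blast
  obtain k where k: "continuous_on V K"
    "\<And>x. x \<in> V \<Longrightarrow> (\<psi> has_derivative (\<lambda>h. k x \<bullet> h)) (at x)"
    "\<And>x. x \<in> V \<Longrightarrow> (k has_derivative (\<lambda>h. K x *v h)) (at x)"
    by (rule C2E[OF assms(2)]) blast
  show ?thesis
    by (rule C2I[where g = "\<lambda>x. g x + k x"])
      (use g k in \<open>auto intro!: continuous_intros derivative_eq_intros
        simp: inner_add_left matrix_vector_mult_add_rdistrib\<close>)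
qed

lemma C2_scale:
  assumes "C2_with_hessian_on V \<phi> H"
  shows "C2_with_hessian_on V (\<lambda>x. c * \<phi> x) (\<lambda>x. c *\<^sub>R H x)"
proof -
  obtain g where g: "open V" "continuous_on V H"
    "\<And>x. x \<in> V \<Longrightarrow> (\<phi> has_derivative (\<lambda>h. g x \<bullet> h)) (at x)"
    "\<And>x. x \<in> V \<Longrightarrow> (g has_derivative (\<lambda>h. H x *v h)) (at x)"
    by (rule C2E[OF assms(1)]) blast
  show ?thesis
    by (rule C2I[where g = "\<lambda>x. c *\<^sub>R g x"])
      (use g in \<open>auto intro!: continuous_intros derivative_eq_intros
        simp: scaleR_matrix_vector_assoc\<close>)
qed

lemma C2_const: "open V \<Longrightarrow> C2_with_hessian_on V (\<lambda>x. c) (\<lambda>x. 0)"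
  by (rule C2I[where g = "\<lambda>x. 0"]) (auto intro!: derivative_eq_intros)

lemma C2_norm_sq:
  fixes y :: "real^'n"
  assumes "open V"
  shows "C2_with_hessian_on V (\<lambda>x. (norm (x - y))\<^sup>2) (\<lambda>x. mat 2)"
proof (rule C2I[where g = "\<lambda>x. 2 *\<^sub>R (x - y)"])
  have *: "mat 2 = (2::real) *\<^sub>R (mat 1 :: real^'n^'n)"
    by (simp add: vec_eq_iff mat_def)
  show "((\<lambda>x. 2 *\<^sub>R (x - y)) has_derivative (\<lambda>h. mat 2 *v h)) (at x)" for x
    unfolding * scaleR_matrix_vector_assoc[symmetric]
    by (auto intro!: derivative_eq_intros)
  show "((\<lambda>x. (norm (x - y))\<^sup>2) has_derivative (\<lambda>h. (2 *\<^sub>R (x - y)) \<bullet> h)) (at x)" for x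
    unfolding power2_norm_eq_inner
    by (auto intro!: derivative_eq_intros simp: inner_commute)
qed (use assms in auto)

lemma mat_eq_scaleR: "mat c = c *\<^sub>R (mat 1 :: real^'n^'n)"
  by (simp add: vec_eq_iff mat_def)

lemma C2_add_norm_sq:
  assumes "C2_with_hessian_on V \<phi> H"
  shows "C2_with_hessian_on V (\<lambda>x. \<phi> x + c * (norm (x - y))\<^sup>2 + d) (\<lambda>x. H x + (2 * c) *\<^sub>R mat 1)"
  using C2_add[OF C2_add[OF assms C2_scale[OF C2_norm_sq]] C2_const] C2_open[OF assms]
  by (simp add: mat_eq_scaleR[of 2] mult.commute)

lemma C2_affine_change:
  fixes \<phi> :: "real^'n \<Rightarrow> real" and A :: "real^'n^'n"
  assumes "C2_with_hessian_on V \<phi> H"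
  shows "C2_with_hessian_on {x. A *v x \<in> V} (\<lambda>x. \<phi> (A *v x)) (\<lambda>x. transpose A ** H (A *v x) ** A)"
proof -
  obtain g where g: "open V" "continuous_on V H"
    "\<And>x. x \<in> V \<Longrightarrow> (\<phi> has_derivative (\<lambda>h. g x \<bullet> h)) (at x)"
    "\<And>x. x \<in> V \<Longrightarrow> (g has_derivative (\<lambda>h. H x *v h)) (at x)"
    by (rule C2E[OF assms(1)]) blast
  have A: "((*v) A has_derivative (*v) A) (at x)" for x
    by (rule bounded_linear_imp_has_derivative) (rule matrix_vector_mul_bounded_linear)
  have op: "open {x. A *v x \<in> V}"
    using open_vimage[OF g(1), of "(*v) A"]
    by (simp add: vimage_def linear_continuous_on matrix_vector_mul_bounded_linear)
  show ?thesis
  proof (rule C2I[where g = "\<lambda>x. transpose A *v g (A *v x)"])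
    have H: "continuous_on {x. A *v x \<in> V} (\<lambda>x. H (A *v x))"
      by (rule continuous_on_compose2[OF g(2)]) (auto intro!: linear_continuous_on matrix_vector_mul_bounded_linear)
    show "continuous_on {x. A *v x \<in> V} (\<lambda>x. transpose A ** H (A *v x) ** A)"
      unfolding matrix_matrix_mult_def using H
      by (auto intro!: continuous_intros continuous_on_vec_lambda continuous_on_component)
  next
    fix x assume "x \<in> {x. A *v x \<in> V}"
    then have x: "A *v x \<in> V" by simp
    have "((\<lambda>x. \<phi> (A *v x)) has_derivative (\<lambda>h. g (A *v x) \<bullet> (A *v h))) (at x)"
      using has_derivative_compose[OF A g(3)[OF x]] .
    then show "((\<lambda>x. \<phi> (A *v x)) has_derivative (\<lambda>h. (transpose A *v g (A *v x)) \<bullet> h)) (at x)"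
      by (simp add: dot_lmul_matrix transpose_matrix_vector)
    have "((\<lambda>x. g (A *v x)) has_derivative (\<lambda>h. H (A *v x) *v (A *v h))) (at x)"
      using has_derivative_compose[OF A g(4)[OF x]] .
    from bounded_linear.has_derivative[OF matrix_vector_mul_bounded_linear this, of "transpose A"]
    show "((\<lambda>x. transpose A *v g (A *v x)) has_derivative
        (\<lambda>h. (transpose A ** H (A *v x) ** A) *v h)) (at x)"
      by (simp add: matrix_vector_mul_assoc matrix_mul_assoc)
  qed (use op in auto)
qed

lemma line_proj_component: "line_proj e $ i $ j = e $ i * (e::real^'n) $ j"
proof -
  have "line_proj e $ i $ j = (line_proj e *v axis j 1) $ i"
    by (simp add: matrix_vector_mult_basis column_def)
  also have "\<dots> = e $ i * e $ j"
    by (simp add: line_proj_mult_vec inner_axis)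
  finally show ?thesis .
qed

text \<open>With \<open>a = 2 - q\<close> the matrix in the Hessian is \<open>I - q P\<^sub>e\<close> for the radial direction \<open>e\<close>, the matrix
  that defines the Riesz characteristic.\<close>

lemma C2_norm_powr:
  fixes y :: "real^'n"
  shows "C2_with_hessian_on (- {y}) (\<lambda>x. norm (x - y) powr a)
    (\<lambda>x. (a * norm (x - y) powr (a - 2)) *\<^sub>R (mat 1 - (2 - a) *\<^sub>R line_proj (sgn (x - y))))"
proof (rule C2I[where g = "\<lambda>x. (a * norm (x - y) powr (a - 2)) *\<^sub>R (x - y)"])
  have eq: "line_proj e = (\<chi> i j. e $ i * e $ j)" for e :: "real^'n"
    by (simp add: vec_eq_iff line_proj_component)
  have "continuous_on (- {y}) (\<lambda>x. sgn (x - y))"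
    by (auto simp: sgn_div_norm intro!: continuous_intros)
  then have "continuous_on (- {y}) (\<lambda>x. line_proj (sgn (x - y)))"
    unfolding eq by (intro continuous_on_vec_lambda continuous_on_mult continuous_on_component)
  then show "continuous_on (- {y}) (\<lambda>x. (a * norm (x - y) powr (a - 2)) *\<^sub>R
        (mat 1 - (2 - a) *\<^sub>R line_proj (sgn (x - y))))"
    by (auto intro!: continuous_intros)
next
  fix x assume "x \<in> - {y}"
  then have nz: "norm (x - y) > 0" by simp
  have d: "((\<lambda>x. norm (x - y) powr b) has_derivative
      (\<lambda>h. (b * norm (x - y) powr (b - 2)) * ((x - y) \<bullet> h))) (at x)" for b
  proof -
    have "((\<lambda>x. norm (x - y)) has_derivative (\<lambda>h. sgn (x - y) \<bullet> h)) (at x)"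
    proof -
      have "((\<lambda>x. x - y) has_derivative (\<lambda>h. h)) (at x)"
        by (auto intro!: derivative_eq_intros)
      from has_derivative_compose[OF this has_derivative_norm] nz show ?thesis
        by (simp add: inner_commute)
    qed
    then have "((\<lambda>x. norm (x - y) powr b) has_derivative
      (\<lambda>h. norm (x - y) powr b * (0 * ln (norm (x - y)) + (sgn (x - y) \<bullet> h) * b / norm (x - y)))) (at x)"
      using has_derivative_powr[of "\<lambda>x. norm (x - y)" _ x UNIV "\<lambda>_. b" "\<lambda>_. 0"] nz by auto
    moreover have "norm (x - y) powr b * (0 * ln (norm (x - y)) + (sgn (x - y) \<bullet> h) * b / norm (x - y))
       = (b * norm (x - y) powr (b - 2)) * ((x - y) \<bullet> h)" for h
    proof -
      have "sgn (x - y) \<bullet> h = ((x - y) \<bullet> h) / norm (x - y)"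
        by (simp add: sgn_div_norm divide_inverse mult.commute)
      then show ?thesis
        using nz by (simp add: powr_diff power2_eq_square)
    qed
    ultimately show ?thesis by simp
  qed
  show "((\<lambda>x. norm (x - y) powr a) has_derivative
      (\<lambda>h. ((a * norm (x - y) powr (a - 2)) *\<^sub>R (x - y)) \<bullet> h)) (at x)"
    using d[of a] by simp
  have "((\<lambda>x. (a * norm (x - y) powr (a - 2)) *\<^sub>R (x - y)) has_derivative
     (\<lambda>h. (a * norm (x - y) powr (a - 2)) *\<^sub>R h +
       (a * (((a - 2) * norm (x - y) powr (a - 2 - 2)) * ((x - y) \<bullet> h))) *\<^sub>R (x - y))) (at x)"
    by (rule derivative_eq_intros d refl | simp)+
  moreover have "(a * norm (x - y) powr (a - 2)) *\<^sub>R h +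
       (a * (((a - 2) * norm (x - y) powr (a - 2 - 2)) * ((x - y) \<bullet> h))) *\<^sub>R (x - y)
      = ((a * norm (x - y) powr (a - 2)) *\<^sub>R (mat 1 - (2 - a) *\<^sub>R line_proj (sgn (x - y)))) *v h" for h
  proof -
    define z where "z = x - y"
    have "line_proj (sgn z) *v h = ((z \<bullet> h) / norm z ^ 2) *\<^sub>R z"
      by (simp add: line_proj_mult_vec sgn_div_norm power2_eq_square divide_inverse mult.commute
          mult.left_commute)
    then have "((a * norm z powr (a - 2)) *\<^sub>R (mat 1 - (2 - a) *\<^sub>R line_proj (sgn z))) *v h
      = (a * norm z powr (a - 2)) *\<^sub>R h
        + (a * norm z powr (a - 2) * (a - 2) * ((z \<bullet> h) / norm z ^ 2)) *\<^sub>R z"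
      by (simp add: scaleR_matrix_vector_assoc[symmetric] matrix_vector_mult_diff_rdistrib algebra_simps)
    moreover have "norm z powr (a - 2 - 2) = norm z powr (a - 2) / norm z ^ 2"
      using nz by (subst powr_diff) (simp add: z_def)
    ultimately show ?thesis
      unfolding z_def by simp
  qed
  ultimately show "((\<lambda>x. (a * norm (x - y) powr (a - 2)) *\<^sub>R (x - y)) has_derivative
     (\<lambda>h. ((a * norm (x - y) powr (a - 2)) *\<^sub>R (mat 1 - (2 - a) *\<^sub>R line_proj (sgn (x - y)))) *v h)) (at x)"
    by simp
qed auto

lemma derivative_error_bound:
  fixes g :: "'a::real_normed_vector \<Rightarrow> 'b::real_normed_vector"
  assumes "(g has_derivative g') (at x)" "0 < \<epsilon>" "open V" "x \<in> V"
  obtains d where "0 < d" "ball x d \<subseteq> V"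
    "\<And>y. y \<in> ball x d \<Longrightarrow> norm (g y - g x - g' (y - x)) \<le> \<epsilon> * norm (y - x)"
proof -
  obtain d1 where d1: "0 < d1" "\<And>y. norm (y - x) < d1 \<Longrightarrow> norm (g y - g x - g' (y - x)) \<le> \<epsilon> * norm (y - x)"
    using assms(1,2) unfolding has_derivative_at_alt by blast
  obtain d2 where d2: "0 < d2" "ball x d2 \<subseteq> V"
    using assms(3,4) open_contains_ball by blast
  show thesis
    by (rule that[of "min d1 d2"]) (use d1 d2 in \<open>auto simp: dist_norm norm_minus_commute\<close>)
qed

text \<open>The mean value theorem on the segment from \<open>x\<close> to \<open>x + a\<close>, applied to the difference of
  \<open>\<phi> (y + b)\<close> and \<open>\<phi> y\<close>, turns the second difference quotient into a difference of gradients, which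
  differentiability of the gradient at the single point \<open>x\<close> controls.\<close>

lemma C2_second_difference:
  fixes \<phi> :: "real^'n \<Rightarrow> real"
  assumes C2: "C2_with_hessian_on V \<phi> H" and x: "x \<in> V" and \<epsilon>: "0 < \<epsilon>"
  obtains d where "0 < d" "ball x d \<subseteq> V"
    "\<And>a b. norm a + norm b < d \<Longrightarrow>
      \<bar>\<phi> (x + a + b) - \<phi> (x + a) - \<phi> (x + b) + \<phi> x - a \<bullet> (H x *v b)\<bar> \<le> 2 * \<epsilon> * (norm a + norm b)\<^sup>2"
proof -
  obtain g where g: "open V"
    "\<And>x. x \<in> V \<Longrightarrow> (\<phi> has_derivative (\<lambda>h. g x \<bullet> h)) (at x)"
    "\<And>x. x \<in> V \<Longrightarrow> (g has_derivative (\<lambda>h. H x *v h)) (at x)"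
    by (rule C2E[OF C2]) blast
  obtain d where d: "0 < d" "ball x d \<subseteq> V"
    "\<And>y. y \<in> ball x d \<Longrightarrow> norm (g y - g x - H x *v (y - x)) \<le> \<epsilon> * norm (y - x)"
    using derivative_error_bound[OF g(3)[OF x] \<epsilon> g(1) x] by blast
  show thesis
  proof (rule that[OF d(1,2)])
    fix a b :: "real^'n" assume n_less: "norm a + norm b < d"
    define n where "n = norm a + norm b"
    define y where "y c s = x + (s *\<^sub>R a + c)" for c s
    have small: "norm (y c s - x) \<le> n" if "0 \<le> s" "s \<le> 1" "c = 0 \<or> c = b" for c s
    proof -
      have "norm (s *\<^sub>R a + c) \<le> norm (s *\<^sub>R a) + norm c" by (rule norm_triangle_ineq)
      also have "\<dots> \<le> norm a + norm b"
        using that by (intro add_mono) (auto simp: mult_left_le_one_le)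
      finally show ?thesis by (simp add: y_def n_def)
    qed
    have inb: "y c s \<in> ball x d" if "0 \<le> s" "s \<le> 1" "c = 0 \<or> c = b" for c s
      using small[OF that] n_less by (simp add: n_def dist_norm norm_minus_commute)
    have der: "((\<lambda>s. \<phi> (y c s)) has_derivative (\<lambda>h. g (y c s) \<bullet> (h *\<^sub>R a))) (at s)"
      if "0 \<le> s" "s \<le> 1" "c = 0 \<or> c = b" for s c
    proof -
      have "(y c has_derivative (\<lambda>h. h *\<^sub>R a)) (at s)"
        unfolding y_def by (auto intro!: derivative_eq_intros)
      from has_derivative_compose[OF this g(2)] inb[OF that] d(2) show ?thesis by auto
    qed
    define k where "k s = \<phi> (y b s) - \<phi> (y 0 s)" for s
    have "\<exists>s\<in>{0<..<1}. k 1 - k 0 = (\<lambda>h. g (y b s) \<bullet> (h *\<^sub>R a) - g (y 0 s) \<bullet> (h *\<^sub>R a)) (1 - 0)"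
      unfolding k_def
      by (rule mvt_simple[OF zero_less_one]) (rule has_derivative_at_withinI[OF has_derivative_diff[OF der der]]; simp)
    then obtain s where s: "0 < s" "s < 1" and ks: "k 1 - k 0 = a \<bullet> (g (y b s) - g (y 0 s))"
      by (auto simp: inner_diff_right inner_commute)
    have err: "norm (g (y c s) - g x - H x *v (y c s - x)) \<le> \<epsilon> * n" if "c = 0 \<or> c = b" for c
      using order_trans[OF d(3)[OF inb] mult_left_mono[OF small]] s \<epsilon> that by simp
    have "H x *v (y b s - x) - H x *v (y 0 s - x) = H x *v b"
      unfolding y_def matrix_vector_mult_diff_distrib[symmetric] by simp
    then have "norm (g (y b s) - g (y 0 s) - H x *v b) \<le> 2 * (\<epsilon> * n)"
      using norm_triangle_ineq4[of "g (y b s) - g x - H x *v (y b s - x)" "g (y 0 s) - g x - H x *v (y 0 s - x)"]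
        err[of 0] err[of b] by (simp add: algebra_simps)
    then have "norm a * norm (g (y b s) - g (y 0 s) - H x *v b) \<le> n * (2 * (\<epsilon> * n))"
      by (intro mult_mono) (auto simp: n_def)
    then have "\<bar>a \<bullet> (g (y b s) - g (y 0 s) - H x *v b)\<bar> \<le> n * (2 * (\<epsilon> * n))"
      by (rule order_trans[OF Cauchy_Schwarz_ineq2])
    moreover have "\<phi> (x + a + b) - \<phi> (x + a) - \<phi> (x + b) + \<phi> x = k 1 - k 0"
      by (simp add: k_def y_def add.assoc)
    ultimately show "\<bar>\<phi> (x + a + b) - \<phi> (x + a) - \<phi> (x + b) + \<phi> x - a \<bullet> (H x *v b)\<bar>
        \<le> 2 * \<epsilon> * (norm a + norm b)\<^sup>2"
      unfolding ks by (simp add: inner_diff_right n_def power2_eq_square mult.left_commute mult.assoc)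
  qed
qed

text \<open>The second difference is symmetric in its two increments, so letting both shrink along fixed
  directions makes its limit, the Hessian form, symmetric.\<close>

lemma C2_hessian_symmetric:
  assumes C2: "C2_with_hessian_on V \<phi> H" and x: "x \<in> V"
  shows "H x \<in> Sym2"
proof -
  have sym: "v \<bullet> (H x *v w) = w \<bullet> (H x *v v)" for v w
  proof -
    define n where "n = norm v + norm w"
    have n: "0 \<le> n" by (simp add: n_def)
    have "\<bar>v \<bullet> (H x *v w) - w \<bullet> (H x *v v)\<bar> \<le> \<epsilon> * (4 * n\<^sup>2)" if \<epsilon>: "0 < \<epsilon>" for \<epsilon>
    proof -
      obtain d where d: "0 < d" "ball x d \<subseteq> V" "\<And>a b. norm a + norm b < d \<Longrightarrow>
        \<bar>\<phi> (x + a + b) - \<phi> (x + a) - \<phi> (x + b) + \<phi> x - a \<bullet> (H x *v b)\<bar> \<le> 2 * \<epsilon> * (norm a + norm b)\<^sup>2"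
        by (rule C2_second_difference[OF C2 x \<epsilon>]) (rule that)
      define t where "t = d / (n + 1)"
      have t: "0 < t" "t * (n + 1) = d" using d(1) n by (simp_all add: t_def add_nonneg_eq_0_iff)
      have tn: "norm (t *\<^sub>R v) + norm (t *\<^sub>R w) = t * n" "norm (t *\<^sub>R w) + norm (t *\<^sub>R v) = t * n"
        using t(1) by (simp_all add: n_def distrib_left)
      have "t * n < d" using t by (simp add: distrib_left)
      then have "\<bar>(t *\<^sub>R v) \<bullet> (H x *v (t *\<^sub>R w)) - (t *\<^sub>R w) \<bullet> (H x *v (t *\<^sub>R v))\<bar> \<le> 4 * \<epsilon> * (t * n)\<^sup>2"
        using d(3)[of "t *\<^sub>R v" "t *\<^sub>R w"] d(3)[of "t *\<^sub>R w" "t *\<^sub>R v"] unfolding tn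
        by (simp add: add.assoc add.commute[of "t *\<^sub>R w" "t *\<^sub>R v"])
      then have "t\<^sup>2 * \<bar>v \<bullet> (H x *v w) - w \<bullet> (H x *v v)\<bar> \<le> t\<^sup>2 * (\<epsilon> * (4 * n\<^sup>2))"
        by (simp add: matrix_vector_mult_scaleR right_diff_distrib[symmetric] abs_mult power2_eq_square ac_simps)
      then show ?thesis using t(1) by simp
    qed
    note bound = this
    have "\<bar>v \<bullet> (H x *v w) - w \<bullet> (H x *v v)\<bar> \<le> 0"
    proof (rule field_le_epsilon)
      fix e :: real assume e: "0 < e"
      define c where "c = 4 * n\<^sup>2 + 1"
      have c: "0 < c" "4 * n\<^sup>2 \<le> c" by (simp_all add: c_def add_nonneg_pos)
      have "\<bar>v \<bullet> (H x *v w) - w \<bullet> (H x *v v)\<bar> \<le> (e / c) * (4 * n\<^sup>2)"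
        using e c(1) by (intro bound) simp
      also have "\<dots> \<le> (e / c) * c" using e c by (intro mult_left_mono) auto
      also have "\<dots> = e" using c(1) by simp
      finally show "\<bar>v \<bullet> (H x *v w) - w \<bullet> (H x *v v)\<bar> \<le> 0 + e" by simp
    qed
    then show ?thesis by simp
  qed
  have comp: "axis i 1 \<bullet> (H x *v axis j 1) = H x $ i $ j" for i j
    by (simp add: matrix_vector_mult_basis column_def inner_axis')
  have "H x $ i $ j = H x $ j $ i" for i j
    using sym[of "axis i 1" "axis j 1"] unfolding comp .
  then show ?thesis
    by (simp add: Sym2_def transpose_def vec_eq_iff)
qed

lemma C2_local_min_psd:
  assumes C2: "C2_with_hessian_on V \<phi> H" and x: "x \<in> V" and min: "\<And>y. y \<in> V \<Longrightarrow> \<phi> x \<le> \<phi> y"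
  shows "H x \<in> psd"
proof -
  have "0 \<le> v \<bullet> (H x *v v)" for v
  proof (rule ccontr)
    assume neg: "\<not> 0 \<le> v \<bullet> (H x *v v)"
    then have v: "0 < norm v" by auto
    define \<epsilon> where "\<epsilon> = - (v \<bullet> (H x *v v)) / (16 * (norm v)\<^sup>2)"
    have \<epsilon>: "0 < \<epsilon>" using neg v by (simp add: \<epsilon>_def divide_neg_pos)
    obtain d where d: "0 < d" "ball x d \<subseteq> V" "\<And>a b. norm a + norm b < d \<Longrightarrow>
      \<bar>\<phi> (x + a + b) - \<phi> (x + a) - \<phi> (x + b) + \<phi> x - a \<bullet> (H x *v b)\<bar> \<le> 2 * \<epsilon> * (norm a + norm b)\<^sup>2"
      by (rule C2_second_difference[OF C2 x \<epsilon>]) (rule that)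
    define t where "t = d / (3 * norm v)"
    have t: "0 < t" "t * norm v = d / 3" using d(1) v by (simp_all add: t_def)
    \<comment> \<open>The second difference in the directions \<open>a\<close> and \<open>- a\<close> is twice \<open>\<phi> x\<close> minus two other values.\<close>
    have "x + t *\<^sub>R v \<in> V" "x - t *\<^sub>R v \<in> V"
      using t d(1,2) by (auto simp: subset_iff dist_norm)
    note mins = min[OF this(1)] min[OF this(2)]
    have "\<bar>\<phi> (x + t *\<^sub>R v + - (t *\<^sub>R v)) - \<phi> (x + t *\<^sub>R v) - \<phi> (x + - (t *\<^sub>R v)) + \<phi> x
        - (t *\<^sub>R v) \<bullet> (H x *v (- (t *\<^sub>R v)))\<bar> \<le> 2 * \<epsilon> * (norm (t *\<^sub>R v) + norm (- (t *\<^sub>R v)))\<^sup>2"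
      by (rule d(3)) (use t d(1) in simp)
    moreover have "(t *\<^sub>R v) \<bullet> (H x *v (- (t *\<^sub>R v))) = - (t\<^sup>2 * (v \<bullet> (H x *v v)))"
      by (simp add: linear_neg[OF matrix_vector_mul_linear] matrix_vector_mult_scaleR power2_eq_square)
    moreover have "norm (t *\<^sub>R v) + norm (- (t *\<^sub>R v)) = 2 * (t * norm v)" using t(1) by simp
    ultimately have "t\<^sup>2 * (- (v \<bullet> (H x *v v))) \<le> 2 * \<epsilon> * (2 * (t * norm v))\<^sup>2"
      using mins t(1) by (simp add: abs_le_iff)
    also have "\<dots> = t\<^sup>2 * (- (v \<bullet> (H x *v v)) / 2)"
      using v by (simp add: \<epsilon>_def power_mult_distrib)
    finally show False using t(1) neg by simp
  qed
  then show ?thesis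
    using C2_hessian_symmetric[OF C2 x] by (simp add: psd_def)
qed

lemma C2_touching_psd:
  assumes "C2_with_hessian_on V \<phi> H" "C2_with_hessian_on V \<psi> K"
    and "x \<in> V" "\<And>y. y \<in> V \<Longrightarrow> \<psi> y \<le> \<phi> y" "\<psi> x = \<phi> x"
  shows "H x - K x \<in> psd"
proof -
  have "C2_with_hessian_on V (\<lambda>y. \<phi> y + (-1) * \<psi> y) (\<lambda>y. H y + (-1) *\<^sub>R K y)"
    by (intro C2_add C2_scale assms)
  from C2_local_min_psd[OF this assms(3)] show ?thesis
    using assms(4,5) by simp
qed

section \<open>Comparison for viscosity subsolutions\<close>

lemma subharmonic_open: "subharmonic F X u \<Longrightarrow> open X"
  by (simp add: subharmonic_def)

lemma subharmonic_test:
  assumes "subharmonic F X u" "C2_with_hessian_on V \<phi> H" "x \<in> V" "V \<subseteq> X"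
    "\<And>y. y \<in> V \<Longrightarrow> u y \<le> ereal (\<phi> y)" "u x = ereal (\<phi> x)"
  shows "H x \<in> F"
proof -
  have "\<forall>x\<^sub>0\<in>X. \<forall>V \<phi> H. x\<^sub>0 \<in> V \<and> V \<subseteq> X \<and> C2_with_hessian_on V \<phi> H
         \<and> (\<forall>x\<in>V. u x \<le> ereal (\<phi> x)) \<and> u x\<^sub>0 = ereal (\<phi> x\<^sub>0) \<longrightarrow> H x\<^sub>0 \<in> F"
    using assms(1) unfolding subharmonic_def by blast
  then show ?thesis using assms(2-6) by blast
qed

text \<open>If no point were maximal, the relatively open sets on which the difference is less than its value
  at some \<open>y\<close> would cover \<open>K\<close>; in a finite subcover, the \<open>y\<close> with the largest value would lie in
  none of the sets.\<close>

lemma usc_minus_continuous_attains_max: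
  fixes u :: "real^'n \<Rightarrow> ereal"
  assumes K: "compact K" "K \<noteq> {}" "K \<subseteq> X" and u: "usc_on X u" "\<And>x. x \<in> X \<Longrightarrow> u x < \<infinity>"
    and \<psi>: "continuous_on K \<psi>"
  obtains x where "x \<in> K" "\<And>y. y \<in> K \<Longrightarrow> u y - ereal (\<psi> y) \<le> u x - ereal (\<psi> x)"
proof -
  define w where "w x = u x - ereal (\<psi> x)" for x
  have op: "openin (top_of_set K) {x \<in> K. w x < c}" for c
  proof -
    define S where "S d = {x \<in> K. u x < ereal d} \<inter> {x \<in> K. ereal d < c + ereal (\<psi> x)}" for d :: real
    have eq: "{x \<in> K. w x < c} = (\<Union>d::real. {x \<in> K. u x < ereal d} \<inter> {x \<in> K. ereal d < c + ereal (\<psi> x)})"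
    proof (intro equalityI subsetI)
      fix x assume x: "x \<in> {x \<in> K. w x < c}"
      then have "u x < c + ereal (\<psi> x)"
        unfolding w_def using u(2)[of x] K(3) by (cases "u x"; cases c) (auto simp: algebra_simps)
      then obtain d where "u x < ereal d" "ereal d < c + ereal (\<psi> x)"
        using ereal_dense2 by blast
      then show "x \<in> (\<Union>d::real. {x \<in> K. u x < ereal d} \<inter> {x \<in> K. ereal d < c + ereal (\<psi> x)})"
        using x by auto
    next
      fix x assume "x \<in> (\<Union>d::real. {x \<in> K. u x < ereal d} \<inter> {x \<in> K. ereal d < c + ereal (\<psi> x)})"
      then obtain d where d: "x \<in> K" "u x < ereal d" "ereal d < c + ereal (\<psi> x)" by auto
      then show "x \<in> {x \<in> K. w x < c}"
        unfolding w_def by (cases "u x"; cases c) (auto simp: algebra_simps)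
    qed
    have "openin (top_of_set K) {x \<in> K. u x < ereal d}" for d
    proof -
      have "openin (top_of_set X) {x \<in> X. u x < ereal d}"
        using u(1) unfolding usc_on_def by blast
      then obtain T where "open T" "{x \<in> X. u x < ereal d} = X \<inter> T"
        unfolding openin_open by blast
      then have "{x \<in> K. u x < ereal d} = K \<inter> T" using K(3) by blast
      then show ?thesis using \<open>open T\<close> by (auto simp: openin_open)
    qed
    moreover have "openin (top_of_set K) {x \<in> K. ereal d < c + ereal (\<psi> x)}" for d
    proof (cases c)
      case (real r)
      have "{x \<in> K. ereal d < c + ereal (\<psi> x)} = K \<inter> \<psi> -` {d - r<..}"
        using real by auto
      then show ?thesis
        using continuous_openin_preimage_gen[OF \<psi>, of "{d - r<..}"] by simp
    qed auto
    ultimately have op: "openin (top_of_set K) (S d)" for d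
      unfolding S_def by (rule openin_Int)
    have "openin (top_of_set K) (\<Union>(range S))"
      by (rule openin_Union) (use op in auto)
    then show ?thesis
      unfolding eq S_def .
  qed
  have "\<exists>x\<in>K. \<forall>y\<in>K. w y \<le> w x"
  proof (rule ccontr)
    assume "\<not> ?thesis"
    then have no: "\<forall>x\<in>K. \<exists>y\<in>K. w x < w y" by (meson not_le)
    define \<C> where "\<C> = (\<lambda>y. {x \<in> K. w x < w y}) ` K"
    have "\<forall>c\<in>\<C>. openin (top_of_set K) c"
      unfolding \<C>_def using op by blast
    moreover have "K \<subseteq> \<Union>\<C>"
      unfolding \<C>_def using no by blast
    ultimately obtain \<D> where D: "\<D> \<subseteq> \<C>" "finite \<D>" "K \<subseteq> \<Union>\<D>"
      using K(1)[unfolded compact_eq_openin_cover, THEN spec, of \<C>] by auto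
    then obtain Y where Y: "finite Y" "Y \<subseteq> K" "\<D> = (\<lambda>y. {x \<in> K. w x < w y}) ` Y"
      unfolding \<C>_def by (meson finite_subset_image)
    have "Y \<noteq> {}" using K(2) D(3) Y(3) by auto
    define m where "m = Max (w ` Y)"
    have "m \<in> w ` Y" unfolding m_def using Y(1) \<open>Y \<noteq> {}\<close> by (intro Max_in) auto
    then obtain y where y: "y \<in> Y" "w y = m" by auto
    then obtain z where z: "z \<in> Y" "w y < w z" using D(3) Y(2,3) by blast
    then have "w z \<le> m" unfolding m_def using Y(1) by auto
    then show False using z y by auto
  qed
  then obtain x where "x \<in> K" "\<And>y. y \<in> K \<Longrightarrow> w y \<le> w x" by blast
  then show thesis by (rule that[unfolded w_def[symmetric]])
qed

text \<open>At an interior maximum of \<open>u - \<psi>\<close> a vertical translate of \<open>\<psi>\<close> would be a test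
  function whose Hessian lies outside \<open>F\<close>.\<close>

lemma subharmonic_comparison:
  assumes u: "subharmonic F X u" and K: "compact K" "K \<subseteq> X" and D: "D \<subseteq> K"
    and \<psi>: "continuous_on K \<psi>" "C2_with_hessian_on D \<psi> H" "\<And>x. x \<in> D \<Longrightarrow> H x \<notin> F"
    and bd: "\<And>x. x \<in> K - D \<Longrightarrow> u x \<le> ereal (\<psi> x)" and x: "x \<in> K"
  shows "u x \<le> ereal (\<psi> x)"
proof (rule ccontr)
  assume not_le: "\<not> u x \<le> ereal (\<psi> x)"
  have fin: "\<And>x. x \<in> X \<Longrightarrow> u x < \<infinity>" and usc: "usc_on X u"
    using u by (auto simp: subharmonic_def)
  obtain z where z: "z \<in> K" "\<And>y. y \<in> K \<Longrightarrow> u y - ereal (\<psi> y) \<le> u z - ereal (\<psi> z)"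
    using usc_minus_continuous_attains_max[OF K(1) _ K(2) usc fin \<psi>(1)] x by blast
  have pos: "0 < u x - ereal (\<psi> x)"
    using not_le by (cases "u x") auto
  then have "0 < u z - ereal (\<psi> z)"
    using z(2)[OF x] by (rule less_le_trans)
  then obtain r where r: "u z = ereal r" "\<psi> z < r"
    using fin[of z] z(1) K(2) by (cases "u z") auto
  then have "z \<in> D"
    using bd[of z] z(1) by auto
  have "C2_with_hessian_on D (\<lambda>y. \<psi> y + (r - \<psi> z)) (\<lambda>y. H y + 0)"
    using \<psi>(2) by (intro C2_add C2_const C2_open[OF \<psi>(2)])
  then have "H z + 0 \<in> F"
  proof (rule subharmonic_test[OF u])
    show "u y \<le> ereal (\<psi> y + (r - \<psi> z))" if "y \<in> D" for y
      using z(2)[of y] that D r by (cases "u y") (auto simp: algebra_simps)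
  qed (use \<open>z \<in> D\<close> D K r in auto)
  then show False using \<psi>(3)[OF \<open>z \<in> D\<close>] by simp
qed

lemma subharmonic_ereal_iff:
  fixes u :: "real^'n \<Rightarrow> real"
  assumes "continuous_on X u"
  shows "subharmonic F X (\<lambda>x. ereal (u x)) \<longleftrightarrow> open X \<and>
    (\<forall>x V \<phi> H. C2_with_hessian_on V \<phi> H \<and> x \<in> V \<and> V \<subseteq> X \<and> (\<forall>y\<in>V. u y \<le> \<phi> y) \<and> u x = \<phi> x
       \<longrightarrow> H x \<in> F)"
proof -
  have "openin (top_of_set X) {x \<in> X. ereal (u x) < c}" for c
  proof -
    have "continuous_on X (\<lambda>x. ereal (u x))"
      using assms by (intro continuous_intros)
    from continuous_openin_preimage_gen[OF this, of "{..<c}"] show ?thesis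
      by (simp add: vimage_def Int_def)
  qed
  then have "usc_on X (\<lambda>x. ereal (u x))" by (simp add: usc_on_def)
  moreover have "\<forall>C\<in>components X. \<exists>x\<in>C. ereal (u x) \<noteq> - \<infinity>"
    using in_components_nonempty by fastforce
  ultimately show ?thesis
    unfolding subharmonic_def by (auto; blast)
qed

lemma subharmonic_smooth:
  assumes C2: "C2_with_hessian_on X u H" and F: "\<And>x. x \<in> X \<Longrightarrow> H x \<in> F"
    and mono: "\<And>A P. A \<in> F \<Longrightarrow> P \<in> psd \<Longrightarrow> A + P \<in> F"
  shows "subharmonic F X (\<lambda>x. ereal (u x))"
  unfolding subharmonic_ereal_iff[OF C2_continuous_on[OF C2]]
proof (intro conjI allI impI; (elim conjE)?)
  show "open X" using C2_open[OF C2] .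
  fix x V \<phi> K
  assume *: "C2_with_hessian_on V \<phi> K" "x \<in> V" "V \<subseteq> X" "\<forall>y\<in>V. u y \<le> \<phi> y" "u x = \<phi> x"
  then have "K x - H x \<in> psd"
    using C2_touching_psd[OF *(1) C2_subset[OF C2 *(3) C2_open[OF *(1)]] *(2)] by auto
  from mono[OF F this, of x] show "K x \<in> F" using * by auto
qed

text \<open>The comparison functions are \<open>\<psi> + \<eta> (R\<^sup>2 - |x - y|\<^sup>2)\<close>, which agree with \<open>\<psi>\<close> on the sphere; then \<open>\<eta>\<close>
  tends to \<open>0\<close>.\<close>

lemma subharmonic_comparison_ball:
  assumes u: "subharmonic F X u" and R: "cball y R \<subseteq> X"
    and \<psi>: "continuous_on (cball y R) \<psi>" "C2_with_hessian_on (ball y R) \<psi> H"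
    and notin: "\<And>x \<eta>. x \<in> ball y R \<Longrightarrow> 0 < \<eta> \<Longrightarrow> H x + (2 * - \<eta>) *\<^sub>R mat 1 \<notin> F"
    and bd: "\<And>x. x \<in> sphere y R \<Longrightarrow> u x \<le> ereal (\<psi> x)" and x: "x \<in> cball y R"
  shows "u x \<le> ereal (\<psi> x)"
proof -
  have *: "u x \<le> ereal (\<psi> x + (- \<eta>) * (norm (x - y))\<^sup>2 + \<eta> * R\<^sup>2)" if \<eta>: "0 < \<eta>" for \<eta>
  proof (rule subharmonic_comparison[OF u compact_cball R ball_subset_cball _ C2_add_norm_sq[OF \<psi>(2)] _ _ x])
    show "continuous_on (cball y R) (\<lambda>x. \<psi> x + - \<eta> * (norm (x - y))\<^sup>2 + \<eta> * R\<^sup>2)"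
      using \<psi>(1) by (intro continuous_intros)
  qed (use bd notin \<eta> in \<open>auto simp: dist_norm norm_minus_commute\<close>)
  show ?thesis
  proof (cases "u x")
    case (real r)
    have "((\<lambda>\<eta>. \<psi> x + (- \<eta>) * (norm (x - y))\<^sup>2 + \<eta> * R\<^sup>2) \<longlongrightarrow> \<psi> x + (- 0) * (norm (x - y))\<^sup>2 + 0 * R\<^sup>2) (at_right 0)"
      by (intro tendsto_intros)
    moreover have "eventually (\<lambda>\<eta>. r \<le> \<psi> x + (- \<eta>) * (norm (x - y))\<^sup>2 + \<eta> * R\<^sup>2) (at_right 0)"
      using * real by (auto simp: eventually_at_filter)
    ultimately have "r \<le> \<psi> x + (- 0) * (norm (x - y))\<^sup>2 + 0 * R\<^sup>2"
      by (rule tendsto_lowerbound) simp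
    then show ?thesis using real by simp
  qed (use *[of 1] in auto)
qed

lemma max_principle:
  assumes u: "subharmonic F X u" and cone: "cone F" "- mat 1 \<notin> F"
    and R: "cball y R \<subseteq> X" and bd: "\<And>x. x \<in> sphere y R \<Longrightarrow> u x \<le> ereal M"
    and x: "x \<in> cball y R"
  shows "u x \<le> ereal M"
proof (rule subharmonic_comparison_ball[OF u R continuous_on_const C2_const[OF open_ball] _ bd x])
  fix \<eta> :: real assume \<eta>: "0 < \<eta>"
  show "0 + (2 * - \<eta>) *\<^sub>R mat 1 \<notin> F"
  proof
    assume "0 + (2 * - \<eta>) *\<^sub>R mat 1 \<in> F"
    then have "(1 / (2 * \<eta>)) *\<^sub>R (0 + (2 * - \<eta>) *\<^sub>R mat 1) \<in> F"
      using cone(1) \<eta> unfolding cone_def by (meson divide_nonneg_pos less_eq_real_def mult_pos_pos zero_less_numeral zero_le_one)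
    then show False using cone(2) \<eta> by simp
  qed
qed

lemma symmetric_near_identity_psd:
  fixes B :: "real^'n^'n"
  assumes "B \<in> Sym2"
  shows "\<exists>K>0. mat 1 + (1 / K) *\<^sub>R B \<in> psd"
proof -
  obtain K where K: "K > 0" "\<And>x. norm (B *v x) \<le> norm x * K"
    using bounded_linear.pos_bounded[OF matrix_vector_mul_bounded_linear[of B]] by blast
  have "mat 1 + (1 / K) *\<^sub>R B \<in> psd"
    unfolding psd_def
  proof (intro CollectI conjI allI)
    show "mat 1 + (1 / K) *\<^sub>R B \<in> Sym2"
      using assms by (auto simp: Sym2_def transpose_def vec_eq_iff mat_def)
    fix x
    have "\<bar>x \<bullet> (B *v x)\<bar> \<le> norm x * (norm x * K)"
      by (rule order_trans[OF Cauchy_Schwarz_ineq2 mult_left_mono[OF K(2) norm_ge_zero]])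
    then have "\<bar>x \<bullet> (B *v x)\<bar> / K \<le> x \<bullet> x"
      using K(1) by (simp add: divide_le_eq power2_norm_eq_inner[symmetric] power2_eq_square mult.assoc)
    then have "- (x \<bullet> x) \<le> (x \<bullet> (B *v x)) / K"
      using K(1) by (simp add: abs_if divide_le_eq le_divide_eq split: if_splits)
    then show "0 \<le> x \<bullet> ((mat 1 + (1 / K) *\<^sub>R B) *v x)"
      by (simp add: matrix_vector_mult_add_rdistrib scaleR_matrix_vector_assoc[symmetric] inner_add_right)
  qed
  then show ?thesis using K(1) by blast
qed

text \<open>Adding to \<open>- I\<close> a positive semidefinite matrix close to \<open>I\<close> and rescaling would reach every
  symmetric matrix.\<close>

lemma subequation_cone_minus_id:
  fixes F :: "(real^'n^'n) set"
  assumes "subequation F" "cone F"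
  shows "- mat 1 \<notin> F"
proof
  assume I: "- mat 1 \<in> F"
  obtain B where B: "B \<in> Sym2" "B \<notin> F"
    using assms(1) by (auto simp: subequation_def)
  obtain K where K: "K > 0" "mat 1 + (1 / K) *\<^sub>R B \<in> psd"
    using symmetric_near_identity_psd[OF B(1)] by blast
  have "- mat 1 + (mat 1 + (1 / K) *\<^sub>R B) \<in> F"
    using assms(1) I K(2) unfolding subequation_def by blast
  then have "K *\<^sub>R (- mat 1 + (mat 1 + (1 / K) *\<^sub>R B)) \<in> F"
    using assms(2) K(1) unfolding cone_def by (meson less_eq_real_def)
  then show False using B(2) K(1) by simp
qed

text \<open>The hypothesis on \<open>F\<close> below is what the Riesz characteristic \<open>p\<close> provides: the functions
  \<open>c + C |x - y|\<^sup>2\<^sup>-\<^sup>q\<close> with \<open>p < q < 2\<close> and \<open>C > 0\<close> have Hessians outside \<open>F\<close>.\<close>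

locale riesz_cone =
  fixes F :: "(real^'n^'n) set" and p :: real
  assumes subeq: "subequation F" and cone: "cone F" and p_less_2: "p < 2"
    and riesz: "\<And>q e. p < q \<Longrightarrow> norm e = 1 \<Longrightarrow> mat 1 - q *\<^sub>R line_proj e \<notin> F"
begin

lemma closed_F: "closed F" and F_mono: "A \<in> F \<Longrightarrow> P \<in> psd \<Longrightarrow> A + P \<in> F"
  using subeq by (auto simp: subequation_def)

lemma F_scale: "A \<in> F \<Longrightarrow> 0 \<le> c \<Longrightarrow> c *\<^sub>R A \<in> F"
  using cone by (simp add: cone_def)

lemma F_scale_iff: "0 < c \<Longrightarrow> c *\<^sub>R A \<in> F \<longleftrightarrow> A \<in> F"
  using F_scale[of A c] F_scale[of "c *\<^sub>R A" "1 / c"] by auto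

text \<open>This estimate drives the whole development. For \<open>q > p\<close> in place of \<open>p\<close> the right-hand side is a
  strict supersolution on the punctured ball, whose boundary consists of the pole and the sphere,
  where it dominates \<open>u\<close>. Then \<open>q\<close> decreases to \<open>p\<close>.\<close>

lemma pole_comparison:
  assumes u: "subharmonic F X u" and R: "0 < R" "cball y R \<subseteq> X"
    and bd: "\<And>x. x \<in> sphere y R \<Longrightarrow> u x \<le> ereal M" and m: "u y \<le> ereal m" "m < M"
    and x: "x \<in> cball y R"
  shows "u x \<le> ereal (m + (M - m) * (norm (x - y) / R) powr (2 - p))"
proof -
  have *: "u x \<le> ereal (m + (M - m) * (norm (x - y) / R) powr (2 - q))" if q: "p < q" "q < 2" for q
  proof -
    define C where "C = (M - m) / R powr (2 - q)"
    have C: "C > 0" using R(1) m(2) by (simp add: C_def)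
    have psi: "m + C * norm (x - y) powr (2 - q) = m + (M - m) * (norm (x - y) / R) powr (2 - q)" for x
      using R(1) by (simp add: C_def powr_divide)
    have cont: "continuous_on (cball y R) (\<lambda>x. m + C * norm (x - y) powr (2 - q))"
      using q by (intro continuous_intros continuous_on_powr') auto
    let ?D = "ball y R - {y}"
    have "C2_with_hessian_on ?D (\<lambda>x. norm (x - y) powr (2 - q))
      (\<lambda>x. ((2 - q) * norm (x - y) powr (2 - q - 2)) *\<^sub>R (mat 1 - (2 - (2 - q)) *\<^sub>R line_proj (sgn (x - y))))"
      by (rule C2_subset[OF C2_norm_powr]) auto
    then have C2: "C2_with_hessian_on ?D (\<lambda>x. m + C * norm (x - y) powr (2 - q))
      (\<lambda>x. 0 + C *\<^sub>R ((2 - q) * norm (x - y) powr (2 - q - 2)) *\<^sub>R (mat 1 - (2 - (2 - q)) *\<^sub>R line_proj (sgn (x - y))))"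
      by (intro C2_add C2_scale C2_const) auto
    have "u x \<le> ereal (m + C * norm (x - y) powr (2 - q))"
    proof (rule subharmonic_comparison[OF u compact_cball R(2) _ cont C2 _ _ x])
      fix z assume z: "z \<in> ?D"
      then have "norm (sgn (z - y)) = 1" by (auto simp: norm_sgn)
      from riesz[OF q(1) this] show
        "0 + C *\<^sub>R ((2 - q) * norm (z - y) powr (2 - q - 2)) *\<^sub>R (mat 1 - (2 - (2 - q)) *\<^sub>R line_proj (sgn (z - y))) \<notin> F"
        using C q z by (simp add: F_scale_iff)
    next
      fix z assume "z \<in> cball y R - ?D"
      then consider "z = y" | "z \<in> sphere y R" by fastforce
      then show "u z \<le> ereal (m + C * norm (z - y) powr (2 - q))"
      proof cases
        case 2
        then have "norm (z - y) = R" by (simp add: dist_norm norm_minus_commute)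
        then show ?thesis using bd[OF 2] R(1) by (simp add: C_def)
      qed (use m in simp)
    qed auto
    then show ?thesis unfolding psi .
  qed
  have ev: "eventually (\<lambda>q. p < q \<and> q < 2) (at_right p)"
    using p_less_2 eventually_at_right by blast
  show ?thesis
  proof (cases "u x")
    case (real r)
    have "((\<lambda>q. m + (M - m) * (norm (x - y) / R) powr (2 - q)) \<longlongrightarrow> m + (M - m) * (norm (x - y) / R) powr (2 - p)) (at_right p)"
    proof (cases "x = y")
      case False
      then show ?thesis using R(1) by (intro tendsto_intros) auto
    qed auto
    then have "r \<le> m + (M - m) * (norm (x - y) / R) powr (2 - p)"
      by (rule tendsto_lowerbound) (use * real in \<open>auto intro: eventually_mono[OF ev]\<close>)
    then show ?thesis using real by simp
  next
    case PInf
    obtain q where "p < q" "q < 2" using dense[OF p_less_2] by blast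
    from *[OF this] PInf show ?thesis by simp
  qed auto
qed

end

section \<open>Hoelder continuity\<close>

context riesz_cone
begin

lemma subharmonic_bounded_above:
  assumes u: "subharmonic F X u" and K: "compact K" "K \<subseteq> X"
  obtains M where "\<And>x. x \<in> K \<Longrightarrow> u x < ereal M"
proof (cases "K = {}")
  case False
  have fin: "\<And>x. x \<in> X \<Longrightarrow> u x < \<infinity>" and usc: "usc_on X u"
    using u by (auto simp: subharmonic_def)
  obtain z where z: "z \<in> K" "\<And>y. y \<in> K \<Longrightarrow> u y - ereal 0 \<le> u z - ereal 0"
    using usc_minus_continuous_attains_max[OF K(1) False K(2) usc fin continuous_on_const[of K "0::real"]]
    by blast
  obtain M where M: "u z < ereal M"
    using ereal_dense2[OF fin[of z]] z(1) K(2) by blast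
  show thesis
    by (rule that[of M]) (use z M in \<open>auto intro: le_less_trans\<close>)
qed (use that in blast)

text \<open>Letting \<open>m \<rightarrow> -\<infinity>\<close> in the comparison with poles, the value \<open>-\<infinity>\<close> at one point spreads
  to a ball of fixed size, hence to a whole component.\<close>

lemma subharmonic_minus_infinity_spreads:
  assumes u: "subharmonic F X u" and R: "0 < R" "cball y R \<subseteq> X" and y: "u y = -\<infinity>"
    and x: "x \<in> ball y R"
  shows "u x = -\<infinity>"
proof (rule ccontr)
  assume "u x \<noteq> -\<infinity>"
  moreover have "x \<in> X" using x R(2) ball_subset_cball[of y R] by blast
  then have "u x < \<infinity>" using u by (simp add: subharmonic_def)
  ultimately obtain r where r: "u x = ereal r" by (cases "u x") auto
  obtain M where M: "\<And>z. z \<in> cball y R \<Longrightarrow> u z < ereal M"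
    using subharmonic_bounded_above[OF u compact_cball R(2)] by blast
  define \<theta> where "\<theta> = (norm (x - y) / R) powr (2 - p)"
  have "norm (x - y) / R < 1" using x R(1) by (simp add: dist_norm norm_minus_commute)
  then have \<theta>: "\<theta> < 1" unfolding \<theta>_def
    using R(1) p_less_2 powr_less_mono2[of "2 - p" "norm (x - y) / R" 1] by simp
  define m where "m = min (M - 1) ((r - M * \<theta>) / (1 - \<theta>) - 1)"
  have "u x \<le> ereal (m + (M - m) * \<theta>)"
    unfolding \<theta>_def
    by (rule pole_comparison[OF u R]) (use M x y less_imp_le in \<open>auto simp: m_def less_imp_le\<close>)
  then have "r - M * \<theta> \<le> m * (1 - \<theta>)" by (simp add: r algebra_simps)
  also have "\<dots> \<le> ((r - M * \<theta>) / (1 - \<theta>) - 1) * (1 - \<theta>)"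
    using \<theta> by (intro mult_right_mono) (auto simp: m_def)
  also have "\<dots> = r - M * \<theta> - (1 - \<theta>)"
    using \<theta> by (simp add: field_simps)
  finally show False using \<theta> by simp
qed

text \<open>The points where \<open>u = -\<infinity>\<close> form an open set, as the value spreads to balls. Their complement is
  open too: a point of that set near \<open>y\<close> would spread its value to \<open>y\<close>, since the size of the ball
  depends only on the distance to the boundary of \<open>X\<close>.\<close>

lemma subharmonic_finite:
  assumes u: "subharmonic F X u" and x: "x \<in> X"
  shows "\<bar>u x\<bar> \<noteq> \<infinity>"
proof -
  have X: "open X" and fin: "\<And>x. x \<in> X \<Longrightarrow> u x < \<infinity>"
    and nontriv: "\<And>C. C \<in> components X \<Longrightarrow> \<exists>x\<in>C. u x \<noteq> -\<infinity>"
    using u by (auto simp: subharmonic_def)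
  define S where "S = {x \<in> X. u x = -\<infinity>}"
  have "open S"
    unfolding open_contains_ball
  proof
    fix y assume y: "y \<in> S"
    then obtain R where "R > 0" "cball y R \<subseteq> X"
      using X open_contains_cball unfolding S_def by blast
    then have "ball y R \<subseteq> S"
      using subharmonic_minus_infinity_spreads[OF u _ _, of R y] y ball_subset_cball[of y R]
      unfolding S_def by blast
    with \<open>R > 0\<close> show "\<exists>e>0. ball y e \<subseteq> S" by blast
  qed
  have "open (X - S)"
    unfolding open_contains_ball
  proof
    fix y assume y: "y \<in> X - S"
    then obtain R where R: "R > 0" "cball y R \<subseteq> X"
      using X open_contains_cball by blast
    have "z \<notin> S" if z: "z \<in> ball y (R / 3)" for z
    proof
      assume "z \<in> S"
      have "cball z (R / 2) \<subseteq> cball y R"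
      proof
        fix w assume "w \<in> cball z (R / 2)"
        then show "w \<in> cball y R" using z dist_triangle[of y w z] R(1) by simp
      qed
      then have "cball z (R / 2) \<subseteq> X" using R by blast
      moreover have "y \<in> ball z (R / 2)" using z R(1) by (simp add: dist_commute)
      ultimately have "u y = -\<infinity>"
        using subharmonic_minus_infinity_spreads[OF u, of "R / 2" z y] \<open>z \<in> S\<close> R(1) by (simp add: S_def)
      then show False using y by (simp add: S_def)
    qed
    moreover have "ball y (R / 3) \<subseteq> X"
      using R subset_ball[of "R / 3" R y] ball_subset_cball[of y R] by auto
    ultimately show "\<exists>e>0. ball y e \<subseteq> X - S"
      using R(1) by (intro exI[of _ "R / 3"]) auto
  qed
  define C where "C = connected_component_set X x"
  have C: "C \<in> components X" "x \<in> C" "C \<subseteq> X" "connected C"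
    using x by (auto simp: C_def components_def connected_component_subset)
  obtain z where z: "z \<in> C" "u z \<noteq> -\<infinity>" using nontriv[OF C(1)] by blast
  have "x \<notin> S"
  proof
    assume "x \<in> S"
    then show False
      using connectedD[OF C(4) \<open>open S\<close> \<open>open (X - S)\<close>] C(2,3) z by (auto simp: S_def)
  qed
  then show ?thesis using fin[OF x] x by (cases "u x") (auto simp: S_def)
qed

text \<open>Poles at points \<open>y\<close> near \<open>x\<^sub>0\<close>, evaluated at \<open>x\<^sub>0\<close>, bound \<open>u y\<close> from below in terms of \<open>u x\<^sub>0\<close>. Hence
  the factor \<open>M - u y\<close> in the comparison is bounded uniformly in \<open>y\<close>, and the comparison itself
  becomes a Hoelder estimate.\<close>

lemma subharmonic_holder_near_point:
  assumes u: "subharmonic F X u" and x0: "x\<^sub>0 \<in> X"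
  obtains d C where "0 < d" "0 \<le> C" "ball x\<^sub>0 d \<subseteq> X"
    "\<And>x y. x \<in> ball x\<^sub>0 d \<Longrightarrow> y \<in> ball x\<^sub>0 d \<Longrightarrow>
       \<bar>real_of_ereal (u x) - real_of_ereal (u y)\<bar> \<le> C * norm (x - y) powr (2 - p)"
proof -
  define v where "v x = real_of_ereal (u x)" for x
  have uv: "u x = ereal (v x)" if "x \<in> X" for x
    using subharmonic_finite[OF u that] by (simp add: v_def ereal_real)
  obtain R' where R': "R' > 0" "cball x\<^sub>0 R' \<subseteq> X"
    using subharmonic_open[OF u] x0 open_contains_cball by blast
  define R where "R = R' / 3"
  have R: "R > 0" "cball x\<^sub>0 (3 * R) \<subseteq> X" using R' by (auto simp: R_def)
  obtain M where M: "\<And>z. z \<in> cball x\<^sub>0 (3 * R) \<Longrightarrow> u z < ereal M"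
    using subharmonic_bounded_above[OF u compact_cball R(2)] by blast
  have near: "v x \<le> v y + (M - v y) * (norm (x - y) / R) powr (2 - p)"
    if y: "y \<in> cball x\<^sub>0 R" and x: "x \<in> cball y R" for x y
  proof -
    have sub: "cball y R \<subseteq> cball x\<^sub>0 (3 * R)"
    proof
      fix w assume "w \<in> cball y R"
      then show "w \<in> cball x\<^sub>0 (3 * R)" using y dist_triangle[of x\<^sub>0 w y] R(1) by simp
    qed
    then have sX: "cball y R \<subseteq> X" using R(2) by blast
    have yc: "y \<in> cball y R" using R(1) by simp
    have "u x \<le> ereal (v y + (M - v y) * (norm (x - y) / R) powr (2 - p))"
    proof (rule pole_comparison[OF u R(1) sX])
      show "u y \<le> ereal (v y)" "v y < M"
        using uv[of y] M[of y] subsetD[OF sub yc] subsetD[OF sX yc] by auto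
      show "u z \<le> ereal M" if "z \<in> sphere y R" for z
        using M[of z] sub that by (simp add: subset_iff less_imp_le)
    qed (rule x)
    then show ?thesis using uv[of x] x sX by auto
  qed
  define \<theta> where "\<theta> = (1 / 2 :: real) powr (2 - p)"
  have \<theta>: "\<theta> < 1" unfolding \<theta>_def using p_less_2 powr_less_mono2[of "2 - p" "1 / 2" 1] by simp
  define B where "B = (M - v x\<^sub>0) / (1 - \<theta>)"
  have MB: "0 < M - v y" "M - v y \<le> B" if y: "y \<in> ball x\<^sub>0 (R / 2)" for y
  proof -
    have yc: "y \<in> cball x\<^sub>0 R" "x\<^sub>0 \<in> cball y R" "y \<in> cball x\<^sub>0 (3 * R)"
      using y R(1) by (auto simp: dist_commute)
    then show pos: "0 < M - v y" using M[of y] uv[of y] R(2) by auto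
    have "norm (x\<^sub>0 - y) / R \<le> 1 / 2" using y R(1) by (simp add: dist_norm field_simps)
    then have "(norm (x\<^sub>0 - y) / R) powr (2 - p) \<le> \<theta>"
      unfolding \<theta>_def using R(1) p_less_2 by (intro powr_mono2) auto
    then have "v x\<^sub>0 \<le> v y + (M - v y) * \<theta>"
      using near[OF yc(1,2)] pos mult_left_mono[of "(norm (x\<^sub>0 - y) / R) powr (2 - p)" \<theta> "M - v y"]
      by linarith
    then have "(M - v y) * (1 - \<theta>) \<le> M - v x\<^sub>0" by (simp add: algebra_simps)
    then show "M - v y \<le> B" unfolding B_def using \<theta> by (simp add: pos_le_divide_eq)
  qed
  define C where "C = B / R powr (2 - p)"
  have x0b: "x\<^sub>0 \<in> ball x\<^sub>0 (R / 2)" using R(1) by simp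
  have B0: "0 \<le> B" using MB[OF x0b] by linarith
  have one: "v x - v y \<le> C * norm (x - y) powr (2 - p)"
    if "x \<in> ball x\<^sub>0 (R / 2)" "y \<in> ball x\<^sub>0 (R / 2)" for x y
  proof -
    have "x \<in> cball y R" using that dist_triangle2[of y x x\<^sub>0] by (simp add: dist_commute)
    moreover have "y \<in> cball x\<^sub>0 R" using that R(1) by auto
    ultimately have "v x - v y \<le> (M - v y) * (norm (x - y) / R) powr (2 - p)"
      using near[of y x] by simp
    also have "\<dots> \<le> B * (norm (x - y) / R) powr (2 - p)"
      using MB[OF that(2)] by (intro mult_right_mono) auto
    also have "\<dots> = C * norm (x - y) powr (2 - p)"
      using R(1) by (simp add: C_def powr_divide)
    finally show ?thesis .
  qed
  show thesis
  proof (rule that[of "R / 2" C])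
    show "ball x\<^sub>0 (R / 2) \<subseteq> X"
      using R by (auto simp: subset_iff)
    show "\<bar>real_of_ereal (u x) - real_of_ereal (u y)\<bar> \<le> C * norm (x - y) powr (2 - p)"
      if "x \<in> ball x\<^sub>0 (R / 2)" "y \<in> ball x\<^sub>0 (R / 2)" for x y
      using one[OF that] one[OF that(2,1)]
      unfolding v_def by (simp add: abs_le_iff norm_minus_commute)
  qed (use R B0 in \<open>auto simp: C_def\<close>)
qed

end

lemma holder_imp_continuous_on:
  fixes v :: "real^'n \<Rightarrow> real"
  assumes "0 < a" "\<And>x y. x \<in> S \<Longrightarrow> y \<in> S \<Longrightarrow> \<bar>v x - v y\<bar> \<le> C * norm (x - y) powr a"
  shows "continuous_on S v"
  unfolding continuous_on_def
proof
  fix x assume x: "x \<in> S"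
  have "((\<lambda>y. C * norm (y - x) powr a) \<longlongrightarrow> C * norm (x - x) powr a) (at x within S)"
    by (intro tendsto_intros tendsto_powr') (use assms(1) in auto)
  then have lim: "((\<lambda>y. C * norm (y - x) powr a) \<longlongrightarrow> 0) (at x within S)"
    by simp
  have "\<forall>\<^sub>F y in at x within S. norm (v y - v x) \<le> C * norm (y - x) powr a"
    unfolding eventually_at_filter by (rule always_eventually) (simp add: assms(2)[OF _ x])
  from Lim_null_comparison[OF this lim] have "((\<lambda>y. v y - v x) \<longlongrightarrow> 0) (at x within S)" .
  then show "(v \<longlongrightarrow> v x) (at x within S)"
    by (simp add: LIM_zero_iff)
qed

lemma holder_seminorm_le:
  assumes "\<And>x y. x \<in> K \<Longrightarrow> y \<in> K \<Longrightarrow> \<bar>f x - f y\<bar> \<le> C * norm (x - y) powr a"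
  shows "holder_seminorm a K f \<le> ennreal C"
  unfolding holder_seminorm_def
proof (intro SUP_least ennreal_leI)
  fix x y assume "x \<in> K" "y \<in> K - {x}"
  then show "\<bar>f x - f y\<bar> / norm (x - y) powr a \<le> C"
    using assms[of x y] by (auto simp: divide_le_eq)
qed

text \<open>On a compact set, pairs of points closer than a Lebesgue number of the cover by the balls of
  local Hoelder continuity are controlled by the largest of finitely many local constants, and
  the other pairs by the oscillation.\<close>

lemma holder_on_compact:
  fixes v :: "real^'n \<Rightarrow> real"
  assumes a: "0 < a" and K: "compact K"
    and loc: "\<And>x. x \<in> K \<Longrightarrow> \<exists>d>0. \<exists>C. \<forall>y\<in>ball x d. \<forall>z\<in>ball x d. \<bar>v y - v z\<bar> \<le> C * norm (y - z) powr a"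
  obtains C where "\<And>x y. x \<in> K \<Longrightarrow> y \<in> K \<Longrightarrow> \<bar>v x - v y\<bar> \<le> C * norm (x - y) powr a"
proof -
  obtain d C where d: "\<And>x. x \<in> K \<Longrightarrow> 0 < d x"
    and C: "\<And>x y z. x \<in> K \<Longrightarrow> y \<in> ball x (d x) \<Longrightarrow> z \<in> ball x (d x) \<Longrightarrow> \<bar>v y - v z\<bar> \<le> C x * norm (y - z) powr a"
    using loc by metis
  have "continuous_on K v"
    unfolding continuous_on_eq_continuous_within
  proof
    fix x assume x: "x \<in> K"
    have "continuous_on (ball x (d x)) v"
      by (rule holder_imp_continuous_on[OF a]) (rule C[OF x])
    then show "continuous (at x within K) v"
      using d[OF x] by (simp add: continuous_on_eq_continuous_at continuous_at_imp_continuous_at_within)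
  qed
  then have "bounded (v ` K)"
    using K compact_continuous_image compact_imp_bounded by blast
  then obtain B where B: "\<And>x. x \<in> K \<Longrightarrow> \<bar>v x\<bar> \<le> B"
    by (auto simp: bounded_iff)
  obtain K' where K': "K' \<subseteq> K" "finite K'" "K \<subseteq> (\<Union>x\<in>K'. ball x (d x))"
    by (rule compactE_image[OF K, of K "\<lambda>x. ball x (d x)"]) (use d in auto)
  obtain e where e: "0 < e" "\<And>x. x \<in> K \<Longrightarrow> \<exists>G \<in> (\<lambda>x. ball x (d x)) ` K'. ball x e \<subseteq> G"
    using Heine_Borel_lemma[OF K, of "(\<lambda>x. ball x (d x)) ` K'"] K'(3) by blast
  define A where "A = (\<Sum>x\<in>K'. \<bar>C x\<bar>)"
  have CA: "C x \<le> A" if "x \<in> K'" for x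
  proof -
    have "\<bar>C x\<bar> \<le> A" unfolding A_def
      by (rule member_le_sum[OF that]) (use K'(2) in auto)
    then show ?thesis by simp
  qed
  show thesis
  proof (rule that[of "A + 2 * \<bar>B\<bar> / e powr a"])
    fix x y assume xy: "x \<in> K" "y \<in> K"
    have A0: "0 \<le> A" by (auto simp: A_def intro: sum_nonneg)
    show "\<bar>v x - v y\<bar> \<le> (A + 2 * \<bar>B\<bar> / e powr a) * norm (x - y) powr a"
    proof (cases "norm (x - y) < e")
      case True
      obtain z where z: "z \<in> K'" "ball x e \<subseteq> ball z (d z)" using e(2)[OF xy(1)] by blast
      have "\<bar>v x - v y\<bar> \<le> C z * norm (x - y) powr a"
      proof (rule C)
        show "z \<in> K" using z K' by blast
        show "x \<in> ball z (d z)" using z(2) e(1) centre_in_ball[of x e] by blast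
        show "y \<in> ball z (d z)" using z(2) True by (auto simp: dist_norm)
      qed
      also have "\<dots> \<le> (A + 2 * \<bar>B\<bar> / e powr a) * norm (x - y) powr a"
        using CA[OF z(1)] by (intro mult_right_mono add_increasing2) auto
      finally show ?thesis .
    next
      case False
      have "\<bar>v x - v y\<bar> \<le> 2 * \<bar>B\<bar>"
        using B[OF xy(1)] B[OF xy(2)] by linarith
      also have "\<dots> = 2 * \<bar>B\<bar> / e powr a * e powr a" using e(1) by simp
      also have "\<dots> \<le> (A + 2 * \<bar>B\<bar> / e powr a) * norm (x - y) powr a"
        using False e(1) a A0 by (intro mult_mono powr_mono2) auto
      finally show ?thesis .
    qed
  qed
qed

context riesz_cone
begin

theorem subharmonic_locally_holder:
  assumes u: "subharmonic F X u"
  shows "locally_holder (2 - p) X u"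
  unfolding locally_holder_def
proof (intro conjI allI impI ballI; (elim conjE)?)
  show "\<bar>u x\<bar> \<noteq> \<infinity>" if "x \<in> X" for x using subharmonic_finite[OF u that] .
  fix K assume K: "compact K" "K \<subseteq> X"
  have "\<exists>d>0. \<exists>C. \<forall>y\<in>ball x d. \<forall>z\<in>ball x d.
      \<bar>real_of_ereal (u y) - real_of_ereal (u z)\<bar> \<le> C * norm (y - z) powr (2 - p)" if x: "x \<in> K" for x
  proof -
    obtain d C where "0 < d" "0 \<le> C" "ball x d \<subseteq> X" "\<And>y z. y \<in> ball x d \<Longrightarrow> z \<in> ball x d \<Longrightarrow>
       \<bar>real_of_ereal (u y) - real_of_ereal (u z)\<bar> \<le> C * norm (y - z) powr (2 - p)"
      by (rule subharmonic_holder_near_point[OF u subsetD[OF K(2) x]]) (rule that)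
    then show ?thesis by blast
  qed
  then obtain C where C: "\<And>x y. x \<in> K \<Longrightarrow> y \<in> K \<Longrightarrow>
      \<bar>real_of_ereal (u x) - real_of_ereal (u y)\<bar> \<le> C * norm (x - y) powr (2 - p)"
    using holder_on_compact[OF _ K(1), of "2 - p" "\<lambda>x. real_of_ereal (u x)"] p_less_2
    unfolding diff_gt_0_iff_gt by blast
  have "holder_seminorm (2 - p) K (\<lambda>x. real_of_ereal (u x)) \<le> ennreal C"
    by (rule holder_seminorm_le) (rule C)
  then show "holder_seminorm (2 - p) K (\<lambda>x. real_of_ereal (u x)) < \<infinity>"
    by (rule le_less_trans) simp
qed

end

section \<open>Limits and changes of variables\<close>

lemma subharmonic_cong:
  assumes "\<And>x. x \<in> X \<Longrightarrow> u x = w x" and u: "subharmonic F X u"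
  shows "subharmonic F X w"
proof -
  have "{x \<in> X. u x < c} = {x \<in> X. w x < c}" for c
    using assms(1) by auto
  then have "usc_on X w"
    using u unfolding subharmonic_def usc_on_def by simp
  moreover have "\<exists>x\<in>C. w x \<noteq> -\<infinity>" if C: "C \<in> components X" for C
  proof -
    obtain x where x: "x \<in> C" "u x \<noteq> -\<infinity>" using u C unfolding subharmonic_def by blast
    moreover have "x \<in> X" using x(1) in_components_subset[OF C] by blast
    ultimately show ?thesis using assms(1) by auto
  qed
  moreover have "w x < \<infinity>" if "x \<in> X" for x
    using u assms(1)[OF that] that by (auto simp: subharmonic_def)
  moreover have "H x \<in> F" if "C2_with_hessian_on V \<phi> H" "x \<in> V" "V \<subseteq> X"
    "\<forall>y\<in>V. w y \<le> ereal (\<phi> y)" "w x = ereal (\<phi> x)" for x V \<phi> H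
    by (rule subharmonic_test[OF u that(1-3)]) (use that assms(1) in \<open>auto simp: subset_iff\<close>)
  ultimately show ?thesis
    using subharmonic_open[OF u] unfolding subharmonic_def by blast
qed

lemma subharmonic_subset:
  fixes u :: "real^'n \<Rightarrow> real"
  assumes u: "subharmonic F X (\<lambda>x. ereal (u x))" "continuous_on X u" and Y: "Y \<subseteq> X" "open Y"
  shows "subharmonic F Y (\<lambda>x. ereal (u x))"
  using u(1) Y unfolding subharmonic_ereal_iff[OF u(2)]
    subharmonic_ereal_iff[OF continuous_on_subset[OF u(2) Y(1)]]
  by (meson order_trans)

text \<open>If \<open>\<phi>\<close> touches the limit \<open>U\<close> from above at \<open>x\<close>, then a translate of \<open>\<phi> + \<eta> |y - x|\<^sup>2\<close>
  touches a late member of the sequence at a point near \<open>x\<close>.\<close>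

lemma subharmonic_locally_uniform_limit:
  fixes f :: "nat \<Rightarrow> real^'n \<Rightarrow> real"
  assumes X: "open X" and F: "closed F"
    and loc: "\<And>x. x \<in> X \<Longrightarrow> \<exists>d>0. ball x d \<subseteq> X \<and> uniform_limit (ball x d) f U sequentially \<and>
      (\<forall>\<^sub>F k in sequentially. continuous_on (ball x d) (f k) \<and> subharmonic F (ball x d) (\<lambda>y. ereal (f k y)))"
  shows "continuous_on X U" and "subharmonic F X (\<lambda>x. ereal (U x))"
proof -
  show cont: "continuous_on X U"
    unfolding continuous_on_eq_continuous_at[OF X]
  proof
    fix x assume "x \<in> X"
    from loc[OF this] obtain d where d: "0 < d" "uniform_limit (ball x d) f U sequentially"
      "\<forall>\<^sub>F k in sequentially. continuous_on (ball x d) (f k) \<and> subharmonic F (ball x d) (\<lambda>y. ereal (f k y))"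
      by blast
    have "continuous_on (ball x d) U"
      by (rule uniform_limit_theorem[OF _ d(2)]) (use d(3) in \<open>auto elim: eventually_mono\<close>)
    then show "isCont U x"
      using d(1) by (simp add: continuous_on_eq_continuous_at)
  qed
  show "subharmonic F X (\<lambda>x. ereal (U x))"
    unfolding subharmonic_ereal_iff[OF cont]
  proof (intro conjI allI impI; (elim conjE)?)
    fix x V \<phi> H
    assume C2: "C2_with_hessian_on V \<phi> H" and x: "x \<in> V" and V: "V \<subseteq> X"
      and le: "\<forall>y\<in>V. U y \<le> \<phi> y" and eq: "U x = \<phi> x"
    have near: "\<exists>z\<in>ball x e \<inter> V. H z + (2 * \<eta>) *\<^sub>R mat 1 \<in> F" if e: "0 < e" and eta: "0 < \<eta>" for e \<eta> :: real
    proof -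
      from loc[of x] x V obtain d where d: "0 < d" "uniform_limit (ball x d) f U sequentially"
        "\<forall>\<^sub>F k in sequentially. continuous_on (ball x d) (f k) \<and> subharmonic F (ball x d) (\<lambda>y. ereal (f k y))"
        by blast
      obtain e1 where e1: "0 < e1" "cball x e1 \<subseteq> V"
        using C2_open[OF C2] x open_contains_cball by blast
      define e' where "e' = min e1 (min d e) / 2"
      have e': "0 < e'" "cball x e' \<subseteq> V" "cball x e' \<subseteq> ball x d" "cball x e' \<subseteq> ball x e"
        using e1 d(1) e by (auto simp: e'_def subset_iff)
      define \<epsilon> where "\<epsilon> = \<eta> * e'\<^sup>2 / 4"
      have eps: "\<epsilon> > 0" using e'(1) eta by (simp add: \<epsilon>_def)
      have "\<forall>\<^sub>F k in sequentially. \<forall>z\<in>ball x d. dist (f k z) (U z) < \<epsilon>"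
        using d(2) eps by (simp add: uniform_limit_iff)
      from eventually_happens'[OF _ eventually_conj[OF this d(3)]]
      obtain k where k: "\<forall>z\<in>ball x d. dist (f k z) (U z) < \<epsilon>"
        "continuous_on (ball x d) (f k)" "subharmonic F (ball x d) (\<lambda>y. ereal (f k y))"
        using sequentially_bot by blast
      define w where "w z = f k z - (\<phi> z + \<eta> * (norm (z - x))\<^sup>2)" for z
      have "continuous_on (cball x e') w"
        unfolding w_def
        by (intro continuous_intros continuous_on_subset[OF k(2) e'(3)]
            continuous_on_subset[OF C2_continuous_on[OF C2] e'(2)])
      then obtain z where z: "z \<in> cball x e'" "\<And>y. y \<in> cball x e' \<Longrightarrow> w y \<le> w z"
        using continuous_attains_sup[of "cball x e'" w] e'(1) by auto
      have fx: "\<bar>f k y - U y\<bar> < \<epsilon>" if "y \<in> cball x e'" for y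
        using k(1)[rule_format, of y] that e'(3) by (auto simp: dist_real_def)
      have Uz: "U z \<le> \<phi> z" using le e'(2) z(1) by blast
      have "w x \<le> w z" using z(2)[of x] e'(1) by simp
      then have "\<eta> * (norm (z - x))\<^sup>2 < 2 * \<epsilon>"
        using fx[of x] fx[OF z(1)] Uz eq e'(1) by (simp add: w_def abs_less_iff)
      also have "\<dots> < \<eta> * e'\<^sup>2" using e'(1) eta by (simp add: \<epsilon>_def)
      finally have "(norm (z - x))\<^sup>2 < e'\<^sup>2" using eta by simp
      then have zb: "z \<in> ball x e'"
        using e'(1) by (simp add: dist_norm norm_minus_commute power_less_imp_less_base)
      have "C2_with_hessian_on (ball x e') (\<lambda>y. \<phi> y + \<eta> * (norm (y - x))\<^sup>2 + w z) (\<lambda>y. H y + (2 * \<eta>) *\<^sub>R mat 1)"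
        by (rule C2_add_norm_sq[OF C2_subset[OF C2]]) (use e'(2) ball_subset_cball in auto)
      then have "H z + (2 * \<eta>) *\<^sub>R mat 1 \<in> F"
      proof (rule subharmonic_test[OF k(3) _ zb])
        show "ball x e' \<subseteq> ball x d" using e'(3) ball_subset_cball by blast
        show "ereal (f k y) \<le> ereal (\<phi> y + \<eta> * (norm (y - x))\<^sup>2 + w z)" if "y \<in> ball x e'" for y
          using z(2)[of y] that by (simp add: w_def)
      qed (simp add: w_def)
      then show ?thesis using z(1) e'(2,4) by blast
    qed
    have "\<exists>z. z \<in> ball x (inverse (real (Suc n))) \<and> z \<in> V \<and> H z + (2 * inverse (real (Suc n))) *\<^sub>R mat 1 \<in> F" for n
      using near[of "inverse (real (Suc n))" "inverse (real (Suc n))"] by auto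
    then obtain z where z: "\<And>n. z n \<in> ball x (inverse (real (Suc n)))" "\<And>n. z n \<in> V"
      "\<And>n. H (z n) + (2 * inverse (real (Suc n))) *\<^sub>R mat 1 \<in> F" by metis
    have "(\<lambda>n. dist (z n) x) \<longlonglongrightarrow> 0"
      by (rule tendsto_sandwich[OF _ _ tendsto_const LIMSEQ_inverse_real_of_nat])
        (use z(1) in \<open>auto simp: dist_commute less_imp_le\<close>)
    then have "z \<longlonglongrightarrow> x" by (rule tendsto_dist_iff[THEN iffD2])
    moreover have "isCont H x"
      using C2_hessian_continuous_on[OF C2] C2_open[OF C2] x continuous_on_eq_continuous_at by blast
    ultimately have "(\<lambda>n. H (z n)) \<longlonglongrightarrow> H x"
      using isCont_tendsto_compose by blast
    then have "(\<lambda>n. H (z n) + (2 * inverse (real (Suc n))) *\<^sub>R mat 1) \<longlonglongrightarrow> H x + (2 * 0) *\<^sub>R mat 1"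
      by (intro tendsto_add tendsto_scaleR tendsto_mult tendsto_const LIMSEQ_inverse_real_of_nat)
    from closed_sequentially[OF F z(3) this] show "H x \<in> F"
      by simp
  qed (rule X)
qed

text \<open>The common form of the two changes of variables in use, dilations and rotations.\<close>

lemma subharmonic_linear_change:
  fixes u :: "real^'n \<Rightarrow> real" and A B :: "real^'n^'n"
  assumes u: "subharmonic F X (\<lambda>x. ereal (u x))" "continuous_on X u"
    and AB: "A ** B = mat 1" "B ** A = mat 1" and k: "0 < k"
    and F: "\<And>M. (1 / k) *\<^sub>R (transpose B ** M ** B) \<in> F \<Longrightarrow> M \<in> F"
  shows "subharmonic F {x. A *v x \<in> X} (\<lambda>x. ereal (k * u (A *v x) + c))"
proof -
  let ?Y = "{x. A *v x \<in> X}"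
  have X: "open X" using subharmonic_open[OF u(1)] .
  have Y: "open ?Y"
    using open_vimage[OF X, of "(*v) A"]
    by (simp add: vimage_def linear_continuous_on matrix_vector_mul_bounded_linear)
  have "continuous_on ?Y (\<lambda>x. u (A *v x))"
    by (rule continuous_on_compose2[OF u(2)]) (auto intro!: linear_continuous_on matrix_vector_mul_bounded_linear)
  then have cont: "continuous_on ?Y (\<lambda>x. k * u (A *v x) + c)"
    by (intro continuous_intros)
  have inv: "A *v (B *v x) = x" "B *v (A *v x) = x" for x
    using AB by (simp_all add: matrix_vector_mul_assoc)
  show ?thesis
    unfolding subharmonic_ereal_iff[OF cont]
  proof (intro conjI allI impI; (elim conjE)?)
    fix x V \<phi> H
    assume C2: "C2_with_hessian_on V \<phi> H" and x: "x \<in> V" and V: "V \<subseteq> ?Y"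
      and le: "\<forall>y\<in>V. k * u (A *v y) + c \<le> \<phi> y" and eq: "k * u (A *v x) + c = \<phi> x"
    have C2': "C2_with_hessian_on {y. B *v y \<in> V} (\<lambda>y. (1 / k) * \<phi> (B *v y) + (- c / k))
      (\<lambda>y. (1 / k) *\<^sub>R (transpose B ** H (B *v y) ** B) + 0)"
      using C2_affine_change[OF C2, of B] by (intro C2_add C2_scale C2_const C2_open)
    have "(1 / k) *\<^sub>R (transpose B ** H (B *v (A *v x)) ** B) + 0 \<in> F"
    proof (rule subharmonic_test[OF u(1) C2'])
      show "{y. B *v y \<in> V} \<subseteq> X" using V inv(1) by fastforce
      show "ereal (u y) \<le> ereal ((1 / k) * \<phi> (B *v y) + (- c / k))" if "y \<in> {y. B *v y \<in> V}" for y
        using le[rule_format, of "B *v y"] that k by (simp add: inv field_simps)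
      show "ereal (u (A *v x)) = ereal ((1 / k) * \<phi> (B *v (A *v x)) + (- c / k))"
        using eq[symmetric] k by (simp add: inv field_simps)
    qed (simp add: inv x)
    then show "H x \<in> F" using F by (simp add: inv)
  qed (rule Y)
qed

section \<open>Tangents\<close>

text \<open>The theorem of Arzela and Ascoli on the balls of integer radius, followed by a diagonal argument.\<close>

lemma equi_holder_subsequence:
  fixes f :: "nat \<Rightarrow> real^'n \<Rightarrow> real"
  assumes a: "0 < a" and hold: "\<And>j x y. \<bar>f j x - f j y\<bar> \<le> C * norm (x - y) powr a"
    and zero: "\<And>j. f j 0 = 0"
  obtains s U where "strict_mono (s :: nat \<Rightarrow> nat)"
    "\<And>K. compact K \<Longrightarrow> uniform_limit K (\<lambda>k. f (s k)) U sequentially"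
proof -
  define P where "P i h = (\<exists>g. uniform_limit (cball 0 (real i)) (\<lambda>n. f (h n)) g sequentially)"
    for i :: nat and h :: "nat \<Rightarrow> nat"
  have sub: "\<exists>k. strict_mono (k :: nat \<Rightarrow> nat) \<and> P i (r \<circ> k)" for i and r :: "nat \<Rightarrow> nat"
  proof (rule Arzela_Ascoli[of "cball 0 (real i) :: (real^'n) set" "\<lambda>n. f (r n)" "\<bar>C\<bar> * real i powr a"])
    show "norm (f (r n) x) \<le> \<bar>C\<bar> * real i powr a" if "x \<in> cball 0 (real i)" for n x
    proof -
      have "\<bar>f (r n) x\<bar> \<le> C * norm x powr a" using hold[of "r n" x 0] zero by simp
      also have "\<dots> \<le> \<bar>C\<bar> * real i powr a"
        using that a by (intro mult_mono powr_mono2) auto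
      finally show ?thesis by simp
    qed
    fix x :: "real^'n" and e :: real assume e: "0 < e"
    define d where "d = (e / (\<bar>C\<bar> + 1)) powr (1 / a)"
    have d: "0 < d" "d powr a = e / (\<bar>C\<bar> + 1)"
      using e a by (auto simp: d_def powr_powr)
    have "norm (f (r n) x - f (r n) y) < e" if "norm (x - y) < d" for n y
    proof -
      have "\<bar>f (r n) x - f (r n) y\<bar> \<le> C * norm (x - y) powr a" by (rule hold)
      also have "\<dots> \<le> (\<bar>C\<bar> + 1) * norm (x - y) powr a" by (intro mult_right_mono) auto
      also have "\<dots> < (\<bar>C\<bar> + 1) * d powr a"
        using that a by (intro mult_strict_left_mono powr_less_mono2) auto
      also have "\<dots> = e" using d(2) by simp
      finally show ?thesis by simp
    qed
    then show "\<exists>d>0. \<forall>n y. y \<in> cball 0 (real i) \<and> norm (x - y) < d \<longrightarrow> norm (f (r n) x - f (r n) y) < e"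
      using d(1) by blast
  next
    fix g and k :: "nat \<Rightarrow> nat"
    assume k: "strict_mono k"
      and lim: "\<And>e. 0 < e \<Longrightarrow> \<exists>N. \<forall>n x. n \<ge> N \<and> x \<in> cball 0 (real i) \<longrightarrow> norm (f (r (k n)) x - g x) < e"
    have "uniform_limit (cball 0 (real i)) (\<lambda>n. f (r (k n))) g sequentially"
      unfolding uniform_limit_sequentially_iff dist_norm using lim by blast
    then show ?thesis using k unfolding P_def o_def by blast
  qed auto
  obtain s where s: "strict_mono (s :: nat \<Rightarrow> nat)" "\<And>i. P i (id \<circ> s)"
  proof (rule subsequence_diagonalization_lemma[of P id])
    show "\<exists>k. strict_mono (k :: nat \<Rightarrow> nat) \<and> P i (r \<circ> k)" for i and r :: "nat \<Rightarrow> nat"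
      by (rule sub)
    show "P i (r \<circ> k2)" if P1: "P i (r \<circ> k1)" and k2: "\<And>j. N \<le> j \<Longrightarrow> \<exists>j'. j \<le> j' \<and> k2 j = k1 j'"
      for i N and r k1 k2 :: "nat \<Rightarrow> nat"
    proof -
      obtain g where g: "\<And>e. e > 0 \<Longrightarrow> \<exists>N. \<forall>n\<ge>N. \<forall>x\<in>cball 0 (real i). dist (f ((r \<circ> k1) n) x) (g x) < e"
        using P1 unfolding P_def uniform_limit_sequentially_iff by blast
      have "\<exists>M. \<forall>n\<ge>M. \<forall>x\<in>cball 0 (real i). dist (f ((r \<circ> k2) n) x) (g x) < e" if e: "e > 0" for e
      proof -
        obtain N' where N': "\<forall>n\<ge>N'. \<forall>x\<in>cball 0 (real i). dist (f ((r \<circ> k1) n) x) (g x) < e"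
          using g[OF e] by blast
        show ?thesis
        proof (intro exI[of _ "max N N'"] allI impI)
          fix n assume n: "max N N' \<le> n"
          then obtain j' where "n \<le> j'" "k2 n = k1 j'" using k2[of n] by auto
          then show "\<forall>x\<in>cball 0 (real i). dist (f ((r \<circ> k2) n) x) (g x) < e"
            using N' n by auto
        qed
      qed
      then show ?thesis unfolding P_def uniform_limit_sequentially_iff by blast
    qed
  qed (rule that)
  define U where "U x = lim (\<lambda>n. f (s n) x)" for x
  have U: "uniform_limit (cball 0 (real i)) (\<lambda>n. f (s n)) U sequentially" for i
  proof -
    obtain g where g: "uniform_limit (cball 0 (real i)) (\<lambda>n. f (s n)) g sequentially"
      using s(2)[of i] by (auto simp: P_def)
    have "g x = U x" if "x \<in> cball 0 (real i)" for x
      using tendsto_uniform_limitI[OF g that] unfolding U_def by (simp add: limI)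
    then show ?thesis using g uniform_limit_cong'[of "cball 0 (real i)" "\<lambda>n. f (s n)" "\<lambda>n. f (s n)" g U] by blast
  qed
  show thesis
  proof (rule that[OF s(1)])
    fix K :: "(real^'n) set" assume "compact K"
    then obtain b where b: "\<And>x. x \<in> K \<Longrightarrow> norm x \<le> b"
      using compact_imp_bounded bounded_iff by metis
    have "K \<subseteq> cball 0 (real (nat \<lceil>b\<rceil>))"
      using b by (fastforce simp: of_nat_nat intro: order_trans[OF _ real_nat_ceiling_ge])
    then show "uniform_limit K (\<lambda>k. f (s k)) U sequentially"
      using U uniform_limit_on_subset by blast
  qed
qed

text \<open>Interpolation: on a set where a Hoelder function with exponent \<open>a\<close> is uniformly small, its
  \<open>\<beta>\<close>-seminorm is small for \<open>\<beta> < a\<close>, by weighting the Hoelder bound and the sup bound.\<close>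

lemma holder_interpolation:
  fixes w :: "real^'n \<Rightarrow> real"
  assumes \<beta>: "0 < \<beta>" "\<beta> < a" and A: "0 \<le> A" "0 < \<epsilon>"
    and hold: "\<And>x y. x \<in> K \<Longrightarrow> y \<in> K \<Longrightarrow> \<bar>w x - w y\<bar> \<le> A * norm (x - y) powr a"
    and small: "\<And>x. x \<in> K \<Longrightarrow> \<bar>w x\<bar> \<le> \<epsilon>"
  shows "holder_norm \<beta> K w \<le> ennreal (\<epsilon> + A powr (\<beta> / a) * (2 * \<epsilon>) powr (1 - \<beta> / a))"
proof -
  define \<theta> where "\<theta> = \<beta> / a"
  have \<theta>: "0 < \<theta>" "\<theta> < 1" "a * \<theta> = \<beta>" using \<beta> by (auto simp: \<theta>_def)
  have "\<bar>w x - w y\<bar> \<le> (A powr \<theta> * (2 * \<epsilon>) powr (1 - \<theta>)) * norm (x - y) powr \<beta>"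
    if xy: "x \<in> K" "y \<in> K" for x y
  proof -
    let ?q = "\<bar>w x - w y\<bar>"
    have "?q = ?q powr \<theta> * ?q powr (1 - \<theta>)"
      by (cases "?q = 0") (simp_all add: powr_add[symmetric])
    also have "\<dots> \<le> (A * norm (x - y) powr a) powr \<theta> * (2 * \<epsilon>) powr (1 - \<theta>)"
    proof (intro mult_mono powr_mono2)
      show "?q \<le> 2 * \<epsilon>" using small[OF xy(1)] small[OF xy(2)] by linarith
    qed (use \<theta> hold[OF xy] in auto)
    also have "\<dots> = (A powr \<theta> * (2 * \<epsilon>) powr (1 - \<theta>)) * norm (x - y) powr \<beta>"
      using A by (simp add: powr_mult powr_powr \<theta>(3))
    finally show ?thesis .
  qed
  then have "holder_seminorm \<beta> K w \<le> ennreal (A powr \<theta> * (2 * \<epsilon>) powr (1 - \<theta>))"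
    by (rule holder_seminorm_le)
  moreover have "(SUP x\<in>K. ennreal \<bar>w x\<bar>) \<le> ennreal \<epsilon>"
    using small by (intro SUP_least ennreal_leI)
  ultimately have "holder_norm \<beta> K w \<le> ennreal \<epsilon> + ennreal (A powr \<theta> * (2 * \<epsilon>) powr (1 - \<theta>))"
    unfolding holder_norm_def by (intro add_mono)
  then show ?thesis
    using A by (simp add: \<theta>_def ennreal_plus[symmetric] del: ennreal_plus)
qed

lemma holder_norm_tendsto_0:
  fixes w :: "nat \<Rightarrow> real^'n \<Rightarrow> real"
  assumes \<beta>: "0 < \<beta>" "\<beta> < a" and A: "0 \<le> A"
    and hold: "\<forall>\<^sub>F k in sequentially. \<forall>x\<in>K. \<forall>y\<in>K. \<bar>w k x - w k y\<bar> \<le> A * norm (x - y) powr a"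
    and small: "uniform_limit K w (\<lambda>x. 0) sequentially"
  shows "(\<lambda>k. holder_norm \<beta> K (w k)) \<longlonglongrightarrow> 0"
proof (rule order_tendstoI)
  fix c :: ennreal assume c: "0 < c"
  have "((\<lambda>\<epsilon>. \<epsilon> + A powr (\<beta> / a) * (2 * \<epsilon>) powr (1 - \<beta> / a)) \<longlongrightarrow>
      0 + A powr (\<beta> / a) * (2 * 0) powr (1 - \<beta> / a)) (at_right 0)"
    by (intro tendsto_intros tendsto_powr') (use \<beta> in \<open>auto simp: eventually_at_filter\<close>)
  then have "((\<lambda>\<epsilon>. ennreal (\<epsilon> + A powr (\<beta> / a) * (2 * \<epsilon>) powr (1 - \<beta> / a))) \<longlongrightarrow> ennreal 0) (at_right 0)"
    by (intro tendsto_ennrealI) simp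
  then have "\<forall>\<^sub>F \<epsilon> in at_right 0. ennreal (\<epsilon> + A powr (\<beta> / a) * (2 * \<epsilon>) powr (1 - \<beta> / a)) < c"
    by (rule order_tendstoD) (use c in simp)
  moreover have "\<forall>\<^sub>F \<epsilon> in at_right (0::real). 0 < \<epsilon>"
    by (simp add: eventually_at_filter)
  ultimately obtain \<epsilon> :: real where \<epsilon>: "0 < \<epsilon>" "ennreal (\<epsilon> + A powr (\<beta> / a) * (2 * \<epsilon>) powr (1 - \<beta> / a)) < c"
    using eventually_happens'[OF _ eventually_conj] by (metis (no_types, lifting) trivial_limit_at_right_real)
  have "\<forall>\<^sub>F k in sequentially. \<forall>x\<in>K. dist (w k x) 0 < \<epsilon>"
    using small \<epsilon>(1) by (simp add: uniform_limit_iff)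
  with hold show "\<forall>\<^sub>F k in sequentially. holder_norm \<beta> K (w k) < c"
  proof eventually_elim
    case (elim k)
    have "holder_norm \<beta> K (w k) \<le> ennreal (\<epsilon> + A powr (\<beta> / a) * (2 * \<epsilon>) powr (1 - \<beta> / a))"
      by (rule holder_interpolation[OF \<beta> A \<epsilon>(1)]) (use elim in \<open>auto simp: less_imp_le\<close>)
    then show ?case using \<epsilon>(2) by (rule le_less_trans)
  qed
qed simp

context riesz_cone
begin

lemma subharmonic_real_part:
  assumes u: "subharmonic F X u"
  shows "subharmonic F X (\<lambda>x. ereal (real_of_ereal (u x)))"
  by (rule subharmonic_cong[OF _ u]) (use subharmonic_finite[OF u] in \<open>simp add: ereal_real\<close>)

lemma subharmonic_continuous_on:
  assumes u: "subharmonic F X u"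
  shows "continuous_on X (\<lambda>x. real_of_ereal (u x))"
  unfolding continuous_on_eq_continuous_at[OF subharmonic_open[OF u]]
proof
  fix x assume "x \<in> X"
  obtain d C where d: "0 < d" "0 \<le> C" "ball x d \<subseteq> X"
    "\<And>y z. y \<in> ball x d \<Longrightarrow> z \<in> ball x d \<Longrightarrow>
       \<bar>real_of_ereal (u y) - real_of_ereal (u z)\<bar> \<le> C * norm (y - z) powr (2 - p)"
    by (rule subharmonic_holder_near_point[OF u \<open>x \<in> X\<close>]) (rule that)
  have "continuous_on (ball x d) (\<lambda>x. real_of_ereal (u x))"
    by (rule holder_imp_continuous_on[of "2 - p"]) (use p_less_2 d(4) in auto)
  then show "isCont (\<lambda>x. real_of_ereal (u x)) x"
    using d(1) by (simp add: continuous_on_eq_continuous_at)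
qed

text \<open>The factor \<open>r\<^sup>p\<^sup>-\<^sup>2\<close> is the one for which a Hoelder bound with exponent \<open>2 - p\<close> is invariant under
  rescaling; only the ball on which it holds grows.\<close>

lemma rescale_equi_holder:
  assumes u: "subharmonic F X u" and X: "0 \<in> X"
  obtains \<rho> C where "0 < \<rho>" "0 \<le> C" "cball 0 \<rho> \<subseteq> X"
    "\<And>r x y. 0 < r \<Longrightarrow> norm x \<le> \<rho> / r \<Longrightarrow> norm y \<le> \<rho> / r \<Longrightarrow>
       \<bar>rescale p u r x - rescale p u r y\<bar> \<le> C * norm (x - y) powr (2 - p)"
proof -
  obtain d C where d: "0 < d" "0 \<le> C" "ball 0 d \<subseteq> X"
    "\<And>y z. y \<in> ball 0 d \<Longrightarrow> z \<in> ball 0 d \<Longrightarrow>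
       \<bar>real_of_ereal (u y) - real_of_ereal (u z)\<bar> \<le> C * norm (y - z) powr (2 - p)"
    by (rule subharmonic_holder_near_point[OF u X]) (rule that)
  show thesis
  proof (rule that[of "d / 2" C])
    show "cball 0 (d / 2) \<subseteq> X" using d(1,3) by (auto simp: subset_iff)
    fix r :: real and x y :: "real^'n"
    assume r: "0 < r" and xy: "norm x \<le> d / 2 / r" "norm y \<le> d / 2 / r"
    have "r *\<^sub>R x \<in> ball 0 d" "r *\<^sub>R y \<in> ball 0 d"
      using xy r d(1) by (auto simp: field_simps)
    from d(4)[OF this] have "\<bar>real_of_ereal (u (r *\<^sub>R x)) - real_of_ereal (u (r *\<^sub>R y))\<bar>
        \<le> C * (r powr (2 - p) * norm (x - y) powr (2 - p))"
      using r by (simp add: scaleR_diff_right[symmetric] powr_mult)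
    then have "r powr (p - 2) * \<bar>real_of_ereal (u (r *\<^sub>R x)) - real_of_ereal (u (r *\<^sub>R y))\<bar>
        \<le> r powr (p - 2) * (C * (r powr (2 - p) * norm (x - y) powr (2 - p)))"
      by (intro mult_left_mono) auto
    also have "\<dots> = (r powr (p - 2) * r powr (2 - p)) * (C * norm (x - y) powr (2 - p))"
      by (simp add: ac_simps)
    also have "r powr (p - 2) * r powr (2 - p) = 1"
      using r by (simp add: powr_add[symmetric])
    finally show "\<bar>rescale p u r x - rescale p u r y\<bar> \<le> C * norm (x - y) powr (2 - p)"
      unfolding rescale_def by (simp add: right_diff_distrib[symmetric] abs_mult)
  qed (use d in auto)
qed

lemma rescale_subharmonic:
  assumes u: "subharmonic F X u" and \<rho>: "ball 0 \<rho> \<subseteq> X" and r: "0 < r"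
  shows "subharmonic F (ball 0 (\<rho> / r)) (\<lambda>x. ereal (rescale p u r x))"
    and "continuous_on (ball 0 (\<rho> / r)) (rescale p u r)"
proof -
  let ?v = "\<lambda>x. real_of_ereal (u x)"
  have v: "subharmonic F (ball 0 \<rho>) (\<lambda>x. ereal (?v x))" "continuous_on (ball 0 \<rho>) ?v"
    using subharmonic_subset[OF subharmonic_real_part[OF u] subharmonic_continuous_on[OF u] \<rho>]
      continuous_on_subset[OF subharmonic_continuous_on[OF u] \<rho>] by auto
  let ?A = "r *\<^sub>R mat 1 :: real^'n^'n" and ?B = "(1 / r) *\<^sub>R mat 1 :: real^'n^'n"
  have A: "?A *v x = r *\<^sub>R x" for x by (simp add: scaleR_matrix_vector_assoc[symmetric])
  have set: "{x. ?A *v x \<in> ball 0 \<rho>} = ball 0 (\<rho> / r)"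
    unfolding A using r by (auto simp: field_simps)
  have AB: "?A ** ?B = mat 1" "?B ** ?A = mat 1"
    using r by (auto simp: matrix_eq matrix_vector_mul_assoc[symmetric] scaleR_matrix_vector_assoc[symmetric]
        matrix_vector_mult_scaleR)
  have "transpose ?B = ?B"
    by (auto simp: transpose_def vec_eq_iff mat_def)
  then have BMB: "transpose ?B ** M ** ?B = (1 / r\<^sup>2) *\<^sub>R M" for M
    by (simp add: matrix_eq matrix_vector_mul_assoc[symmetric] scaleR_matrix_vector_assoc[symmetric]
        matrix_vector_mult_scaleR power2_eq_square)
  have k: "0 < r powr (p - 2)" using r by simp
  have "subharmonic F (ball 0 (\<rho> / r)) (\<lambda>x. ereal (r powr (p - 2) * ?v (?A *v x) + - (r powr (p - 2) * ?v 0)))"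
    unfolding set[symmetric]
    by (rule subharmonic_linear_change[OF v AB k]) (use r k in \<open>simp add: BMB F_scale_iff\<close>)
  then show "subharmonic F (ball 0 (\<rho> / r)) (\<lambda>x. ereal (rescale p u r x))"
    by (simp add: rescale_def A right_diff_distrib)
  have "continuous_on (ball 0 (\<rho> / r)) (\<lambda>x. ?v (r *\<^sub>R x))"
    by (rule continuous_on_compose2[OF v(2)]) (use r in \<open>auto intro!: continuous_intros simp: field_simps\<close>)
  then show "continuous_on (ball 0 (\<rho> / r)) (rescale p u r)"
    unfolding rescale_def by (intro continuous_intros)
qed

lemma tangent_subharmonic:
  assumes u: "subharmonic F X u" and X: "0 \<in> X" and r: "\<And>j. 0 < r j" "r \<longlonglongrightarrow> 0"
    and U: "converges_locally_uniformly (\<lambda>k. rescale p u (r k)) U"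
  shows "continuous_on UNIV U" "subharmonic F UNIV (\<lambda>x. ereal (U x))"
proof -
  obtain \<rho> where \<rho>: "0 < \<rho>" "ball 0 \<rho> \<subseteq> X"
    using subharmonic_open[OF u] X open_contains_ball by blast
  have loc: "\<exists>d>0. ball x d \<subseteq> UNIV \<and> uniform_limit (ball x d) (\<lambda>k. rescale p u (r k)) U sequentially \<and>
      (\<forall>\<^sub>F k in sequentially. continuous_on (ball x d) (rescale p u (r k)) \<and>
         subharmonic F (ball x d) (\<lambda>y. ereal (rescale p u (r k) y)))" for x
  proof (intro exI[of _ 1] conjI)
    show "uniform_limit (ball x 1) (\<lambda>k. rescale p u (r k)) U sequentially"
      by (rule uniform_limit_on_subset[OF _ ball_subset_cball])
        (use U in \<open>simp add: converges_locally_uniformly_def\<close>)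
    have "\<forall>\<^sub>F k in sequentially. r k < \<rho> / (norm x + 1)"
      using r(2) \<rho>(1) by (intro order_tendstoD) (auto intro!: divide_pos_pos add_nonneg_pos)
    then show "\<forall>\<^sub>F k in sequentially. continuous_on (ball x 1) (rescale p u (r k)) \<and>
         subharmonic F (ball x 1) (\<lambda>y. ereal (rescale p u (r k) y))"
    proof eventually_elim
      case (elim k)
      have "norm x + 1 < \<rho> / r k"
      proof -
        have n: "0 < norm x + 1" by (simp add: add_nonneg_pos)
        then have "r k * (norm x + 1) < \<rho>" using elim by (simp add: pos_less_divide_eq)
        then show ?thesis using r(1)[of k] by (simp add: pos_less_divide_eq mult.commute)
      qed
      then have "ball x 1 \<subseteq> ball 0 (\<rho> / r k)"
        by (simp add: ball_subset_ball_iff dist_norm)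
      then show ?case
        using rescale_subharmonic[OF u \<rho>(2) r(1)[of k]]
        by (auto intro: continuous_on_subset subharmonic_subset[OF _ _ _ open_ball])
    qed
  qed auto
  show "continuous_on UNIV U" "subharmonic F UNIV (\<lambda>x. ereal (U x))"
    using subharmonic_locally_uniform_limit[OF open_UNIV closed_F loc] by auto
qed

text \<open>The rescaled functions are extended to all of space by composing them with the nearest point
  projection onto the ball where they are controlled; this preserves their Hoelder bound.\<close>

lemma tangent_exists:
  assumes u: "subharmonic F X u" and X: "0 \<in> X" and r: "\<And>j. 0 < r j" "r \<longlonglongrightarrow> 0"
  obtains s U where "strict_mono s"
    "converges_locally_uniformly (\<lambda>k. rescale p u (r (s k))) U"
    "\<And>\<beta>. 0 < \<beta> \<Longrightarrow> \<beta> < 2 - p \<Longrightarrow> converges_locally_holder \<beta> (\<lambda>k. rescale p u (r (s k))) U"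
proof -
  obtain \<rho> C where \<rho>: "0 < \<rho>" "0 \<le> C" "cball 0 \<rho> \<subseteq> X"
    and hold: "\<And>r x y. 0 < r \<Longrightarrow> norm x \<le> \<rho> / r \<Longrightarrow> norm y \<le> \<rho> / r \<Longrightarrow>
       \<bar>rescale p u r x - rescale p u r y\<bar> \<le> C * norm (x - y) powr (2 - p)"
    by (rule rescale_equi_holder[OF u X]) (rule that) 
  define f where "f j x = rescale p u (r j) (closest_point (cball 0 (\<rho> / r j)) x)" for j and x :: "real^'n"
  have pos: "0 < \<rho> / r j" for j using \<rho>(1) r(1) by simp
  have f_hold: "\<bar>f j x - f j y\<bar> \<le> C * norm (x - y) powr (2 - p)" for j x y
  proof -
    let ?S = "cball 0 (\<rho> / r j) :: (real^'n) set"
    have S: "closed ?S" "?S \<noteq> {}" using pos[of j] by (auto simp: less_imp_le)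
    have "closest_point ?S z \<in> ?S" for z using closest_point_in_set[OF S] .
    then have "\<bar>f j x - f j y\<bar> \<le> C * norm (closest_point ?S x - closest_point ?S y) powr (2 - p)"
      unfolding f_def by (intro hold[OF r(1)]) auto
    also have "\<dots> \<le> C * norm (x - y) powr (2 - p)"
      using closest_point_lipschitz[OF convex_cball S, of x y] \<rho>(2) p_less_2
      by (intro mult_left_mono powr_mono2) (auto simp: dist_norm)
    finally show ?thesis .
  qed
  have f_eq: "f j x = rescale p u (r j) x" if "norm x \<le> \<rho> / r j" for j x
    unfolding f_def using that by (simp add: closest_point_self)
  have "f j 0 = 0" for j
    using f_eq[of 0 j] pos[of j] by (simp add: rescale_def less_imp_le)
  then obtain s U where s: "strict_mono (s :: nat \<Rightarrow> nat)"
    and lim: "\<And>K. compact K \<Longrightarrow> uniform_limit K (\<lambda>k. f (s k)) U sequentially"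
    using equi_holder_subsequence[of "2 - p" f C] f_hold p_less_2 by (metis diff_gt_0_iff_gt)
  have U_hold: "\<bar>U x - U y\<bar> \<le> C * norm (x - y) powr (2 - p)" for x y
  proof -
    have "(\<lambda>k. f (s k) z) \<longlonglongrightarrow> U z" for z
      using tendsto_uniform_limitI[OF lim[of "{z}"], of z] by simp
    then have "(\<lambda>k. \<bar>f (s k) x - f (s k) y\<bar>) \<longlonglongrightarrow> \<bar>U x - U y\<bar>"
      by (intro tendsto_intros)
    then show ?thesis by (rule LIMSEQ_le_const2) (use f_hold in auto)
  qed
  have ev: "\<forall>\<^sub>F k in sequentially. \<forall>x\<in>K. f (s k) x = rescale p u (r (s k)) x" if K: "compact K" for K
  proof -
    obtain b where b: "0 < b" "\<forall>x\<in>K. norm x \<le> b"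
      using compact_imp_bounded[OF K] unfolding bounded_pos by blast
    have "(\<lambda>k. r (s k)) \<longlonglongrightarrow> 0" using LIMSEQ_subseq_LIMSEQ[OF r(2) s] by (simp add: o_def)
    then have "\<forall>\<^sub>F k in sequentially. r (s k) < \<rho> / b"
      using b(1) \<rho>(1) by (intro order_tendstoD) auto
    then show ?thesis
    proof eventually_elim
      case (elim k)
      then have "b \<le> \<rho> / r (s k)" using b(1) r(1)[of "s k"] by (simp add: field_simps)
      then show ?case using b(2) f_eq[of _ "s k"] by fastforce
    qed
  qed
  have unif: "uniform_limit K (\<lambda>k. rescale p u (r (s k))) U sequentially" if "compact K" for K
    using lim[OF that] uniform_limit_cong[OF ev[OF that], of U U] by simp
  show thesis
  proof (rule that[OF s])
    show "converges_locally_uniformly (\<lambda>k. rescale p u (r (s k))) U"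
      using unif by (simp add: converges_locally_uniformly_def)
    fix \<beta> assume \<beta>: "0 < \<beta>" "\<beta> < 2 - p"
    show "converges_locally_holder \<beta> (\<lambda>k. rescale p u (r (s k))) U"
      unfolding converges_locally_holder_def
    proof (intro allI impI)
      fix K :: "(real^'n) set" assume K: "compact K"
      show "(\<lambda>k. holder_norm \<beta> K (\<lambda>x. rescale p u (r (s k)) x - U x)) \<longlonglongrightarrow> 0"
      proof (rule holder_norm_tendsto_0[OF \<beta>])
        show "0 \<le> 2 * C" using \<rho>(2) by simp
        show "uniform_limit K (\<lambda>k x. rescale p u (r (s k)) x - U x) (\<lambda>x. 0) sequentially"
          using unif[OF K] by (simp add: uniform_limit_iff dist_real_def)
        show "\<forall>\<^sub>F k in sequentially. \<forall>x\<in>K. \<forall>y\<in>K. \<bar>(rescale p u (r (s k)) x - U x)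
            - (rescale p u (r (s k)) y - U y)\<bar> \<le> 2 * C * norm (x - y) powr (2 - p)"
          using ev[OF K]
        proof eventually_elim
          case (elim k)
          show ?case
          proof (intro ballI)
            fix x y assume "x \<in> K" "y \<in> K"
            then have "rescale p u (r (s k)) x = f (s k) x" "rescale p u (r (s k)) y = f (s k) y"
              using elim by auto
            then show "\<bar>(rescale p u (r (s k)) x - U x) - (rescale p u (r (s k)) y - U y)\<bar>
                \<le> 2 * C * norm (x - y) powr (2 - p)"
              using f_hold[of "s k" x y] U_hold[of x y] by (simp add: abs_le_iff)
          qed
        qed
      qed
    qed
  qed
qed

end

section \<open>The Dirichlet problem with polynomial data\<close>

text \<open>An upper bound for the degree of a polynomial function. A bound instead of the exact degree makes
  the polynomials belonging to each \<open>m\<close> a vector space.\<close>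

inductive poly_deg :: "nat \<Rightarrow> (real^'n \<Rightarrow> real) \<Rightarrow> bool" where
  const: "poly_deg m (\<lambda>x. c)"
| coord: "poly_deg m f \<Longrightarrow> poly_deg (Suc m) (\<lambda>x. x $ i * f x)"
| add: "poly_deg m f \<Longrightarrow> poly_deg m g \<Longrightarrow> poly_deg m (\<lambda>x. f x + g x)"
| lift: "poly_deg m f \<Longrightarrow> poly_deg (Suc m) f"

lemma poly_deg_mono: "poly_deg m f \<Longrightarrow> m \<le> k \<Longrightarrow> poly_deg k f"
  by (induction k) (auto simp: le_Suc_eq intro: poly_deg.lift)

lemma poly_deg_scale: "poly_deg m f \<Longrightarrow> poly_deg m (\<lambda>x. c * f x)"
proof (induction rule: poly_deg.induct)
  case (coord m f i)
  then show ?case using poly_deg.coord[of m "\<lambda>x. c * f x" i] by (simp add: mult.left_commute)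
next
  case (add m f g)
  then show ?case using poly_deg.add[of m "\<lambda>x. c * f x" "\<lambda>x. c * g x"] by (simp add: distrib_left)
qed (auto intro: poly_deg.intros)

lemma poly_deg_sum:
  assumes "finite I" "\<And>i. i \<in> I \<Longrightarrow> poly_deg m (f i)"
  shows "poly_deg m (\<lambda>x. \<Sum>i\<in>I. f i x)"
  using assms by (induction I) (auto intro: poly_deg.intros)

lemma poly_deg_mult: "poly_deg m f \<Longrightarrow> poly_deg k g \<Longrightarrow> poly_deg (m + k) (\<lambda>x. f x * g x)"
proof (induction rule: poly_deg.induct)
  case (const m c)
  then show ?case by (intro poly_deg_mono[OF poly_deg_scale[of k g c]]) auto
next
  case (coord m f i)
  then show ?case using poly_deg.coord[of "m + k" "\<lambda>x. f x * g x" i] by (simp add: mult.assoc)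
next
  case (add m f g')
  then show ?case using poly_deg.add by (simp add: distrib_right)
qed (auto intro: poly_deg.lift)

lemma poly_deg_coord_minus: "poly_deg m f \<Longrightarrow> poly_deg (Suc m) (\<lambda>x. (x $ i - c) * f x)"
  using poly_deg.add[OF poly_deg.coord[of m f i] poly_deg.lift[OF poly_deg_scale[of m f "-c"]]]
  by (simp add: algebra_simps)

lemma norm_sq_eq_sum: "(norm x)\<^sup>2 = (\<Sum>i\<in>UNIV. (x $ i)\<^sup>2)"
  unfolding power2_norm_eq_inner inner_vec_def by (simp add: power2_eq_square)

lemma poly_deg_ball_function:
  fixes y :: "real^'n"
  assumes "poly_deg m f"
  shows "poly_deg (Suc (Suc m)) (\<lambda>x. (R\<^sup>2 - (norm (x - y))\<^sup>2) * f x)"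
proof -
  have "poly_deg (Suc (Suc m)) (\<lambda>x. R\<^sup>2 * f x + (-1) * (\<Sum>i\<in>UNIV. (x $ i - y $ i) * ((x $ i - y $ i) * f x)))"
    by (intro poly_deg.add poly_deg_scale poly_deg_sum poly_deg_coord_minus poly_deg_mono[OF assms] assms) auto
  moreover have "R\<^sup>2 * f x + (-1) * (\<Sum>i\<in>UNIV. (x $ i - y $ i) * ((x $ i - y $ i) * f x))
      = (R\<^sup>2 - (norm (x - y))\<^sup>2) * f x" for x
    unfolding norm_sq_eq_sum[of "x - y"]
    by (simp add: left_diff_distrib sum_distrib_right power2_eq_square mult.assoc)
  ultimately show ?thesis by simp
qed

lemma real_polynomial_function_poly_deg:
  fixes f :: "real^'n \<Rightarrow> real"
  shows "real_polynomial_function f \<Longrightarrow> \<exists>m. poly_deg m f"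
proof (induction rule: real_polynomial_function.induct)
  case (linear f)
  have "f = (\<lambda>x. \<Sum>i\<in>UNIV. x $ i * f (axis i 1))"
  proof
    fix x
    have "f x = f (\<Sum>i\<in>UNIV. x $ i *\<^sub>R axis i 1)"
      by (simp add: basis_expansion scalar_mult_eq_scaleR[symmetric])
    also have "\<dots> = (\<Sum>i\<in>UNIV. x $ i * f (axis i 1))"
      using linear by (simp add: bounded_linear.linear linear_sum linear_scale)
    finally show "f x = (\<Sum>i\<in>UNIV. x $ i * f (axis i 1))" .
  qed
  moreover have "poly_deg (Suc 0) (\<lambda>x. \<Sum>i\<in>UNIV. x $ i * f (axis i 1))"
    by (intro poly_deg_sum poly_deg.coord poly_deg.const) auto
  ultimately show ?case by simp (rule exI)
next
  case (add f g)
  then obtain m k where "poly_deg m f" "poly_deg k g" by blast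
  then show ?case
    using poly_deg.add[OF poly_deg_mono[of m f "max m k"] poly_deg_mono[of k g "max m k"]] by auto
qed (auto intro: poly_deg.const poly_deg_mult)

text \<open>The clause for \<open>m = 0\<close> carries the induction: as \<open>0 - 1 = 0\<close> on natural numbers, without it the term
  \<open>x $ j * g i x\<close> in the derivative of \<open>x $ j * f x\<close> with \<open>f\<close> constant would only be known to have
  degree at most 1.\<close>

lemma poly_deg_derivative:
  "poly_deg m f \<Longrightarrow> \<exists>g. (\<forall>i. poly_deg (m - 1) (g i)) \<and> (m = 0 \<longrightarrow> (\<forall>i. g i = (\<lambda>x. 0))) \<and>
    (\<forall>x. (f has_derivative (\<lambda>h. \<Sum>i\<in>UNIV. g i x * h $ i)) (at x))"
proof (induction rule: poly_deg.induct)
  case (const m c)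
  show ?case
    by (rule exI[of _ "\<lambda>i x. 0"]) (auto intro: poly_deg.const)
next
  case (coord m f j)
  then obtain g where g: "\<forall>i. poly_deg (m - 1) (g i)" "m = 0 \<longrightarrow> (\<forall>i. g i = (\<lambda>x. 0))"
    "\<forall>x. (f has_derivative (\<lambda>h. \<Sum>i\<in>UNIV. g i x * h $ i)) (at x)" by blast
  have "poly_deg m (\<lambda>x. (if i = j then f x else 0) + x $ j * g i x)" for i
  proof (rule poly_deg.add)
    show "poly_deg m (\<lambda>x. if i = j then f x else 0)"
      using coord(1) by (cases "i = j") (auto intro: poly_deg.const)
    show "poly_deg m (\<lambda>x. x $ j * g i x)"
    proof (cases m)
      case 0
      then show ?thesis using g(2) by (simp add: poly_deg.const)
    next
      case (Suc k)
      then show ?thesis using g(1) poly_deg.coord[of k "g i" j] by simp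
    qed
  qed
  moreover have "((\<lambda>x. x $ j * f x) has_derivative
      (\<lambda>h. \<Sum>i\<in>UNIV. ((if i = j then f x else 0) + x $ j * g i x) * h $ i)) (at x)" for x
  proof -
    have "((\<lambda>x. x $ j) has_derivative (\<lambda>h. h $ j)) (at x)"
      by (rule bounded_linear_imp_has_derivative) (rule bounded_linear_vec_nth)
    from has_derivative_mult[OF this g(3)[rule_format]]
    have "((\<lambda>x. x $ j * f x) has_derivative (\<lambda>h. x $ j * (\<Sum>i\<in>UNIV. g i x * h $ i) + h $ j * f x)) (at x)" .
    moreover have "(\<Sum>i\<in>UNIV. ((if i = j then f x else 0) + x $ j * g i x) * h $ i)
        = x $ j * (\<Sum>i\<in>UNIV. g i x * h $ i) + h $ j * f x" for h :: "real^'a"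
    proof -
      have "(\<Sum>i\<in>UNIV. ((if i = j then f x else 0) + x $ j * g i x) * h $ i)
          = (\<Sum>i\<in>UNIV. (if i = j then f x * h $ i else 0)) + (\<Sum>i\<in>UNIV. x $ j * (g i x * h $ i))"
        unfolding sum.distrib[symmetric] by (intro sum.cong) (auto simp: distrib_right)
      then show ?thesis by (simp add: sum_distrib_left mult.commute)
    qed
    ultimately show ?thesis by simp
  qed
  ultimately show ?case
    by (intro exI[of _ "\<lambda>i x. (if i = j then f x else 0) + x $ j * g i x"]) simp
next
  case (add m f1 f2)
  then obtain g1 g2 where
    g1: "\<forall>i. poly_deg (m - 1) (g1 i)" "m = 0 \<longrightarrow> (\<forall>i. g1 i = (\<lambda>x. 0))"
    "\<forall>x. (f1 has_derivative (\<lambda>h. \<Sum>i\<in>UNIV. g1 i x * h $ i)) (at x)" and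
    g2: "\<forall>i. poly_deg (m - 1) (g2 i)" "m = 0 \<longrightarrow> (\<forall>i. g2 i = (\<lambda>x. 0))"
    "\<forall>x. (f2 has_derivative (\<lambda>h. \<Sum>i\<in>UNIV. g2 i x * h $ i)) (at x)" by blast
  show ?case
  proof (intro exI[of _ "\<lambda>i x. g1 i x + g2 i x"] conjI allI impI)
    show "((\<lambda>x. f1 x + f2 x) has_derivative (\<lambda>h. \<Sum>i\<in>UNIV. (g1 i x + g2 i x) * h $ i)) (at x)" for x
      using has_derivative_add[OF g1(3)[rule_format] g2(3)[rule_format]]
      by (simp add: distrib_right sum.distrib)
  qed (use g1 g2 in \<open>auto intro: poly_deg.add\<close>)
next
  case (lift m f)
  then obtain g where g: "\<forall>i. poly_deg (m - 1) (g i)"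
    "\<forall>x. (f has_derivative (\<lambda>h. \<Sum>i\<in>UNIV. g i x * h $ i)) (at x)" by blast
  then show ?case
    using poly_deg_mono[of "m - 1" _ m] by (intro exI[of _ g]) auto
qed

lemma poly_deg_continuous: "poly_deg m f \<Longrightarrow> continuous_on S f"
  by (induction rule: poly_deg.induct) (auto intro!: continuous_intros)

lemma poly_deg_hessian:
  fixes f :: "real^'n \<Rightarrow> real"
  assumes "poly_deg m f"
  obtains H where "C2_with_hessian_on UNIV f H" "\<And>i j. poly_deg (m - 2) (\<lambda>x. H x $ i $ j)"
proof -
  obtain g where g: "\<And>i. poly_deg (m - 1) (g i)"
    "\<And>x. (f has_derivative (\<lambda>h. \<Sum>i\<in>UNIV. g i x * h $ i)) (at x)"
    using poly_deg_derivative[OF assms] by blast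
  have "\<forall>i. \<exists>G. (\<forall>j. poly_deg (m - 1 - 1) (G j)) \<and>
      (\<forall>x. (g i has_derivative (\<lambda>h. \<Sum>j\<in>UNIV. G j x * h $ j)) (at x))"
    using poly_deg_derivative[OF g(1)] by blast
  then obtain G where G: "\<And>i j. poly_deg (m - 1 - 1) (G i j)"
    "\<And>i x. (g i has_derivative (\<lambda>h. \<Sum>j\<in>UNIV. G i j x * h $ j)) (at x)" by metis
  have "C2_with_hessian_on UNIV f (\<lambda>x. \<chi> i j. G i j x)"
  proof (rule C2I[where g = "\<lambda>x. \<chi> i. g i x"])
    show "continuous_on UNIV (\<lambda>x. \<chi> i j. G i j x)"
      by (intro continuous_on_vec_lambda poly_deg_continuous[OF G(1)])
    show "(f has_derivative (\<lambda>h. (\<chi> i. g i x) \<bullet> h)) (at x)" for x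
      using g(2)[of x] by (simp add: inner_vec_def)
    show "((\<lambda>x. \<chi> i. g i x) has_derivative (\<lambda>h. (\<chi> i j. G i j x) *v h)) (at x)" for x
    proof (subst has_derivative_componentwise_within, rule ballI)
      fix b :: "real^'n" assume "b \<in> Basis"
      then obtain i where b: "b = axis i 1" by (auto simp: Basis_vec_def)
      show "((\<lambda>x. (\<chi> i. g i x) \<bullet> b) has_derivative (\<lambda>h. ((\<chi> i j. G i j x) *v h) \<bullet> b)) (at x)"
        using G(2)[of i x] by (simp add: b inner_axis matrix_vector_mult_def)
    qed
  qed simp
  moreover have "m - 1 - 1 = m - 2" by simp
  ultimately show thesis using that[of "\<lambda>x. \<chi> i j. G i j x"] G(1) by simp
qed

lemma poly_deg_on_line: "poly_deg m f \<Longrightarrow> \<exists>q. \<forall>t. f (x + t *\<^sub>R v) = poly q t"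
proof (induction rule: poly_deg.induct)
  case (const m c)
  show ?case by (rule exI[of _ "[:c:]"]) simp
next
  case (coord m f i)
  then obtain q where "\<forall>t. f (x + t *\<^sub>R v) = poly q t" by blast
  then show ?case by (intro exI[of _ "[:x $ i, v $ i:] * q"]) (simp add: algebra_simps)
next
  case (add m f g)
  then obtain q1 q2 where "\<forall>t. f (x + t *\<^sub>R v) = poly q1 t" "\<forall>t. g (x + t *\<^sub>R v) = poly q2 t" by blast
  then show ?case by (intro exI[of _ "q1 + q2"]) simp
qed

lemma poly_deg_zero_on_ball:
  assumes f: "poly_deg m f" and R: "0 < R" and zero: "\<And>x. x \<in> ball y R \<Longrightarrow> f x = 0"
  shows "f x = 0"
proof -
  obtain q where q: "\<And>t. f (y + t *\<^sub>R (x - y)) = poly q t"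
    using poly_deg_on_line[OF f] by blast
  define d where "d = R / (norm (x - y) + 1)"
  have d: "0 < d" using R by (simp add: d_def add_nonneg_pos)
  have "poly q t = 0" if t: "0 < t" "t < d" for t
  proof -
    have "t * norm (x - y) \<le> t * (norm (x - y) + 1)" using t by simp
    also have "\<dots> < d * (norm (x - y) + 1)" using t by (intro mult_strict_right_mono) (auto simp: add_nonneg_pos)
    also have "\<dots> = R" by (simp add: d_def add_nonneg_eq_0_iff)
    finally have "dist (y + t *\<^sub>R (x - y)) y < R" using t by (simp add: dist_norm)
    then have "y + t *\<^sub>R (x - y) \<in> ball y R" by (simp add: dist_commute)
    from zero[OF this] show ?thesis by (simp add: q)
  qed
  then have "{0<..<d} \<subseteq> {t. poly q t = 0}" by auto
  then have "infinite {t. poly q t = 0}"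
    using d infinite_Ioo finite_subset by blast
  then have "q = 0" using poly_roots_finite by blast
  then show ?thesis using q[of 1] by simp
qed

text \<open>The dimension count behind the Dirichlet problem takes place in the vector space of all real
  functions.\<close>

interpretation fun_space: vector_space "\<lambda>c (f :: 'a \<Rightarrow> real) x. c * f x"
  by unfold_locales (auto simp: fun_eq_iff algebra_simps)

lemma poly_deg_finite_span:
  "\<exists>B. finite B \<and> (\<forall>f :: real^'n \<Rightarrow> real. poly_deg m f \<longrightarrow> f \<in> fun_space.span B)"
proof -
  define B :: "nat \<Rightarrow> (real^'n \<Rightarrow> real) set"
    where "B = rec_nat {\<lambda>x. 1} (\<lambda>m B. B \<union> (\<Union>i. (\<lambda>b x. x $ i * b x) ` B))"
  have B_0: "B 0 = {\<lambda>x. 1}" and B_Suc: "B (Suc m) = B m \<union> (\<Union>i. (\<lambda>b x. x $ i * b x) ` B m)" for m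
    by (simp_all add: B_def)
  have fin: "finite (B m)" for m
    by (induction m) (simp_all add: B_0 B_Suc)
  have one: "(\<lambda>x. 1) \<in> B m" for m
    by (induction m) (simp_all add: B_0 B_Suc)
  have "f \<in> fun_space.span (B m)" if "poly_deg m f" for m and f :: "real^'n \<Rightarrow> real"
    using that
  proof (induction rule: poly_deg.induct)
    case (const m c)
    show ?case using fun_space.span_scale[OF fun_space.span_base[OF one[of m]], of c] by simp
  next
    case (coord m f i)
    let ?P = "{f. (\<lambda>x. x $ i * f x) \<in> fun_space.span (B (Suc m))}"
    have "fun_space.subspace ?P"
    proof (rule fun_space.subspaceI)
      show "0 \<in> ?P"
        using fun_space.span_zero[of "B (Suc m)"] by (simp add: zero_fun_def)
      show "f + g \<in> ?P" if "f \<in> ?P" "g \<in> ?P" for f g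
        using fun_space.span_add[of _ "B (Suc m)"] that by (fastforce simp: plus_fun_def distrib_left)
      show "(\<lambda>x. c * f x) \<in> ?P" if "f \<in> ?P" for c f
        using fun_space.span_scale[of _ "B (Suc m)" c] that by (fastforce simp: mult.left_commute)
    qed
    moreover have "B m \<subseteq> ?P"
      by (auto simp: B_Suc intro!: fun_space.span_base)
    ultimately have "fun_space.span (B m) \<subseteq> ?P"
      by (intro fun_space.span_minimal)
    then show ?case using coord.IH by blast
  next
    case (add m f g)
    then show ?case using fun_space.span_add[of f "B m" g] by (simp add: plus_fun_def)
  next
    case (lift m f)
    then show ?case using fun_space.span_mono[of "B m" "B (Suc m)"] by (auto simp: B_Suc)
  qed
  then show ?thesis using fin by blast
qed

text \<open>An injective linear endomorphism of a finite-dimensional space is surjective, by counting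
  independent vectors. The map is given as a relation, since the operator to which this applies
  is described by the existence of a Hessian and makes sense for smooth functions only.\<close>

lemma (in vector_space) injective_relation_surjective:
  assumes W: "subspace W" "finite B0" "W \<subseteq> span B0"
    and total: "\<And>f. f \<in> W \<Longrightarrow> \<exists>g\<in>W. Rel f g"
    and add: "\<And>f f' g g'. Rel f g \<Longrightarrow> Rel f' g' \<Longrightarrow> Rel (f + f') (g + g')"
    and scale: "\<And>c f g. Rel f g \<Longrightarrow> Rel (scale c f) (scale c g)"
    and inj: "\<And>f. f \<in> W \<Longrightarrow> Rel f 0 \<Longrightarrow> f = 0"
    and g: "g \<in> W"
  shows "\<exists>f\<in>W. Rel f g"
proof -
  obtain B where B: "B \<subseteq> W" "independent B" "W \<subseteq> span B"
    using maximal_independent_subset[of W] by blast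
  have finB: "finite B"
    using independent_span_bound[OF W(2) B(2)] B(1) W(3) by blast
  obtain T where T: "\<And>b. b \<in> B \<Longrightarrow> T b \<in> W" "\<And>b. b \<in> B \<Longrightarrow> Rel b (T b)"
    using total B(1) by (metis subsetD)
  have rel_zero: "Rel 0 0"
    using total[OF subspace_0[OF W(1)]] scale[of _ _ 0] by fastforce
  have rel_sum: "Rel (\<Sum>b\<in>C. scale (c b) b) (\<Sum>b\<in>C. scale (c b) (T b))" if "C \<subseteq> B" for c C
    using finite_subset[OF that finB] that
    by (induction C rule: finite_induct) (auto intro: rel_zero add scale T(2))
  have sum_W: "(\<Sum>b\<in>B. scale (c b) b) \<in> W" for c
    using B(1) by (intro subspace_sum[OF W(1)] subspace_scale[OF W(1)]) auto
  have injT: "inj_on T B"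
  proof (rule inj_onI)
    fix a b assume ab: "a \<in> B" "b \<in> B" "T a = T b"
    have "Rel (a + scale (-1) (b)) (T a + scale (-1) (T b))"
      using ab T(2) by (intro add scale)
    then have "Rel (a - b) 0" using ab(3) by simp
    then show "a = b"
      using inj[of "a - b"] subspace_diff[OF W(1)] B(1) ab by auto
  qed
  have ind: "independent (T ` B)"
  proof (rule independent_if_scalars_zero)
    fix u v assume z: "(\<Sum>x\<in>T ` B. scale (u x) x) = 0" and v: "v \<in> T ` B"
    have "(\<Sum>b\<in>B. scale (u (T b)) (T b)) = 0"
      using z by (simp add: sum.reindex[OF injT])
    then have "(\<Sum>b\<in>B. scale (u (T b)) b) = 0"
      using rel_sum[OF subset_refl, of "\<lambda>b. u (T b)"] inj[OF sum_W] by simp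
    moreover obtain b where "b \<in> B" "v = T b" using v by blast
    ultimately show "u v = 0"
      using B(2) finB independent_explicit_finite_subsets[of B] by (metis subset_refl)
  qed (use finB in simp)
  have "g \<in> span (T ` B)"
  proof (rule ccontr)
    assume ng: "g \<notin> span (T ` B)"
    then have i: "independent (insert g (T ` B))"
      using independent_insertI[OF _ ind] by blast
    have "insert g (T ` B) \<subseteq> span B" using g T(1) B(3) by blast
    from independent_span_bound[OF finB i this]
    have "card (insert g (T ` B)) \<le> card B" by blast
    moreover have "g \<notin> T ` B" using ng span_base by blast
    ultimately show False using finB card_image[OF injT] by simp
  qed
  then obtain u where "g = (\<Sum>x\<in>T ` B. scale (u x) x)"
    using span_finite[of "T ` B"] finB by auto
  then have "g = (\<Sum>b\<in>B. scale (u (T b)) (T b))" by (simp add: sum.reindex[OF injT])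
  then have "Rel (\<Sum>b\<in>B. scale (u (T b)) b) g" using rel_sum[OF subset_refl, of "\<lambda>b. u (T b)"] by simp
  then show ?thesis using sum_W[of "\<lambda>b. u (T b)"] by blast
qed

section \<open>Sums of subsolutions of a linear equation\<close>

lemma subharmonic_mono:
  assumes "subharmonic F X u" "F \<subseteq> F'"
  shows "subharmonic F' X u"
  using assms unfolding subharmonic_def by (meson subsetD)

text \<open>A linear functional on matrices, given by a matrix \<open>L\<close>, is degenerate elliptic and nontrivial
  if it is nonnegative on the cone of positive semidefinite matrices and positive at the identity.\<close>

locale elliptic_functional =
  fixes L :: "real^'n^'n"
  assumes L_psd: "P \<in> psd \<Longrightarrow> 0 \<le> L \<bullet> P" and L_id: "0 < L \<bullet> mat 1"
begin

definition half_space :: "(real^'n^'n) set"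
  where "half_space = {A \<in> Sym2. 0 \<le> L \<bullet> A}"

lemma half_space_mono: "A \<in> half_space \<Longrightarrow> P \<in> psd \<Longrightarrow> A + P \<in> half_space"
  using L_psd[of P] by (auto simp: half_space_def psd_def Sym2_def transpose_def vec_eq_iff inner_add_right)

lemma harmonic_comparison:
  assumes u: "subharmonic half_space X u" and R: "cball y R \<subseteq> X"
    and h: "C2_with_hessian_on UNIV h H" "\<And>x. L \<bullet> H x = 0"
    and bd: "\<And>x. x \<in> sphere y R \<Longrightarrow> u x \<le> ereal (h x)" and x: "x \<in> cball y R"
  shows "u x \<le> ereal (h x)"
proof (rule subharmonic_comparison_ball[OF u R _ C2_subset[OF h(1) subset_UNIV open_ball] _ bd x])
  show "continuous_on (cball y R) h"
    by (rule continuous_on_subset[OF C2_continuous_on[OF h(1)] subset_UNIV])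
  show "H x + (2 * - \<eta>) *\<^sub>R mat 1 \<notin> half_space" if "0 < \<eta>" for x \<eta>
    using L_id that h(2)[of x] by (simp add: half_space_def inner_add_right inner_diff_right not_le)
qed

lemma smooth_harmonic_subharmonic:
  assumes h: "C2_with_hessian_on UNIV h H" "\<And>x. L \<bullet> H x = 0"
  shows "subharmonic half_space UNIV (\<lambda>x. ereal (h x))"
  by (rule subharmonic_smooth[OF h(1) _ half_space_mono])
    (use C2_hessian_symmetric[OF h(1)] h(2) in \<open>auto simp: half_space_def\<close>)

lemma smooth_harmonic_zero_boundary:
  assumes h: "C2_with_hessian_on UNIV h H" "\<And>x. L \<bullet> H x = 0"
    and bd: "\<And>x. x \<in> sphere y R \<Longrightarrow> h x = 0" and x: "x \<in> cball y R"
  shows "h x = 0"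
proof -
  have h': "C2_with_hessian_on UNIV (\<lambda>x. (-1) * h x) (\<lambda>x. (-1) *\<^sub>R H x)"
    by (rule C2_scale[OF h(1)])
  have zero: "C2_with_hessian_on UNIV (\<lambda>x. 0) (\<lambda>x. 0)"
    by (rule C2_const) simp
  have "ereal (h x) \<le> ereal 0"
    by (rule harmonic_comparison[OF smooth_harmonic_subharmonic[OF h] subset_UNIV zero _ _ x]) (use bd in auto)
  moreover have "ereal ((-1) * h x) \<le> ereal 0"
    by (rule harmonic_comparison[OF smooth_harmonic_subharmonic[OF h'] subset_UNIV zero _ _ x]) (use bd h(2) in auto)
  ultimately show ?thesis by simp
qed

text \<open>The map \<open>q \<mapsto> L \<bullet> D\<^sup>2((R\<^sup>2 - |x - y|\<^sup>2) q)\<close> sends polynomials of degree at most \<open>m\<close> to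
  such polynomials, and it is injective by the maximum principle; hence it is surjective, and
  correcting \<open>g\<close> by a multiple of \<open>R\<^sup>2 - |x - y|\<^sup>2\<close> makes it harmonic.\<close>

lemma polynomial_dirichlet:
  assumes g: "poly_deg m g" and R: "0 < R"
  obtains h H where "C2_with_hessian_on UNIV h H" "\<And>x. L \<bullet> H x = 0"
    "\<And>x. x \<in> sphere y R \<Longrightarrow> h x = g x"
proof -
  let ?b = "\<lambda>q x. (R\<^sup>2 - (norm (x - y))\<^sup>2) * q x"
  define Rel where "Rel q t = (\<exists>H. C2_with_hessian_on UNIV (?b q) H \<and> (\<forall>x. t x = L \<bullet> H x))"
    for q t :: "real^'n \<Rightarrow> real"
  define W :: "(real^'n \<Rightarrow> real) set" where "W = {f. poly_deg m f}"
  have entries: "poly_deg k (\<lambda>x. L \<bullet> H x)" if "\<And>i j. poly_deg k (\<lambda>x. H x $ i $ j)" for k H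
    unfolding inner_vec_def inner_real_def by (intro poly_deg_sum poly_deg_scale that) auto
  obtain Hg where Hg: "C2_with_hessian_on UNIV g Hg" "\<And>i j. poly_deg (m - 2) (\<lambda>x. Hg x $ i $ j)"
    using poly_deg_hessian[OF g] by blast
  have "poly_deg m (\<lambda>x. L \<bullet> Hg x)"
    by (rule poly_deg_mono[OF entries[OF Hg(2)]]) simp
  then have s: "(\<lambda>x. L \<bullet> Hg x) \<in> W" by (simp add: W_def)
  have "\<exists>q\<in>W. Rel q (\<lambda>x. L \<bullet> Hg x)"
  proof -
    obtain B :: "(real^'n \<Rightarrow> real) set" where B: "finite B" "\<And>f. poly_deg m f \<Longrightarrow> f \<in> fun_space.span B"
      using poly_deg_finite_span[of m] by blast
    show ?thesis
    proof (rule fun_space.injective_relation_surjective[OF _ B(1) _ _ _ _ _ s])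
      show "fun_space.subspace W"
        by (rule fun_space.subspaceI)
          (auto simp: W_def zero_fun_def plus_fun_def intro: poly_deg.intros poly_deg_scale)
      show "W \<subseteq> fun_space.span B" using B(2) by (auto simp: W_def)
      show "\<exists>t\<in>W. Rel q t" if "q \<in> W" for q
      proof -
        have "poly_deg (Suc (Suc m)) (?b q)"
          using that by (intro poly_deg_ball_function) (simp add: W_def)
        then obtain H where H: "C2_with_hessian_on UNIV (?b q) H" "\<And>i j. poly_deg (Suc (Suc m) - 2) (\<lambda>x. H x $ i $ j)"
          using poly_deg_hessian by blast
        have "(\<lambda>x. L \<bullet> H x) \<in> W" using entries[OF H(2)] by (simp add: W_def)
        then show ?thesis using H(1) unfolding Rel_def by (intro bexI[of _ "\<lambda>x. L \<bullet> H x"]) auto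
      qed
      show "Rel (f + f') (t + t')" if r: "Rel f t" "Rel f' t'" for f f' t t'
      proof -
        obtain H H' where H: "C2_with_hessian_on UNIV (?b f) H" "\<forall>x. t x = L \<bullet> H x"
          and H': "C2_with_hessian_on UNIV (?b f') H'" "\<forall>x. t' x = L \<bullet> H' x"
          using r unfolding Rel_def by blast
        have "?b (f + f') = (\<lambda>x. ?b f x + ?b f' x)" by (simp add: distrib_left fun_eq_iff)
        then show ?thesis using C2_add[OF H(1) H'(1)] H(2) H'(2)
          unfolding Rel_def by (intro exI[of _ "\<lambda>x. H x + H' x"]) (simp add: inner_add_right)
      qed
      show "Rel (\<lambda>x. c * f x) (\<lambda>x. c * t x)" if r: "Rel f t" for c f t
      proof -
        obtain H where H: "C2_with_hessian_on UNIV (?b f) H" "\<forall>x. t x = L \<bullet> H x"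
          using r unfolding Rel_def by blast
        have "?b (\<lambda>x. c * f x) = (\<lambda>x. c * ?b f x)" by (simp add: mult.left_commute)
        then show ?thesis using C2_scale[OF H(1), of c] H(2)
          unfolding Rel_def by (intro exI[of _ "\<lambda>x. c *\<^sub>R H x"]) simp
      qed
      show "q = 0" if q: "q \<in> W" "Rel q 0" for q
      proof -
        obtain H where H: "C2_with_hessian_on UNIV (?b q) H" "\<And>x. L \<bullet> H x = 0"
          using q(2) unfolding Rel_def by auto
        have "q x = 0" if x: "x \<in> ball y R" for x
        proof -
          have "?b q x = 0"
            by (rule smooth_harmonic_zero_boundary[OF H, of y R])
              (use x in \<open>auto simp: dist_norm norm_minus_commute\<close>)
          moreover have "(norm (x - y))\<^sup>2 < R\<^sup>2"
            using x by (simp add: dist_norm norm_minus_commute power_strict_mono)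
          ultimately show ?thesis by simp
        qed
        then have "q x = 0" for x
          using poly_deg_zero_on_ball[of m q R y] q(1) R by (simp add: W_def)
        then show ?thesis by (simp add: fun_eq_iff)
      qed
    qed
  qed
  then obtain q H where q: "C2_with_hessian_on UNIV (?b q) H" "\<And>x. L \<bullet> Hg x = L \<bullet> H x"
    unfolding Rel_def by blast
  show thesis
  proof (rule that[of "\<lambda>x. g x + (-1) * ?b q x" "\<lambda>x. Hg x + (-1) *\<^sub>R H x"])
    show "C2_with_hessian_on UNIV (\<lambda>x. g x + (-1) * ?b q x) (\<lambda>x. Hg x + (-1) *\<^sub>R H x)"
      by (intro C2_add C2_scale Hg(1) q(1))
    show "L \<bullet> (Hg x + (-1) *\<^sub>R H x) = 0" for x
      using q(2)[of x] by (simp add: inner_diff_right)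
    show "g x + (-1) * ?b q x = g x" if "x \<in> sphere y R" for x
      using that by (simp add: dist_norm norm_minus_commute)
  qed
qed

lemma harmonic_majorant_on_sphere:
  assumes u: "continuous_on (sphere z R) u" and R: "0 < R" and \<epsilon>: "0 < \<epsilon>"
  shows "\<exists>h H. C2_with_hessian_on UNIV h H \<and> (\<forall>x. L \<bullet> H x = 0) \<and>
    (\<forall>x\<in>sphere z R. u x \<le> h x \<and> h x \<le> u x + 2 * \<epsilon>)"
proof -
  have "continuous_on (sphere z R) (\<lambda>x. u x + \<epsilon>)" by (intro continuous_intros u)
  then obtain g where g: "real_polynomial_function g"
    "\<And>x. x \<in> sphere z R \<Longrightarrow> \<bar>u x + \<epsilon> - g x\<bar> < \<epsilon>"
    using Stone_Weierstrass_real_polynomial_function[OF compact_sphere _ \<epsilon>] by blast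
  obtain m where m: "poly_deg m g" using real_polynomial_function_poly_deg[OF g(1)] by blast
  obtain h H where h: "C2_with_hessian_on UNIV h H" "\<And>x. L \<bullet> H x = 0"
    "\<And>x. x \<in> sphere z R \<Longrightarrow> h x = g x"
    using polynomial_dirichlet[OF m R, of z] by blast
  have "u x \<le> h x \<and> h x \<le> u x + 2 * \<epsilon>" if "x \<in> sphere z R" for x
    using g(2)[OF that] h(3)[OF that] by (auto simp: abs_less_iff)
  then show ?thesis using h(1,2) by blast
qed

lemma C2_sum:
  assumes "finite I" "\<And>i. i \<in> I \<Longrightarrow> C2_with_hessian_on UNIV (h i) (H i)"
  shows "C2_with_hessian_on UNIV (\<lambda>x. \<Sum>i\<in>I. h i x) (\<lambda>x. \<Sum>i\<in>I. H i x)"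
  using assms
proof (induction I)
  case empty
  then show ?case by (simp add: C2_const)
next
  case (insert a I)
  then show ?case
    using C2_add[of UNIV "h a" "H a" "\<lambda>x. \<Sum>i\<in>I. h i x" "\<lambda>x. \<Sum>i\<in>I. H i x"] by simp
qed

text \<open>If the sum is touched from above at \<open>z\<close> by a strict supersolution, then on a small sphere
  around \<open>z\<close> the summands are approximated from above by polynomials. The harmonic polynomials
  with these boundary values lie above the summands, while their sum lies strictly below the
  test function at \<open>z\<close>.\<close>

lemma half_space_subharmonic_sum:
  fixes u :: "'i \<Rightarrow> real^'n \<Rightarrow> real"
  assumes I: "finite I" and X: "open X"
    and u: "\<And>i. i \<in> I \<Longrightarrow> subharmonic half_space X (\<lambda>x. ereal (u i x))"
    and cont: "\<And>i. i \<in> I \<Longrightarrow> continuous_on X (u i)"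
  shows "subharmonic half_space X (\<lambda>x. ereal (\<Sum>i\<in>I. u i x))"
proof -
  have conts: "continuous_on X (\<lambda>x. \<Sum>i\<in>I. u i x)"
    using cont by (intro continuous_intros)
  show ?thesis
    unfolding subharmonic_ereal_iff[OF conts]
  proof (intro conjI allI impI; (elim conjE)?)
    fix z V \<phi> H
    assume C2: "C2_with_hessian_on V \<phi> H" and z: "z \<in> V" and V: "V \<subseteq> X"
      and le: "\<forall>y\<in>V. (\<Sum>i\<in>I. u i y) \<le> \<phi> y" and eq: "(\<Sum>i\<in>I. u i z) = \<phi> z"
    show "H z \<in> half_space"
    proof (rule ccontr)
      assume "H z \<notin> half_space"
      then have neg: "L \<bullet> H z < 0"
        using C2_hessian_symmetric[OF C2 z] by (simp add: half_space_def)
      define \<eta> where "\<eta> = - (L \<bullet> H z) / (4 * (L \<bullet> mat 1))"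
      have \<eta>: "0 < \<eta>" using neg L_id by (simp add: \<eta>_def divide_neg_pos)
      have "L \<bullet> (H z + (2 * \<eta>) *\<^sub>R mat 1) = L \<bullet> H z / 2"
        using L_id by (simp add: \<eta>_def inner_add_right inner_diff_right)
      then have negz: "L \<bullet> (H z + (2 * \<eta>) *\<^sub>R mat 1) < 0" using neg by simp
      have "open V" using C2_open[OF C2] .
      have "isCont (\<lambda>x. L \<bullet> (H x + (2 * \<eta>) *\<^sub>R mat 1)) z"
        using C2_hessian_continuous_on[OF C2] z \<open>open V\<close>
        by (auto intro!: continuous_intros simp: continuous_on_eq_continuous_at)
      from iffD1[OF tendsto_at_iff_tendsto_nhds this[unfolded isCont_def]]
      have "\<forall>\<^sub>F x in nhds z. L \<bullet> (H x + (2 * \<eta>) *\<^sub>R mat 1) < 0"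
        by (rule order_tendstoD(2)) (rule negz)
      moreover have "\<forall>\<^sub>F x in nhds z. x \<in> V"
        using \<open>open V\<close> z by (rule eventually_nhds_in_open)
      ultimately have "\<forall>\<^sub>F x in nhds z. L \<bullet> (H x + (2 * \<eta>) *\<^sub>R mat 1) < 0 \<and> x \<in> V"
        by (rule eventually_conj)
      then obtain d where d: "0 < d" "\<And>x. dist x z < d \<Longrightarrow> L \<bullet> (H x + (2 * \<eta>) *\<^sub>R mat 1) < 0 \<and> x \<in> V"
        unfolding eventually_nhds_metric by blast
      define R where "R = d / 2"
      have R: "0 < R" "cball z R \<subseteq> V"
        using d by (auto simp: R_def dist_commute)
      have negH: "L \<bullet> (H x + (2 * \<eta>) *\<^sub>R mat 1) < 0" if "x \<in> cball z R" for x
        using d that by (auto simp: R_def dist_commute)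
      define N where "N = real (card I)"
      define \<epsilon> where "\<epsilon> = \<eta> * R\<^sup>2 / (2 * (N + 1))"
      have N: "0 \<le> N" by (simp add: N_def)
      have \<epsilon>: "0 < \<epsilon>" "2 * N * \<epsilon> < \<eta> * R\<^sup>2"
        using \<eta> R(1) N by (auto simp: \<epsilon>_def field_simps add_nonneg_pos)
      have "\<exists>h H. C2_with_hessian_on UNIV h H \<and> (\<forall>x. L \<bullet> H x = 0) \<and>
          (\<forall>x\<in>sphere z R. u i x \<le> h x \<and> h x \<le> u i x + 2 * \<epsilon>)" if i: "i \<in> I" for i
      proof (rule harmonic_majorant_on_sphere[OF _ R(1) \<epsilon>(1)])
        have "sphere z R \<subseteq> X" using R(2) V sphere_cball[of z R] by blast
        then show "continuous_on (sphere z R) (u i)" by (rule continuous_on_subset[OF cont[OF i]])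
      qed
      then have "\<forall>i. \<exists>h H. i \<in> I \<longrightarrow> C2_with_hessian_on UNIV h H \<and> (\<forall>x. L \<bullet> H x = 0) \<and>
          (\<forall>x\<in>sphere z R. u i x \<le> h x \<and> h x \<le> u i x + 2 * \<epsilon>)" by blast
      then obtain h K where h: "\<And>i. i \<in> I \<Longrightarrow> C2_with_hessian_on UNIV (h i) (K i)"
        "\<And>i x. i \<in> I \<Longrightarrow> L \<bullet> K i x = 0"
        "\<And>i x. i \<in> I \<Longrightarrow> x \<in> sphere z R \<Longrightarrow> u i x \<le> h i x \<and> h i x \<le> u i x + 2 * \<epsilon>"
        by metis
      have zR: "z \<in> cball z R" using R(1) by simp
      have RX: "cball z R \<subseteq> X" using R(2) V by blast
      have "u i z \<le> h i z" if i: "i \<in> I" for i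
        using harmonic_comparison[OF u[OF i] RX h(1)[OF i] h(2)[OF i] _ zR] h(3)[OF i] by simp
      then have "(\<Sum>i\<in>I. u i z) \<le> (\<Sum>i\<in>I. h i z)"
        by (rule sum_mono)
      moreover have "ereal (\<Sum>i\<in>I. h i z) \<le> ereal (\<phi> z + \<eta> * (norm (z - z))\<^sup>2 + (2 * N * \<epsilon> - \<eta> * R\<^sup>2))"
      proof (rule subharmonic_comparison[where u = "\<lambda>x. ereal (\<Sum>i\<in>I. h i x)"
            and \<psi> = "\<lambda>x. \<phi> x + \<eta> * (norm (x - z))\<^sup>2 + (2 * N * \<epsilon> - \<eta> * R\<^sup>2)",
            OF _ compact_cball subset_UNIV ball_subset_cball _ _ _ _ zR])
        show "subharmonic half_space UNIV (\<lambda>x. ereal (\<Sum>i\<in>I. h i x))"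
          by (rule smooth_harmonic_subharmonic[OF C2_sum[OF I h(1)]]) (use h(2) in \<open>auto simp: inner_sum_right\<close>)
        show "continuous_on (cball z R) (\<lambda>x. \<phi> x + \<eta> * (norm (x - z))\<^sup>2 + (2 * N * \<epsilon> - \<eta> * R\<^sup>2))"
          using continuous_on_subset[OF C2_continuous_on[OF C2] R(2)] by (intro continuous_intros)
        show "C2_with_hessian_on (ball z R) (\<lambda>x. \<phi> x + \<eta> * (norm (x - z))\<^sup>2 + (2 * N * \<epsilon> - \<eta> * R\<^sup>2))
            (\<lambda>x. H x + (2 * \<eta>) *\<^sub>R mat 1)"
          by (rule C2_add_norm_sq[OF C2_subset[OF C2]]) (use R(2) ball_subset_cball[of z R] in auto)
        show "H x + (2 * \<eta>) *\<^sub>R mat 1 \<notin> half_space" if "x \<in> ball z R" for x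
          using negH[of x] that by (simp add: half_space_def)
        show "ereal (\<Sum>i\<in>I. h i x) \<le> ereal (\<phi> x + \<eta> * (norm (x - z))\<^sup>2 + (2 * N * \<epsilon> - \<eta> * R\<^sup>2))"
          if "x \<in> cball z R - ball z R" for x
        proof -
          have x: "x \<in> sphere z R" "norm (x - z) = R" "x \<in> V"
            using that R(2) by (auto simp: dist_norm norm_minus_commute)
          have "(\<Sum>i\<in>I. h i x) \<le> (\<Sum>i\<in>I. u i x + 2 * \<epsilon>)"
            using h(3) x(1) by (intro sum_mono) auto
          also have "\<dots> = (\<Sum>i\<in>I. u i x) + 2 * N * \<epsilon>"
            by (simp add: sum.distrib N_def)
          also have "\<dots> \<le> \<phi> x + 2 * N * \<epsilon>" using le x(3) by simp
          finally show ?thesis using x(2) by simp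
        qed
      qed
      ultimately show False using \<epsilon>(2) eq by simp
    qed
  qed (rule X)
qed

end

text \<open>Any separating functional is nonnegative on \<open>F\<close> and hence on the positive semidefinite matrices.
  It cannot vanish at the identity: a small multiple of \<open>A\<close>, on which it is negative, added to the
  identity is still positive semidefinite.\<close>

lemma convex_cone_separation:
  fixes F :: "(real^'n^'n) set"
  assumes F: "subequation F" "cone F" "convex F" and A: "A \<in> Sym2" "A \<notin> F"
  obtains L where "elliptic_functional L" "L \<bullet> A < 0" "\<And>B. B \<in> F \<Longrightarrow> 0 \<le> L \<bullet> B"
proof -
  have cl: "closed F" and ne: "F \<noteq> {}" and mono: "\<And>A P. A \<in> F \<Longrightarrow> P \<in> psd \<Longrightarrow> A + P \<in> F"
    using F(1) by (auto simp: subequation_def)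
  have sc: "c *\<^sub>R B \<in> F" if "B \<in> F" "0 \<le> c" for B c
    using F(2) that by (simp add: cone_def)
  obtain B0 where "B0 \<in> F" using ne by blast
  from sc[OF this, of 0] have zero: "0 \<in> F" by simp
  obtain L b where Lb: "L \<bullet> A < b" "\<And>B. B \<in> F \<Longrightarrow> b < L \<bullet> B"
    using separating_hyperplane_closed_point[OF F(3) cl A(2)] by blast
  have b: "b < 0" using Lb(2)[OF zero] by simp
  have nonneg: "0 \<le> L \<bullet> B" if B: "B \<in> F" for B
  proof (rule ccontr)
    assume "\<not> 0 \<le> L \<bullet> B"
    then have "b < (b / (L \<bullet> B)) * (L \<bullet> B)"
      using Lb(2)[OF sc[OF B, of "b / (L \<bullet> B)"]] b by (simp add: divide_nonpos_neg)
    then show False using \<open>\<not> 0 \<le> L \<bullet> B\<close> by simp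
  qed
  have psd: "0 \<le> L \<bullet> P" if "P \<in> psd" for P
    using nonneg[OF mono[OF zero that]] by simp
  obtain K where K: "0 < K" "mat 1 + (1 / K) *\<^sub>R A \<in> psd"
    using symmetric_near_identity_psd[OF A(1)] by blast
  have "0 \<le> L \<bullet> mat 1 + (L \<bullet> A) / K"
    using psd[OF K(2)] by (simp add: inner_add_right)
  moreover have "(L \<bullet> A) / K < 0" using Lb(1) b K(1) by (simp add: divide_neg_pos)
  ultimately have "0 < L \<bullet> mat 1" by linarith
  then show thesis
    using that[of L] psd nonneg Lb(1) b by (simp add: elliptic_functional_def)
qed

text \<open>A convex cone is the intersection of the half spaces containing it, which reduces the claim to
  linear equations with constant coefficients.\<close>

lemma convex_subharmonic_sum:
  fixes F :: "(real^'n^'n) set" and u :: "'i \<Rightarrow> real^'n \<Rightarrow> real"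
  assumes F: "subequation F" "cone F" "convex F" and I: "finite I" and X: "open X"
    and u: "\<And>i. i \<in> I \<Longrightarrow> subharmonic F X (\<lambda>x. ereal (u i x))"
    and cont: "\<And>i. i \<in> I \<Longrightarrow> continuous_on X (u i)"
  shows "subharmonic F X (\<lambda>x. ereal (\<Sum>i\<in>I. u i x))"
proof -
  have conts: "continuous_on X (\<lambda>x. \<Sum>i\<in>I. u i x)"
    using cont by (intro continuous_intros)
  show ?thesis
    unfolding subharmonic_ereal_iff[OF conts]
  proof (intro conjI allI impI; (elim conjE)?)
    fix z V \<phi> H
    assume C2: "C2_with_hessian_on V \<phi> H" and z: "z \<in> V" and V: "V \<subseteq> X"
      and le: "\<forall>y\<in>V. (\<Sum>i\<in>I. u i y) \<le> \<phi> y" and eq: "(\<Sum>i\<in>I. u i z) = \<phi> z"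
    show "H z \<in> F"
    proof (rule ccontr)
      assume "H z \<notin> F"
      then obtain L where L: "elliptic_functional L" "L \<bullet> H z < 0" "\<And>B. B \<in> F \<Longrightarrow> 0 \<le> L \<bullet> B"
        using convex_cone_separation[OF F C2_hessian_symmetric[OF C2 z]] by blast
      interpret elliptic_functional L by (rule L(1))
      have "F \<subseteq> half_space"
        using F(1) L(3) by (auto simp: half_space_def subequation_def)
      then have "subharmonic half_space X (\<lambda>x. ereal (\<Sum>i\<in>I. u i x))"
        using subharmonic_mono[OF u] by (intro half_space_subharmonic_sum[OF I X _ cont]) blast
      from subharmonic_test[OF this C2 z V] le eq have "H z \<in> half_space" by auto
      then show False using L(2) by (simp add: half_space_def)
    qed
  qed (rule X)
qed

section \<open>Spherical means and finite averages over a transitive group\<close>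

lemma orthogonal_matrix_vec:
  fixes g :: "real^'n^'n"
  assumes "orthogonal_matrix g"
  shows "norm (g *v x) = norm x" "g *v (x v* g) = x"
proof -
  have "orthogonal_transformation ((*v) g)"
    using assms by (simp add: orthogonal_transformation_matrix)
  then show "norm (g *v x) = norm x" by (simp add: orthogonal_transformation)
  show "g *v (x v* g) = x"
    using assms by (metis matrix_vector_mul_assoc matrix_vector_mul_lid orthogonal_matrix_def
        transpose_matrix_vector)
qed

lemma nn_integral_lborel_translate:
  fixes f :: "'a::euclidean_space \<Rightarrow> ennreal"
  assumes "f \<in> borel_measurable borel"
  shows "(\<integral>\<^sup>+x. f (c + x) \<partial>lborel) = (\<integral>\<^sup>+x. f x \<partial>lborel)"
proof -
  have "(\<integral>\<^sup>+x. f x \<partial>lborel) = (\<integral>\<^sup>+x. f x \<partial>distr lborel borel ((+) c))"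
    by (simp add: lborel_distr_plus)
  also have "\<dots> = (\<integral>\<^sup>+x. f (c + x) \<partial>lborel)"
    using assms by (subst nn_integral_distr) auto
  finally show ?thesis by simp
qed

text \<open>The uniqueness argument for translation invariant measures: both sides, multiplied by the
  volume of the unit ball, are the integral of \<open>f (g z) 1(|g z - y| < 1)\<close> over all \<open>y\<close> and \<open>z\<close>,
  computed in the two orders of integration.\<close>

lemma nn_integral_lborel_orthogonal:
  fixes f :: "real^'n \<Rightarrow> ennreal" and g :: "real^'n^'n"
  assumes g: "orthogonal_matrix g" and f: "f \<in> borel_measurable borel"
  shows "(\<integral>\<^sup>+x. f (g *v x) \<partial>lborel) = (\<integral>\<^sup>+x. f x \<partial>lborel)"
proof -
  define B where "B = ball (0::real^'n) 1"
  define \<omega> where "\<omega> = emeasure lborel B"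
  have \<omega>: "\<omega> \<noteq> 0" "\<omega> \<noteq> \<infinity>"
    using content_ball_pos[of 1 "0::real^'n"] emeasure_bounded_finite[OF bounded_ball, of "0::real^'n" 1]
    unfolding \<omega>_def B_def by (auto simp: measure_def)
  have [measurable]: "(*v) g \<in> borel_measurable borel"
    by (intro borel_measurable_continuous_onI linear_continuous_on matrix_vector_mul_bounded_linear)
  have [measurable]: "B \<in> sets borel" unfolding B_def by simp
  note f[measurable]
  have trans: "(\<integral>\<^sup>+y. indicator B (x - y) \<partial>lborel) = \<omega>" for x :: "real^'n"
  proof -
    have "(\<integral>\<^sup>+y. indicator B (x - y) \<partial>lborel) = (\<integral>\<^sup>+y. (indicator B (x - (x + y)) :: ennreal) \<partial>lborel)"
      by (rule nn_integral_lborel_translate[symmetric]) measurable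
    also have "\<dots> = (\<integral>\<^sup>+y. indicator B y \<partial>lborel)"
      by (intro nn_integral_cong) (auto simp: B_def indicator_def)
    finally show ?thesis by (simp add: \<omega>_def)
  qed
  have "\<omega> * (\<integral>\<^sup>+z. f (g *v z) \<partial>lborel) = (\<integral>\<^sup>+z. \<integral>\<^sup>+y. f (g *v z) * indicator B (g *v z - y) \<partial>lborel \<partial>lborel)"
  proof -
    have "\<omega> * (\<integral>\<^sup>+z. f (g *v z) \<partial>lborel) = (\<integral>\<^sup>+z. \<omega> * f (g *v z) \<partial>lborel)"
      by (rule nn_integral_cmult[symmetric]) measurable
    also have "\<dots> = (\<integral>\<^sup>+z. \<integral>\<^sup>+y. f (g *v z) * indicator B (g *v z - y) \<partial>lborel \<partial>lborel)"
    proof (rule nn_integral_cong)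
      fix z :: "real^'n"
      have "(\<integral>\<^sup>+y. f (g *v z) * indicator B (g *v z - y) \<partial>lborel)
          = f (g *v z) * (\<integral>\<^sup>+y. indicator B (g *v z - y) \<partial>lborel)"
        by (rule nn_integral_cmult) measurable
      then show "\<omega> * f (g *v z) = (\<integral>\<^sup>+y. f (g *v z) * indicator B (g *v z - y) \<partial>lborel)"
        by (simp add: trans mult.commute)
    qed
    finally show ?thesis .
  qed
  also have "\<dots> = (\<integral>\<^sup>+y. \<integral>\<^sup>+z. f (g *v z) * indicator B (g *v z - y) \<partial>lborel \<partial>lborel)"
    by (rule lborel_pair.Fubini'[symmetric]) measurable
  also have "\<dots> = (\<integral>\<^sup>+y. \<integral>\<^sup>+z. f (y + g *v z) * indicator B z \<partial>lborel \<partial>lborel)"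
  proof (rule nn_integral_cong)
    fix y :: "real^'n"
    have "(\<integral>\<^sup>+z. f (g *v z) * indicator B (g *v z - y) \<partial>lborel)
        = (\<integral>\<^sup>+z. f (g *v (y v* g + z)) * indicator B (g *v (y v* g + z) - y) \<partial>lborel)"
      by (rule nn_integral_lborel_translate[symmetric]) measurable
    also have "\<dots> = (\<integral>\<^sup>+z. f (y + g *v z) * indicator B z \<partial>lborel)"
      using orthogonal_matrix_vec[OF g]
      by (intro nn_integral_cong) (auto simp: matrix_vector_right_distrib B_def indicator_def)
    finally show "(\<integral>\<^sup>+z. f (g *v z) * indicator B (g *v z - y) \<partial>lborel)
        = (\<integral>\<^sup>+z. f (y + g *v z) * indicator B z \<partial>lborel)" .
  qed
  also have "\<dots> = (\<integral>\<^sup>+z. \<integral>\<^sup>+y. f (y + g *v z) * indicator B z \<partial>lborel \<partial>lborel)"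
    by (rule lborel_pair.Fubini') measurable
  also have "\<dots> = (\<integral>\<^sup>+z. (\<integral>\<^sup>+y. f y \<partial>lborel) * indicator B z \<partial>lborel)"
  proof (rule nn_integral_cong)
    fix z :: "real^'n"
    have "(\<integral>\<^sup>+y. f (y + g *v z) \<partial>lborel) = (\<integral>\<^sup>+y. f y \<partial>lborel)"
      using nn_integral_lborel_translate[OF f, of "g *v z"] by (simp add: add.commute)
    then show "(\<integral>\<^sup>+y. f (y + g *v z) * indicator B z \<partial>lborel) = (\<integral>\<^sup>+y. f y \<partial>lborel) * indicator B z"
      by (subst nn_integral_multc) auto
  qed
  also have "\<dots> = \<omega> * (\<integral>\<^sup>+y. f y \<partial>lborel)"
    by (subst nn_integral_cmult) (auto simp: \<omega>_def mult.commute)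
  finally show ?thesis
    using \<omega> by (simp add: ennreal_mult_cancel_left)
qed

lemma distr_lborel_orthogonal:
  fixes g :: "real^'n^'n"
  assumes g: "orthogonal_matrix g"
  shows "distr lborel borel ((*v) g) = lborel"
proof (rule measure_eqI)
  have [measurable]: "(*v) g \<in> borel_measurable borel"
    by (intro borel_measurable_continuous_onI linear_continuous_on matrix_vector_mul_bounded_linear)
  fix A assume "A \<in> sets (distr lborel borel ((*v) g))"
  then have A[measurable]: "A \<in> sets borel" by simp
  have "emeasure (distr lborel borel ((*v) g)) A = (\<integral>\<^sup>+x. indicator A x \<partial>distr lborel borel ((*v) g))"
    by simp
  also have "\<dots> = (\<integral>\<^sup>+x. indicator A (g *v x) \<partial>lborel)"
    by (rule nn_integral_distr) auto
  also have "\<dots> = (\<integral>\<^sup>+x. indicator A x \<partial>lborel)"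
    by (rule nn_integral_lborel_orthogonal[OF g]) measurable
  finally show "emeasure (distr lborel borel ((*v) g)) A = emeasure lborel A" by simp
qed simp

text \<open>The normalized surface measure of the sphere of radius \<open>r\<close>, as the image of Lebesgue measure
  on a compact shell under the radial projection.\<close>

definition shell :: "(real^'n) set"
  where "shell = cball 0 2 - ball 0 1"

definition sphere_mean :: "(real^'n \<Rightarrow> real) \<Rightarrow> real \<Rightarrow> real"
  where "sphere_mean f r = (\<integral>x. indicator shell x * f (r *\<^sub>R sgn x) \<partial>lborel) / measure lborel (shell :: (real^'n) set)"

lemma compact_shell: "compact shell"
  unfolding shell_def by (intro compact_diff) auto

lemma radial_projection:
  assumes "0 < r" "x \<in> shell"
  shows "r *\<^sub>R sgn x \<in> sphere 0 r"
proof -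
  have "x \<noteq> 0" using assms(2) by (auto simp: shell_def)
  then show ?thesis using assms(1) by (simp add: norm_sgn)
qed

lemma integrable_shell:
  fixes f :: "real^'n \<Rightarrow> real"
  assumes r: "0 < r" and f: "continuous_on (sphere 0 r) f"
  shows "integrable lborel (\<lambda>x. indicator shell x * f (r *\<^sub>R sgn x))"
proof -
  have "continuous_on shell (\<lambda>x. r *\<^sub>R sgn x :: real^'n)"
    by (auto intro!: continuous_intros simp: sgn_div_norm shell_def)
  then have "continuous_on shell (\<lambda>x. f (r *\<^sub>R sgn x))"
    by (rule continuous_on_compose2[OF f]) (use radial_projection[OF r] in auto)
  from borel_integrable_compact[OF compact_shell this] show ?thesis by simp
qed

lemma measure_shell_pos: "0 < measure lborel (shell :: (real^'n) set)"
proof -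
  obtain k :: 'n where True by simp
  define a where "a = (3/2) *\<^sub>R (axis k 1 :: real^'n)"
  have a: "norm a = 3/2" by (simp add: a_def)
  have "ball a (1/4) \<subseteq> shell"
  proof
    fix x assume "x \<in> ball a (1/4)"
    then have "norm (a - x) < 1/4" by (simp add: dist_norm)
    then show "x \<in> shell"
      using norm_triangle_ineq4[of a "a - x"] norm_triangle_ineq2[of a "a - x"] a by (simp add: shell_def)
  qed
  then have "measure lborel (ball a (1/4)) \<le> measure lborel (shell :: (real^'n) set)"
    using compact_shell
    by (intro measure_mono_fmeasurable) (auto simp: borel_compact intro!: fmeasurableI emeasure_compact_finite)
  moreover have "0 < measure lborel (ball a (1/4))"
    by (rule content_ball_pos) simp
  ultimately show ?thesis by linarith
qed

lemma sphere_mean_add: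
  assumes "0 < r" "continuous_on (sphere 0 r) f" "continuous_on (sphere 0 r) h"
  shows "sphere_mean (\<lambda>x. f x + h x) r = sphere_mean f r + sphere_mean h r"
  unfolding sphere_mean_def distrib_left
  using integrable_shell[OF assms(1,2)] integrable_shell[OF assms(1,3)]
  by (simp add: add_divide_distrib)

lemma sphere_mean_scale: "sphere_mean (\<lambda>x. c * f x) r = c * sphere_mean f r"
proof -
  have "sphere_mean (\<lambda>x. c * f x) r = (\<integral>x. c * (indicator shell x * f (r *\<^sub>R sgn x)) \<partial>lborel) / measure lborel (shell :: (real^'a) set)"
    by (simp add: sphere_mean_def mult.left_commute)
  then show ?thesis by (simp add: sphere_mean_def)
qed

lemma sphere_mean_const: "sphere_mean (\<lambda>x :: real^'n. c) r = c"
proof -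
  have "(\<integral>x. indicator (shell :: (real^'n) set) x * c \<partial>lborel) = measure lborel (shell :: (real^'n) set) * c"
    using compact_shell by (simp add: compact_imp_closed borel_closed)
  then show ?thesis using measure_shell_pos[where 'n = 'n] by (simp add: sphere_mean_def)
qed

lemma sphere_mean_mono:
  assumes r: "0 < r" "continuous_on (sphere 0 r) f" "continuous_on (sphere 0 r) h"
    and le: "\<And>x. x \<in> sphere 0 r \<Longrightarrow> f x \<le> h x"
  shows "sphere_mean f r \<le> sphere_mean h r"
  unfolding sphere_mean_def
proof (intro divide_right_mono integral_mono integrable_shell r)
  show "indicator shell x * f (r *\<^sub>R sgn x) \<le> indicator shell x * h (r *\<^sub>R sgn x)" for x
    using le[OF radial_projection[OF r(1)], of x] by (cases "x \<in> shell") auto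
qed simp

lemma sphere_mean_cong:
  assumes "0 < r" "\<And>x. x \<in> sphere 0 r \<Longrightarrow> f x = h x"
  shows "sphere_mean f r = sphere_mean h r"
proof -
  have "(\<lambda>x. indicator shell x * f (r *\<^sub>R sgn x)) = (\<lambda>x. indicator shell x * h (r *\<^sub>R sgn x))"
  proof
    show "indicator shell x * f (r *\<^sub>R sgn x) = indicator shell x * h (r *\<^sub>R sgn x)" for x
      using assms(2)[OF radial_projection[OF assms(1)], of x] by (cases "x \<in> shell") auto
  qed
  then show ?thesis unfolding sphere_mean_def by simp
qed

lemma sphere_mean_dilate: "sphere_mean (\<lambda>x. f (c *\<^sub>R x)) r = sphere_mean f (c * r)"
  by (simp add: sphere_mean_def)

lemma sphere_mean_rotate:
  fixes f :: "real^'n \<Rightarrow> real"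
  assumes g: "orthogonal_matrix g" and r: "0 < r" and f: "continuous_on (sphere 0 r) f"
  shows "sphere_mean (\<lambda>x. f (g *v x)) r = sphere_mean f r"
proof -
  let ?h = "\<lambda>x. indicator shell x * f (r *\<^sub>R sgn x)"
  have [measurable]: "(*v) g \<in> borel_measurable borel"
    by (intro borel_measurable_continuous_onI linear_continuous_on matrix_vector_mul_bounded_linear)
  have h: "?h \<in> borel_measurable borel"
    using borel_measurable_integrable[OF integrable_shell[OF r f]] by simp
  have eq: "indicator shell x * f (g *v (r *\<^sub>R sgn x)) = ?h (g *v x)" for x
  proof -
    have "norm (g *v x) = norm x" using orthogonal_matrix_vec[OF g] by simp
    then have "g *v (r *\<^sub>R sgn x) = r *\<^sub>R sgn (g *v x)" "g *v x \<in> shell \<longleftrightarrow> x \<in> shell"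
      by (simp_all add: sgn_div_norm shell_def matrix_vector_mult_scaleR)
    then show ?thesis by (simp add: indicator_def)
  qed
  have "(\<integral>x. ?h (g *v x) \<partial>lborel) = (\<integral>x. ?h x \<partial>distr lborel borel ((*v) g))"
    by (rule integral_distr[symmetric]) (use h in auto)
  then show ?thesis
    unfolding sphere_mean_def eq by (simp add: distr_lborel_orthogonal[OF g])
qed

lemma sphere_mean_uniform_limit:
  assumes r: "0 < r" and f: "\<forall>\<^sub>F k in sequentially. continuous_on (sphere 0 r) (f k)"
    and U: "continuous_on (sphere 0 r) U"
    and lim: "uniform_limit (sphere 0 r) f U sequentially"
  shows "(\<lambda>k. sphere_mean (f k) r) \<longlonglongrightarrow> sphere_mean U r"
proof (rule tendstoI)
  fix e :: real assume e: "0 < e"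
  have "\<forall>\<^sub>F k in sequentially. \<forall>x\<in>sphere 0 r. dist (f k x) (U x) < e / 2"
    using lim e unfolding uniform_limit_iff by (meson half_gt_zero)
  with f show "\<forall>\<^sub>F k in sequentially. dist (sphere_mean (f k) r) (sphere_mean U r) < e"
  proof eventually_elim
    case (elim k)
    have c: "continuous_on (sphere 0 r) (\<lambda>x. U x + e / 2)" "continuous_on (sphere 0 r) (\<lambda>x. f k x + e / 2)"
      using U elim(1) by (auto intro!: continuous_intros)
    have near: "f k x \<le> U x + e / 2 \<and> U x \<le> f k x + e / 2" if "x \<in> sphere 0 r" for x
    proof -
      have "dist (f k x) (U x) < e / 2" using elim(2) that by blast
      then show ?thesis unfolding dist_real_def by linarith
    qed
    have "sphere_mean (f k) r \<le> sphere_mean (\<lambda>x. U x + e / 2) r"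
      by (intro sphere_mean_mono r elim(1) c(1)) (use near in auto)
    moreover have "sphere_mean U r \<le> sphere_mean (\<lambda>x. f k x + e / 2) r"
      by (intro sphere_mean_mono r U c(2)) (use near in auto)
    ultimately show ?case
      using e sphere_mean_add[OF r U continuous_on_const] sphere_mean_add[OF r elim(1) continuous_on_const]
      by (simp add: sphere_mean_const dist_real_def abs_less_iff)
  qed
qed

definition average :: "(real^'n^'n) list \<Rightarrow> (real^'n \<Rightarrow> real) \<Rightarrow> real^'n \<Rightarrow> real"
  where "average gs f x = (\<Sum>g\<leftarrow>gs. f (g *v x)) / length gs"

lemma average_le:
  assumes "gs \<noteq> []" "\<And>g. g \<in> set gs \<Longrightarrow> f (g *v x) \<le> c"
  shows "average gs f x \<le> c"
proof -
  have "(\<Sum>g\<leftarrow>gs. f (g *v x)) \<le> (\<Sum>g\<leftarrow>gs. c)"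
    using assms(2) by (rule sum_list_mono)
  then show ?thesis using assms(1) by (simp add: average_def divide_le_eq sum_list_triv mult.commute)
qed

lemma average_le_improved:
  assumes h: "h \<in> set gs" "f (h *v x) \<le> d" and le: "\<And>g. g \<in> set gs \<Longrightarrow> f (g *v x) \<le> c"
  shows "average gs f x \<le> c - (c - d) / length gs"
proof -
  obtain as bs where gs: "gs = as @ h # bs" using split_list[OF h(1)] by blast
  have "(\<Sum>g\<leftarrow>as. f (g *v x)) \<le> (\<Sum>g\<leftarrow>as. c)" "(\<Sum>g\<leftarrow>bs. f (g *v x)) \<le> (\<Sum>g\<leftarrow>bs. c)"
    using le by (auto simp: gs intro!: sum_list_mono)
  then have "(\<Sum>g\<leftarrow>gs. f (g *v x)) \<le> c * length gs - (c - d)"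
    using h(2) by (simp add: gs sum_list_triv algebra_simps)
  then have "average gs f x \<le> (c * length gs - (c - d)) / length gs"
    unfolding average_def by (rule divide_right_mono) simp
  also have "\<dots> = c - (c - d) / length gs"
    using gs by (subst diff_divide_distrib) simp
  finally show ?thesis .
qed

lemma average_minus: "average gs (\<lambda>x. - f x) x = - average gs f x"
proof -
  have "(\<Sum>g\<leftarrow>gs. - f (g *v x)) = - (\<Sum>g\<leftarrow>gs. f (g *v x))"
    by (induction gs) auto
  then show ?thesis by (simp add: average_def)
qed

lemma average_average:
  assumes "gs \<noteq> []" "hs \<noteq> []"
  shows "average hs (average gs f) x = average (concat (map (\<lambda>h. map (\<lambda>g. g ** h) gs) hs)) f x"
proof -
  have len: "length (concat (map (\<lambda>h. map (\<lambda>g. g ** h) gs) hs)) = length gs * length hs"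
    by (induction hs) auto
  have "(\<Sum>k\<leftarrow>concat (map (\<lambda>h. map (\<lambda>g. g ** h) gs) hs). f (k *v x)) = (\<Sum>h\<leftarrow>hs. \<Sum>g\<leftarrow>gs. f (g *v (h *v x)))"
    by (induction hs) (auto simp: o_def matrix_vector_mul_assoc)
  moreover have "(\<Sum>h\<leftarrow>hs. average gs f (h *v x)) = (\<Sum>h\<leftarrow>hs. \<Sum>g\<leftarrow>gs. f (g *v (h *v x))) / length gs"
    by (induction hs) (auto simp: average_def add_divide_distrib)
  ultimately show ?thesis unfolding average_def[of hs] average_def[of "concat _"] len by simp
qed

locale transitive_orthogonal_group =
  fixes G :: "(real^'n^'n) set"
  assumes orth: "g \<in> G \<Longrightarrow> orthogonal_matrix g"
    and mult: "g \<in> G \<Longrightarrow> h \<in> G \<Longrightarrow> g ** h \<in> G"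
    and transitive: "norm x = 1 \<Longrightarrow> norm y = 1 \<Longrightarrow> \<exists>g\<in>G. g *v x = y"
begin

lemma norm_G: "g \<in> G \<Longrightarrow> norm (g *v x) = norm x"
  using orthogonal_matrix_vec orth by blast

lemma transitive_sphere:
  assumes "0 < b" "x \<in> sphere 0 b" "y \<in> sphere 0 b"
  shows "\<exists>g\<in>G. g *v x = y"
proof -
  have "norm (x /\<^sub>R b) = 1" "norm (y /\<^sub>R b) = 1" using assms by auto
  then obtain g where g: "g \<in> G" "g *v (x /\<^sub>R b) = y /\<^sub>R b" using transitive by blast
  then have "g *v x = y" using assms(1) by (simp add: matrix_vector_mult_scaleR)
  then show ?thesis using g(1) by blast
qed

text \<open>Rotations carrying each point of a finite net to each other one suffice, because rotations
  preserve distances.\<close>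

lemma finite_approximately_transitive:
  assumes b: "0 < b" and \<delta>: "0 < \<delta>"
  obtains hs where "set hs \<subseteq> G" "hs \<noteq> []"
    "\<And>x y. x \<in> sphere 0 b \<Longrightarrow> y \<in> sphere 0 b \<Longrightarrow> \<exists>h\<in>set hs. norm (h *v x - y) < \<delta>"
proof -
  have "\<exists>T. finite T \<and> T \<subseteq> sphere (0::real^'n) b \<and> sphere 0 b \<subseteq> (\<Union>t\<in>T. ball t (\<delta> / 2))"
  proof (rule compactE_image[OF compact_sphere, of "sphere 0 b" "\<lambda>t. ball t (\<delta> / 2)" "0::real^'n" b])
    show "sphere 0 b \<subseteq> (\<Union>c\<in>sphere (0::real^'n) b. ball c (\<delta> / 2))" using \<delta> by fastforce
  qed auto
  then obtain T where T: "finite T" "T \<subseteq> sphere (0::real^'n) b" "sphere 0 b \<subseteq> (\<Union>t\<in>T. ball t (\<delta> / 2))"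
    by blast
  have "\<forall>a\<in>T. \<forall>c\<in>T. \<exists>g. g \<in> G \<and> g *v a = c"
    using transitive_sphere[OF b] T(2) by blast
  then obtain k where k: "\<And>a c. a \<in> T \<Longrightarrow> c \<in> T \<Longrightarrow> k a c \<in> G \<and> k a c *v a = c" by metis
  obtain hs where hs: "set hs = (\<lambda>(a, c). k a c) ` (T \<times> T)"
    using finite_list[of "(\<lambda>(a, c). k a c) ` (T \<times> T)"] T(1) by auto
  obtain i :: 'n where True by simp
  have "b *\<^sub>R axis i 1 \<in> sphere (0::real^'n) b" using b by simp
  then have "T \<noteq> {}" using T(3) by blast
  show thesis
  proof (rule that[of hs])
    show "set hs \<subseteq> G" using k hs by auto
    show "hs \<noteq> []" using hs \<open>T \<noteq> {}\<close> by fastforce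
    fix x y :: "real^'n" assume xy: "x \<in> sphere 0 b" "y \<in> sphere 0 b"
    obtain a where a: "a \<in> T" "x \<in> ball a (\<delta> / 2)" using T(3) xy(1) by blast
    obtain c where c: "c \<in> T" "y \<in> ball c (\<delta> / 2)" using T(3) xy(2) by blast
    have ac: "a \<in> T" "c \<in> T" "dist a x < \<delta> / 2" "dist c y < \<delta> / 2" using a c by auto
    have kG: "k a c \<in> G" "k a c *v a = c" using k[OF ac(1,2)] by auto
    have "k a c *v x - y = k a c *v (x - a) + (c - y)"
      using kG(2) by (simp add: matrix_vector_mult_diff_distrib)
    then have "norm (k a c *v x - y) \<le> norm (k a c *v (x - a)) + norm (c - y)"
      by (metis norm_triangle_ineq)
    also have "\<dots> = dist a x + dist c y"
      using norm_G[OF kG(1)] by (simp add: dist_norm norm_minus_commute)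
    also have "\<dots> < \<delta>" using ac by simp
    finally show "\<exists>h\<in>set hs. norm (h *v x - y) < \<delta>" using hs ac(1,2) by force
  qed
qed

lemma continuous_on_sphere_G:
  assumes "continuous_on (sphere 0 b) f" "g \<in> G"
  shows "continuous_on (sphere 0 b) (\<lambda>x. f (g *v x))"
  by (rule continuous_on_compose2[OF assms(1)])
    (use norm_G[OF assms(2)] in \<open>auto intro!: linear_continuous_on matrix_vector_mul_bounded_linear\<close>)

lemma continuous_on_average:
  assumes "continuous_on (sphere 0 b) f" "set gs \<subseteq> G"
  shows "continuous_on (sphere 0 b) (average gs f)"
proof -
  have "continuous_on (sphere 0 b) (\<lambda>x. \<Sum>g\<leftarrow>gs. f (g *v x))"
    using assms(2)
    by (induction gs) (auto intro!: continuous_intros continuous_on_sphere_G[OF assms(1)])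
  then show ?thesis unfolding average_def[abs_def] by (cases "gs = []") (auto intro!: continuous_intros)
qed

lemma sphere_mean_average:
  assumes b: "0 < b" and f: "continuous_on (sphere 0 b) f" and gs: "set gs \<subseteq> G" "gs \<noteq> []"
  shows "sphere_mean (average gs f) b = sphere_mean f b"
proof -
  have "continuous_on (sphere 0 b) (\<lambda>x. \<Sum>g\<leftarrow>gs. f (g *v x))
      \<and> sphere_mean (\<lambda>x. \<Sum>g\<leftarrow>gs. f (g *v x)) b = length gs * sphere_mean f b"
    using gs(1)
  proof (induction gs)
    case Nil
    then show ?case by (simp add: sphere_mean_const)
  next
    case (Cons g gs)
    then have IH: "continuous_on (sphere 0 b) (\<lambda>x. \<Sum>g\<leftarrow>gs. f (g *v x))"
      "sphere_mean (\<lambda>x. \<Sum>g\<leftarrow>gs. f (g *v x)) b = length gs * sphere_mean f b" and g: "g \<in> G" by auto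
    have c: "continuous_on (sphere 0 b) (\<lambda>x. f (g *v x))" by (rule continuous_on_sphere_G[OF f g])
    show ?case
      using sphere_mean_add[OF b c IH(1)] IH(2) sphere_mean_rotate[OF orth[OF g] b f] c IH(1)
      by (auto simp: distrib_right intro!: continuous_intros)
  qed
  then have "sphere_mean (\<lambda>x. (1 / length gs) * (\<Sum>g\<leftarrow>gs. f (g *v x))) b = sphere_mean f b"
    using gs(2) by (simp only: sphere_mean_scale) simp
  then show ?thesis by (simp add: average_def[abs_def])
qed

text \<open>Let \<open>c\<close> be the infimum of the maxima of all finite averages of \<open>f\<close>, and suppose that it exceeds
  the mean. Every average takes a value at most the mean somewhere, and hence, by equicontinuity,
  values well below \<open>c\<close> on a ball of a fixed size. Averaging a near-minimal average once more, over
  a finite set of rotations one of which moves a given point into that ball, lowers its maximum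
  by a fixed amount, below \<open>c\<close>.\<close>

lemma average_near_mean:
  assumes b: "0 < b" and f: "continuous_on (sphere 0 b) f" and \<epsilon>: "0 < \<epsilon>"
  obtains gs where "set gs \<subseteq> G" "gs \<noteq> []" "\<And>x. x \<in> sphere 0 b \<Longrightarrow> average gs f x \<le> sphere_mean f b + \<epsilon>"
proof -
  define m where "m = sphere_mean f b"
  define S where "S = {c. \<exists>gs. set gs \<subseteq> G \<and> gs \<noteq> [] \<and> (\<forall>x\<in>sphere 0 b. average gs f x \<le> c)}"
  obtain hs0 where hs0: "set hs0 \<subseteq> G" "hs0 \<noteq> []"
    by (rule finite_approximately_transitive[OF b zero_less_one])
  have "bounded (f ` sphere 0 b)"
    using compact_continuous_image[OF f compact_sphere] by (rule compact_imp_bounded)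
  then obtain B where "\<forall>y\<in>f ` sphere 0 b. norm y \<le> B" unfolding bounded_iff by blast
  then have B: "\<bar>f x\<bar> \<le> B" if "x \<in> sphere 0 b" for x using that by auto
  have "average hs0 f x \<le> B" if "x \<in> sphere 0 b" for x
  proof (rule average_le[OF hs0(2)])
    fix g assume "g \<in> set hs0"
    then show "f (g *v x) \<le> B" using B[of "g *v x"] norm_G[of g x] hs0(1) that by auto
  qed
  then have S_ne: "S \<noteq> {}" unfolding S_def using hs0 by blast
  have S_ge: "m \<le> c" if cS: "c \<in> S" for c
  proof -
    obtain gs where gs: "set gs \<subseteq> G" "gs \<noteq> []" "\<forall>x\<in>sphere 0 b. average gs f x \<le> c"
      using cS unfolding S_def by blast
    have "m = sphere_mean (average gs f) b"
      unfolding m_def using sphere_mean_average[OF b f gs(1,2)] by simp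
    also have "\<dots> \<le> sphere_mean (\<lambda>x::real^'n. c) b"
      by (intro sphere_mean_mono b continuous_on_average f gs(1)) (use gs(3) in auto)
    finally show ?thesis by (simp add: sphere_mean_const)
  qed
  have bdd: "bdd_below S" by (rule bdd_belowI[of _ m]) (rule S_ge)
  define c where "c = Inf S"
  have c_le: "c \<le> c'" if "c' \<in> S" for c' unfolding c_def using cInf_lower[OF that bdd] .
  have "c \<le> m"
  proof (rule ccontr)
    assume "\<not> c \<le> m"
    define \<eta> where "\<eta> = (c - m) / 2"
    have \<eta>: "0 < \<eta>" using \<open>\<not> c \<le> m\<close> by (simp add: \<eta>_def)
    have "uniformly_continuous_on (sphere 0 b) f"
      by (rule compact_uniformly_continuous[OF f compact_sphere])
    then obtain \<delta> where \<delta>: "0 < \<delta>"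
      "\<And>x y. x \<in> sphere 0 b \<Longrightarrow> y \<in> sphere 0 b \<Longrightarrow> dist x y < \<delta> \<Longrightarrow> dist (f x) (f y) < \<eta>"
      using \<eta> unfolding uniformly_continuous_on_def by metis
    obtain hs where hs: "set hs \<subseteq> G" "hs \<noteq> []"
      "\<And>x y. x \<in> sphere 0 b \<Longrightarrow> y \<in> sphere 0 b \<Longrightarrow> \<exists>h\<in>set hs. norm (h *v x - y) < \<delta>"
      by (rule finite_approximately_transitive[OF b \<delta>(1)]) (rule that)
    define N where "N = real (length hs)"
    have N: "0 < N" using hs(2) by (simp add: N_def)
    have "c < c + \<eta> / N" using \<eta> N by simp
    then obtain c' where c': "c' \<in> S" "c' < c + \<eta> / N"
      using cInf_lessD[OF S_ne, of "c + \<eta> / N"] unfolding c_def by blast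
    then obtain gs where gs: "set gs \<subseteq> G" "gs \<noteq> []" "\<And>x. x \<in> sphere 0 b \<Longrightarrow> average gs f x \<le> c'"
      unfolding S_def by blast
    let ?w = "average gs f"
    have w: "continuous_on (sphere 0 b) ?w" by (rule continuous_on_average[OF f gs(1)])
    have "\<exists>y\<in>sphere 0 b. ?w y \<le> m"
    proof (rule ccontr)
      assume no: "\<not> ?thesis"
      obtain i :: 'n where True by simp
      have "b *\<^sub>R axis i 1 \<in> sphere (0::real^'n) b" using b by simp
      then obtain y where y: "y \<in> sphere 0 b" "\<And>x. x \<in> sphere 0 b \<Longrightarrow> ?w y \<le> ?w x"
        using continuous_attains_inf[OF compact_sphere _ w] by blast
      have "sphere_mean (\<lambda>x::real^'n. ?w y) b \<le> sphere_mean ?w b"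
        by (intro sphere_mean_mono b w) (use y(2) in auto)
      then show False
        using no y(1) sphere_mean_average[OF b f gs(1,2)] by (auto simp: sphere_mean_const m_def)
    qed
    then obtain y where y: "y \<in> sphere 0 b" "?w y \<le> m" by blast
    have near: "?w z \<le> m + \<eta>" if z: "z \<in> sphere 0 b" "norm (z - y) < \<delta>" for z
    proof -
      have "(\<Sum>g\<leftarrow>gs. f (g *v z)) \<le> (\<Sum>g\<leftarrow>gs. f (g *v y) + \<eta>)"
      proof (rule sum_list_mono)
        fix g assume "g \<in> set gs"
        then have g: "g \<in> G" using gs(1) by blast
        have "dist (g *v z) (g *v y) < \<delta>"
          using z(2) norm_G[OF g, of "z - y"] by (simp add: dist_norm matrix_vector_mult_diff_distrib)
        then have "dist (f (g *v z)) (f (g *v y)) < \<eta>"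
          using \<delta>(2)[of "g *v z" "g *v y"] norm_G[OF g] z(1) y(1) by simp
        then show "f (g *v z) \<le> f (g *v y) + \<eta>" by (simp add: dist_real_def abs_less_iff)
      qed
      also have "\<dots> = (\<Sum>g\<leftarrow>gs. f (g *v y)) + \<eta> * length gs"
        by (simp add: sum_list_addf sum_list_triv mult.commute)
      finally have "?w z \<le> ?w y + \<eta>"
        using gs(2) by (simp add: average_def field_simps)
      then show ?thesis using y(2) by simp
    qed
    have "average hs ?w x \<le> c' - \<eta> / N" if x: "x \<in> sphere 0 b" for x
    proof -
      obtain h where h: "h \<in> set hs" "norm (h *v x - y) < \<delta>" using hs(3)[OF x y(1)] by blast
      have hx: "k *v x \<in> sphere 0 b" if "k \<in> set hs" for k
        using norm_G[of k x] hs(1) that x by auto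
      have "average hs ?w x \<le> c' - (c' - (m + \<eta>)) / length hs"
        by (rule average_le_improved[OF h(1)]) (use near[OF hx[OF h(1)] h(2)] gs(3) hx in auto)
      moreover have "\<eta> / N \<le> (c' - (m + \<eta>)) / length hs"
        unfolding N_def using c_le[OF c'(1)] by (intro divide_right_mono) (auto simp: \<eta>_def field_simps)
      ultimately show ?thesis by linarith
    qed
    moreover have "set (concat (map (\<lambda>h. map (\<lambda>g. g ** h) gs) hs)) \<subseteq> G"
      using mult gs(1) hs(1) by auto
    moreover have "concat (map (\<lambda>h. map (\<lambda>g. g ** h) gs) hs) \<noteq> []"
      using gs(2) hs(2) by (cases hs) auto
    ultimately have "c' - \<eta> / N \<in> S"
      unfolding S_def average_average[OF gs(2) hs(2)] by blast
    from c_le[OF this] c'(2) show False by simp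
  qed
  then have "Inf S < m + \<epsilon>" using \<epsilon> by (simp add: c_def)
  from cInf_lessD[OF S_ne this] obtain c' where "c' \<in> S" "c' < m + \<epsilon>" by blast
  then obtain gs where "set gs \<subseteq> G" "gs \<noteq> []" "\<And>x. x \<in> sphere 0 b \<Longrightarrow> average gs f x \<le> c'"
    unfolding S_def by blast
  then show thesis
    using that[of gs] \<open>c' < m + \<epsilon>\<close> unfolding m_def by fastforce
qed

text \<open>Averaging over finitely many rotations that bring every point of the sphere near \<open>z\<close> turns \<open>f\<close> into
  a function bounded below by a positive constant, without changing the mean.\<close>

lemma sphere_mean_pos:
  fixes f :: "real^'n \<Rightarrow> real"
  assumes b: "0 < b" and f: "continuous_on (sphere 0 b) f"
    and nonneg: "\<And>x. x \<in> sphere 0 b \<Longrightarrow> 0 \<le> f x" and z: "z \<in> sphere 0 b" "0 < f z"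
  shows "0 < sphere_mean f b"
proof -
  have "\<exists>\<delta>>0. \<forall>x\<in>sphere 0 b. dist x z < \<delta> \<longrightarrow> dist (f x) (f z) < f z / 2"
    using f z unfolding continuous_on_iff by (meson half_gt_zero)
  then obtain \<delta> where \<delta>: "0 < \<delta>" "\<And>x. x \<in> sphere 0 b \<Longrightarrow> dist x z < \<delta> \<Longrightarrow> dist (f x) (f z) < f z / 2"
    by blast
  obtain hs where hs: "set hs \<subseteq> G" "hs \<noteq> []"
    "\<And>x y. x \<in> sphere 0 b \<Longrightarrow> y \<in> sphere 0 b \<Longrightarrow> \<exists>h\<in>set hs. norm (h *v x - y) < \<delta>"
    by (rule finite_approximately_transitive[OF b \<delta>(1)]) (rule that)
  let ?c = "f z / 2 / length hs"
  have "?c \<le> average hs f x" if x: "x \<in> sphere 0 b" for x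
  proof -
    obtain h where h: "h \<in> set hs" "norm (h *v x - z) < \<delta>" using hs(3)[OF x z(1)] by blast
    have hx: "k *v x \<in> sphere 0 b" if "k \<in> set hs" for k
      using norm_G[of k x] hs(1) that x by auto
    have "dist (f (h *v x)) (f z) < f z / 2"
      using \<delta>(2)[OF hx[OF h(1)]] h(2) by (simp only: dist_norm)
    then have "f z / 2 \<le> f (h *v x)"
      unfolding dist_real_def by linarith
    then have "average hs (\<lambda>x. - f x) x \<le> 0 - (0 - (- (f z / 2))) / length hs"
      by (intro average_le_improved[OF h(1)]) (use nonneg hx in auto)
    then show ?thesis by (simp add: average_minus)
  qed
  then have "sphere_mean (\<lambda>x::real^'n. ?c) b \<le> sphere_mean (average hs f) b"
    by (intro sphere_mean_mono[OF b _ continuous_on_average[OF f hs(1)]]) auto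
  then have "?c \<le> sphere_mean f b"
    by (simp add: sphere_mean_const sphere_mean_average[OF b f hs(1,2)])
  moreover have "0 < ?c" using z(2) hs(2) by simp
  ultimately show ?thesis by linarith
qed

end

section \<open>Tangents for convex subequations\<close>

locale convex_riesz_cone = riesz_cone F p + transitive_orthogonal_group G
  for F :: "(real^'n^'n) set" and p :: real and G +
  assumes convex_F: "convex F"
    and transpose_G: "g \<in> G \<Longrightarrow> transpose g \<in> G"
    and invariant: "g \<in> G \<Longrightarrow> A \<in> F \<Longrightarrow> g ** A ** transpose g \<in> F"
begin

lemma orthogonal_G: "g \<in> G \<Longrightarrow> g ** transpose g = mat 1" "g \<in> G \<Longrightarrow> transpose g ** g = mat 1"
  using orth by (auto simp: orthogonal_matrix_def)

lemma continuous_on_ball_G: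
  assumes "continuous_on (ball 0 \<rho>) v" "g \<in> G"
  shows "continuous_on (ball 0 \<rho>) (\<lambda>x. v (g *v x))"
  by (rule continuous_on_compose2[OF assms(1)])
    (use norm_G[OF assms(2)] in \<open>auto intro!: linear_continuous_on matrix_vector_mul_bounded_linear\<close>)

lemma subharmonic_rotate:
  assumes v: "subharmonic F (ball 0 \<rho>) (\<lambda>x. ereal (v x))" "continuous_on (ball 0 \<rho>) v"
    and g: "g \<in> G" and k: "0 < k"
  shows "subharmonic F (ball 0 \<rho>) (\<lambda>x. ereal (k * v (g *v x)))"
proof -
  have "M \<in> F" if "(1 / k) *\<^sub>R (transpose (transpose g) ** M ** transpose g) \<in> F" for M
  proof -
    have "g ** M ** transpose g \<in> F" using that k by (simp add: F_scale_iff)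
    from invariant[OF transpose_G[OF g] this]
    have "(transpose g ** g) ** M ** (transpose g ** g) \<in> F" by (simp add: matrix_mul_assoc)
    then show ?thesis by (simp add: orthogonal_G[OF g])
  qed
  from subharmonic_linear_change[OF v orthogonal_G[OF g] k this, of 0]
  show ?thesis using norm_G[OF g] by (simp add: ball_def)
qed

lemma average_subharmonic:
  assumes v: "subharmonic F (ball 0 \<rho>) (\<lambda>x. ereal (v x))" "continuous_on (ball 0 \<rho>) v"
    and gs: "set gs \<subseteq> G" "gs \<noteq> []"
  shows "subharmonic F (ball 0 \<rho>) (\<lambda>x. ereal (average gs v x))"
proof -
  let ?k = "1 / real (length gs)"
  have "subharmonic F (ball 0 \<rho>) (\<lambda>x. ereal (\<Sum>i\<in>{0..<length gs}. ?k * v (gs ! i *v x)))"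
  proof (rule convex_subharmonic_sum[OF subeq cone convex_F])
    fix i assume "i \<in> {0..<length gs}"
    then have g: "gs ! i \<in> G" using gs(1) by auto
    show "subharmonic F (ball 0 \<rho>) (\<lambda>x. ereal (?k * v (gs ! i *v x)))"
      by (rule subharmonic_rotate[OF v g]) (use gs(2) in simp)
    show "continuous_on (ball 0 \<rho>) (\<lambda>x. ?k * v (gs ! i *v x))"
      by (intro continuous_intros continuous_on_ball_G[OF v(2) g])
  qed auto
  moreover have "(\<Sum>i\<in>{0..<length gs}. ?k * v (gs ! i *v x)) = average gs v x" for x
    by (simp add: average_def sum_list_sum_nth sum_divide_distrib)
  ultimately show ?thesis by simp
qed

text \<open>Comparison with the pole at the origin, applied to a finite average of \<open>v\<close> that hardly
  exceeds the mean on the larger sphere, passes to the spherical means.\<close>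

lemma sphere_mean_growth:
  assumes v: "subharmonic F (ball 0 \<rho>) (\<lambda>x. ereal (v x))" "continuous_on (ball 0 \<rho>) v"
    and b: "0 < b" "b < \<rho>"
  shows "v 0 \<le> sphere_mean v b"
    and "0 < r \<Longrightarrow> r \<le> b \<Longrightarrow> sphere_mean v r - v 0 \<le> (r / b) powr (2 - p) * (sphere_mean v b - v 0)"
proof -
  define S where "S = sphere_mean v b"
  have sub: "cball 0 b \<subseteq> ball (0::real^'n) \<rho>" using b by auto
  have cont: "continuous_on (sphere 0 s) v" if "s \<le> b" for s
    by (rule continuous_on_subset[OF v(2)]) (use that b in auto)
  have avg: "\<exists>gs. set gs \<subseteq> G \<and> gs \<noteq> [] \<and> (\<forall>x\<in>sphere 0 b. average gs v x \<le> S + \<epsilon>)" if e: "0 < \<epsilon>" for \<epsilon>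
    using average_near_mean[OF b(1) cont[OF order_refl] e] unfolding S_def by metis
  have at0: "average gs v 0 = v 0" if "gs \<noteq> []" for gs
    using that by (simp add: average_def sum_list_triv)
  have low: "v 0 \<le> S + \<epsilon>" if e: "0 < \<epsilon>" for \<epsilon>
  proof -
    obtain gs where gs: "set gs \<subseteq> G" "gs \<noteq> []" "\<forall>x\<in>sphere 0 b. average gs v x \<le> S + \<epsilon>"
      using avg[OF e] by blast
    have "ereal (average gs v 0) \<le> ereal (S + \<epsilon>)"
      by (rule max_principle[OF average_subharmonic[OF v gs(1,2)] cone
            subequation_cone_minus_id[OF subeq cone] sub]) (use gs(3) b(1) in auto)
    then show ?thesis by (simp add: at0[OF gs(2)])
  qed
  then show 1: "v 0 \<le> sphere_mean v b" unfolding S_def[symmetric] by (rule field_le_epsilon)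
  assume r: "0 < r" "r \<le> b"
  define \<theta> where "\<theta> = (r / b) powr (2 - p)"
  have "sphere_mean v r \<le> (v 0 + \<theta> * (S - v 0)) + \<theta> * \<epsilon>" if e: "0 < \<epsilon>" for \<epsilon>
  proof -
    obtain gs where gs: "set gs \<subseteq> G" "gs \<noteq> []" "\<forall>x\<in>sphere 0 b. average gs v x \<le> S + \<epsilon>"
      using avg[OF e] by blast
    have le: "average gs v x \<le> v 0 + (S + \<epsilon> - v 0) * \<theta>" if x: "x \<in> sphere 0 r" for x
    proof -
      have "ereal (average gs v x) \<le> ereal (v 0 + (S + \<epsilon> - v 0) * (norm (x - 0) / b) powr (2 - p))"
        by (rule pole_comparison[OF average_subharmonic[OF v gs(1,2)] b(1) sub])
          (use gs(3) 1 e x r at0[OF gs(2)] in \<open>auto simp: S_def\<close>)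
      then show ?thesis using x by (simp add: \<theta>_def)
    qed
    have "sphere_mean v r = sphere_mean (average gs v) r"
      using sphere_mean_average[OF r(1) cont[OF r(2)] gs(1,2)] by simp
    also have "\<dots> \<le> sphere_mean (\<lambda>x::real^'n. v 0 + (S + \<epsilon> - v 0) * \<theta>) r"
      by (intro sphere_mean_mono r(1) continuous_on_average cont r(2) gs(1) continuous_on_const) (rule le)
    also have "\<dots> = (v 0 + \<theta> * (S - v 0)) + \<theta> * \<epsilon>"
      by (simp add: sphere_mean_const algebra_simps)
    finally show ?thesis .
  qed
  note * = this
  have \<theta>: "0 < \<theta>" using r b by (simp add: \<theta>_def)
  have "sphere_mean v r \<le> v 0 + \<theta> * (S - v 0)"
  proof (rule field_le_epsilon)
    fix e :: real assume "0 < e"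
    then show "sphere_mean v r \<le> v 0 + \<theta> * (S - v 0) + e"
      using *[of "e / \<theta>"] \<theta> by simp
  qed
  then show "sphere_mean v r - v 0 \<le> (r / b) powr (2 - p) * (sphere_mean v b - v 0)"
    by (simp add: \<theta>_def S_def)
qed

text \<open>By the growth bound the quotient is nonnegative and nondecreasing in the radius.\<close>

lemma sphere_mean_density:
  assumes v: "subharmonic F (ball 0 \<rho>) (\<lambda>x. ereal (v x))" "continuous_on (ball 0 \<rho>) v" and \<rho>: "0 < \<rho>"
  obtains \<Theta> where "\<forall>t :: nat \<Rightarrow> real. (\<forall>k. 0 < t k) \<and> t \<longlonglongrightarrow> 0 \<longrightarrow>
    (\<lambda>k. (sphere_mean v (t k) - v 0) / t k powr (2 - p)) \<longlonglongrightarrow> \<Theta>"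
proof -
  define Q where "Q r = (sphere_mean v r - v 0) / r powr (2 - p)" for r
  have Q_mono: "Q r \<le> Q b" if "0 < r" "r \<le> b" "b < \<rho>" for r b
  proof -
    have b: "0 < b" using that by simp
    have "sphere_mean v r - v 0 \<le> (r / b) powr (2 - p) * (sphere_mean v b - v 0)"
      using sphere_mean_growth(2)[OF v b that(3,1,2)] .
    also have "\<dots> = Q b * r powr (2 - p)"
      using that b by (simp add: Q_def powr_divide)
    finally show ?thesis using that(1) by (simp add: Q_def divide_le_eq)
  qed
  have Q_nonneg: "0 \<le> Q r" if "0 < r" "r < \<rho>" for r
    using sphere_mean_growth(1)[OF v that] by (simp add: Q_def)
  define \<Theta> where "\<Theta> = Inf (Q ` {0<..<\<rho>})"
  have bdd: "bdd_below (Q ` {0<..<\<rho>})" using Q_nonneg by (auto intro!: bdd_belowI[of _ 0])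
  have ne: "Q ` {0<..<\<rho>} \<noteq> {}" using \<rho> by auto
  show thesis
  proof (rule that[of \<Theta>], intro allI impI, elim conjE)
    fix t :: "nat \<Rightarrow> real" assume t: "\<forall>k. 0 < t k" "t \<longlonglongrightarrow> 0"
    have "(\<lambda>k. Q (t k)) \<longlonglongrightarrow> \<Theta>"
    proof (rule order_tendstoI)
      fix a assume a: "a < \<Theta>"
      have "\<forall>\<^sub>F k in sequentially. t k < \<rho>" using order_tendstoD(2)[OF t(2) \<rho>] .
      then show "\<forall>\<^sub>F k in sequentially. a < Q (t k)"
      proof eventually_elim
        case (elim k)
        have "\<Theta> \<le> Q (t k)" unfolding \<Theta>_def by (rule cInf_lower[OF _ bdd]) (use t(1) elim in auto)
        then show ?case using a by simp
      qed
    next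
      fix a assume "\<Theta> < a"
      then obtain r where r: "0 < r" "r < \<rho>" "Q r < a"
        using cInf_lessD[OF ne, of a] unfolding \<Theta>_def by auto
      have "\<forall>\<^sub>F k in sequentially. t k < r" using order_tendstoD(2)[OF t(2) r(1)] .
      then show "\<forall>\<^sub>F k in sequentially. Q (t k) < a"
      proof eventually_elim
        case (elim k)
        then show ?case using Q_mono[of "t k" r] t(1)[rule_format, of k] r by simp
      qed
    qed
    then show "(\<lambda>k. (sphere_mean v (t k) - v 0) / t k powr (2 - p)) \<longlonglongrightarrow> \<Theta>"
      by (simp add: Q_def)
  qed
qed

text \<open>The spherical means of the rescaled functions are the quotients of the preceding lemma at radii
  tending to \<open>0\<close>, up to the factor \<open>R\<^sup>2\<^sup>-\<^sup>p\<close>.\<close>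

lemma tangent_sphere_mean:
  assumes u: "subharmonic F X u" and X: "0 \<in> X" and r: "\<And>j. 0 < r j" "r \<longlonglongrightarrow> 0"
    and U: "converges_locally_uniformly (\<lambda>k. rescale p u (r k)) U"
  obtains \<Theta> where "\<forall>R>0. sphere_mean U R = \<Theta> * R powr (2 - p)"
proof -
  obtain \<rho> where \<rho>: "0 < \<rho>" "ball 0 \<rho> \<subseteq> X"
    using subharmonic_open[OF u] X open_contains_ball by blast
  let ?v = "\<lambda>x. real_of_ereal (u x)"
  have v: "subharmonic F (ball 0 \<rho>) (\<lambda>x. ereal (?v x))" "continuous_on (ball 0 \<rho>) ?v"
    using subharmonic_subset[OF subharmonic_real_part[OF u] subharmonic_continuous_on[OF u] \<rho>(2)]
      continuous_on_subset[OF subharmonic_continuous_on[OF u] \<rho>(2)] by auto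
  obtain \<Theta> where \<Theta>: "\<forall>t :: nat \<Rightarrow> real. (\<forall>k. 0 < t k) \<and> t \<longlonglongrightarrow> 0 \<longrightarrow>
    (\<lambda>k. (sphere_mean ?v (t k) - ?v 0) / t k powr (2 - p)) \<longlonglongrightarrow> \<Theta>"
    by (rule sphere_mean_density[OF v \<rho>(1)]) (rule that)
  show thesis
  proof (rule that[of \<Theta>], intro allI impI)
    fix R :: real assume R: "0 < R"
    have t: "\<And>k. 0 < r k * R" "(\<lambda>k. r k * R) \<longlonglongrightarrow> 0"
      using r R tendsto_mult_right[OF r(2), of R] by auto
    have ev: "\<forall>\<^sub>F k in sequentially. r k * R < \<rho>" using order_tendstoD(2)[OF t(2) \<rho>(1)] .
    have cont: "continuous_on (sphere 0 R) (\<lambda>x. ?v (r k *\<^sub>R x))" if k: "r k * R < \<rho>" for k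
      by (rule continuous_on_compose2[OF v(2)])
        (use k r(1)[of k] in \<open>auto intro!: continuous_intros\<close>)
    have mean: "sphere_mean (rescale p u (r k)) R
        = R powr (2 - p) * ((sphere_mean ?v (r k * R) - ?v 0) / (r k * R) powr (2 - p))"
      if k: "r k * R < \<rho>" for k
    proof -
      have "sphere_mean (rescale p u (r k)) R = r k powr (p - 2) * sphere_mean (\<lambda>x. ?v (r k *\<^sub>R x) + (- ?v 0)) R"
        unfolding rescale_def[abs_def] by (subst sphere_mean_scale[symmetric]) simp
      also have "sphere_mean (\<lambda>x. ?v (r k *\<^sub>R x) + (- ?v 0)) R = sphere_mean ?v (r k * R) - ?v 0"
        using sphere_mean_add[OF R cont[OF k] continuous_on_const, of "- ?v 0"]
          sphere_mean_dilate[of ?v "r k" R]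
        by (simp add: sphere_mean_const)
      also have "r k powr (p - 2) = R powr (2 - p) / (r k * R) powr (2 - p)"
        using R r(1)[of k] powr_minus[of "r k" "2 - p"] by (simp add: powr_mult field_simps)
      finally show ?thesis by simp
    qed
    have lim: "(\<lambda>k. sphere_mean (rescale p u (r k)) R) \<longlonglongrightarrow> sphere_mean U R"
    proof (rule sphere_mean_uniform_limit[OF R])
      show "\<forall>\<^sub>F k in sequentially. continuous_on (sphere 0 R) (rescale p u (r k))"
        using ev
      proof eventually_elim
        case (elim k)
        then show ?case unfolding rescale_def[abs_def] by (intro continuous_intros cont)
      qed
      show "continuous_on (sphere 0 R) U"
        using continuous_on_subset[OF tangent_subharmonic(1)[OF u X r U]] by blast
      show "uniform_limit (sphere 0 R) (\<lambda>k. rescale p u (r k)) U sequentially"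
        using U by (simp add: converges_locally_uniformly_def)
    qed
    have "(\<lambda>k. R powr (2 - p) * ((sphere_mean ?v (r k * R) - ?v 0) / (r k * R) powr (2 - p)))
        \<longlonglongrightarrow> R powr (2 - p) * \<Theta>"
      using \<Theta>[rule_format, of "\<lambda>k. r k * R"] t by (intro tendsto_mult tendsto_const) auto
    then have "(\<lambda>k. sphere_mean (rescale p u (r k)) R) \<longlonglongrightarrow> R powr (2 - p) * \<Theta>"
      by (rule Lim_transform_eventually) (use ev mean in \<open>auto elim: eventually_mono\<close>)
    from LIMSEQ_unique[OF lim this] show "sphere_mean U R = \<Theta> * R powr (2 - p)" by simp
  qed
qed

text \<open>A strict subsolution touching \<open>U\<close> from below at \<open>z\<close> may be bent down quadratically and then lifted
  by a constant: it stays a subsolution, exceeds \<open>U\<close> at \<open>z\<close>, and drops below \<open>U\<close> before the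
  boundary of a small ball. The maximum of both is subharmonic across that boundary.\<close>

lemma (in riesz_cone) raise_subharmonic:
  assumes U_sub: "subharmonic F UNIV (\<lambda>x. ereal (U x))" and U_cont: "continuous_on UNIV U"
    and C2: "C2_with_hessian_on V \<phi> H" and z: "z \<in> V"
    and le: "\<And>y. y \<in> V \<Longrightarrow> \<phi> y \<le> U y" and eq: "\<phi> z = U z"
    and int: "H z \<in> (top_of_set Sym2) interior_of F"
  obtains R v where "0 < R" "ball z R \<subseteq> V" "\<And>x. U x \<le> v x" "\<And>x. x \<notin> ball z R \<Longrightarrow> v x = U x"
    "U z < v z" "continuous_on UNIV v" "subharmonic F UNIV (\<lambda>x. ereal (v x))"
proof -
  obtain T where T: "openin (top_of_set Sym2) T" "H z \<in> T" "T \<subseteq> F"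
    using int by (auto simp: interior_of_def)
  then obtain O' where O': "open O'" "T = Sym2 \<inter> O'" by (auto simp: openin_open)
  then obtain e where e: "0 < e" "ball (H z) e \<subseteq> O'"
    using T(2) open_contains_ball by blast
  have V_op: "open V" using C2_open[OF C2] .
  have "isCont H z"
    using C2_hessian_continuous_on[OF C2] z V_op by (simp add: continuous_on_eq_continuous_at)
  then obtain d where d: "0 < d" "\<And>x. dist x z < d \<Longrightarrow> dist (H x) (H z) < e / 2"
    using e(1) unfolding continuous_at_eps_delta by (metis half_gt_zero)
  obtain d' where d': "0 < d'" "ball z d' \<subseteq> V" using V_op z open_contains_ball by blast
  define R where "R = min d d'"
  have R: "0 < R" "ball z R \<subseteq> V" "\<And>x. x \<in> ball z R \<Longrightarrow> dist (H x) (H z) < e / 2"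
    using d d' by (auto simp: R_def dist_commute subset_iff)
  define c where "c = norm (mat 1 :: real^'n^'n) + 1"
  have c: "0 < c" "norm (mat 1 :: real^'n^'n) \<le> c" by (simp_all add: c_def add_nonneg_pos)
  define \<eta> where "\<eta> = e / (4 * c)"
  have \<eta>: "0 < \<eta>" using e(1) c(1) by (simp add: \<eta>_def)
  have "2 * \<eta> * norm (mat 1 :: real^'n^'n) \<le> 2 * \<eta> * c"
    using \<eta> c(2) by simp
  also have "\<dots> = e / 2" using c(1) by (simp add: \<eta>_def)
  finally have \<eta>_small: "2 * \<eta> * norm (mat 1 :: real^'n^'n) \<le> e / 2" .
  define \<psi> where "\<psi> x = \<phi> x + (- \<eta>) * (norm (x - z))\<^sup>2 + \<eta> * R\<^sup>2 / 8" for x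
  define K where "K x = H x + (2 * - \<eta>) *\<^sub>R mat 1" for x
  have C2\<psi>: "C2_with_hessian_on (ball z R) \<psi> K"
    unfolding \<psi>_def K_def by (intro C2_add_norm_sq C2_subset[OF C2 R(2)]) simp
  have KF: "K x \<in> F" if x: "x \<in> ball z R" for x
  proof -
    have "dist (K x) (H z) = norm ((H x - H z) + (2 * - \<eta>) *\<^sub>R mat 1)"
      by (simp add: K_def dist_norm algebra_simps)
    also have "\<dots> \<le> norm (H x - H z) + 2 * \<eta> * norm (mat 1 :: real^'n^'n)"
      using norm_triangle_ineq[of "H x - H z" "(2 * - \<eta>) *\<^sub>R mat 1"] \<eta> by (simp add: abs_mult)
    also have "\<dots> < e"
      using R(3)[OF x] \<eta>_small by (simp add: dist_norm norm_minus_commute)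
    finally have "K x \<in> O'" using e(2) by (auto simp: dist_commute)
    moreover have "K x \<in> Sym2" using C2_hessian_symmetric[OF C2\<psi> x] .
    ultimately show ?thesis using O'(2) T(3) by blast
  qed
  have \<psi>_less: "\<psi> x < U x" if x: "x \<in> ball z R" "R / 2 \<le> norm (x - z)" for x
  proof -
    have "(R / 2)\<^sup>2 \<le> (norm (x - z))\<^sup>2" using x(2) R(1) by (intro power_mono) auto
    then have "\<eta> * (R\<^sup>2 / 4) \<le> \<eta> * (norm (x - z))\<^sup>2"
      using \<eta> by (intro mult_left_mono) (auto simp: power_divide)
    moreover have "0 < \<eta> * R\<^sup>2" using \<eta> R(1) by simp
    moreover have "\<phi> x \<le> U x" using le R(2) x(1) by blast
    ultimately show ?thesis unfolding \<psi>_def by simp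
  qed
  define v where "v x = (if x \<in> ball z R then max (U x) (\<psi> x) else U x)" for x
  have v_ge: "U x \<le> v x" for x by (simp add: v_def)
  have v_far: "v x = U x" if "x \<notin> cball z (R / 2)" for x
    using \<psi>_less[of x] that by (auto simp: v_def dist_norm norm_minus_commute)
  have v_cont: "continuous_on UNIV v"
  proof -
    have "continuous_on (ball z R) (\<lambda>x. max (U x) (\<psi> x))"
      by (intro continuous_on_max continuous_on_subset[OF U_cont subset_UNIV] C2_continuous_on[OF C2\<psi>])
    then have "continuous_on (ball z R) v"
      by (rule continuous_on_eq) (simp add: v_def)
    moreover have "continuous_on (- cball z (R / 2)) v"
      by (rule continuous_on_eq[OF continuous_on_subset[OF U_cont subset_UNIV]]) (simp add: v_far)
    ultimately have "continuous_on (ball z R \<union> - cball z (R / 2)) v"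
      by (intro continuous_on_open_Un) auto
    moreover have "ball z R \<union> - cball z (R / 2) = UNIV" using R(1) by (auto simp: not_le)
    ultimately show ?thesis by simp
  qed
  have v_sub: "subharmonic F UNIV (\<lambda>x. ereal (v x))"
    unfolding subharmonic_ereal_iff[OF v_cont]
  proof (intro conjI allI impI; (elim conjE)?)
    fix x W \<zeta> M
    assume C2': "C2_with_hessian_on W \<zeta> M" and x: "x \<in> W"
      and le': "\<forall>y\<in>W. v y \<le> \<zeta> y" and eq': "v x = \<zeta> x"
    show "M x \<in> F"
    proof (cases "v x = U x")
      case True
      show ?thesis
        by (rule subharmonic_test[OF U_sub C2' x subset_UNIV])
          (use le' eq' True v_ge order_trans in \<open>auto intro: order_trans\<close>)
    next
      case False
      then have xb: "x \<in> ball z R" "v x = \<psi> x" by (auto simp: v_def max_def split: if_splits)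
      let ?W = "W \<inter> ball z R"
      have W: "open ?W" using C2_open[OF C2'] by auto
      have "M x - K x \<in> psd"
      proof (rule C2_touching_psd[OF C2_subset[OF C2' _ W] C2_subset[OF C2\<psi> _ W]])
        show "\<psi> y \<le> \<zeta> y" if "y \<in> ?W" for y
          using le'[rule_format, of y] that by (simp add: v_def)
      qed (use x xb eq' in auto)
      from F_mono[OF KF[OF xb(1)] this] show ?thesis by simp
    qed
  qed simp
  have "0 < \<eta> * R\<^sup>2 / 8" using \<eta> R(1) by simp
  then have "U z < v z" using R(1) eq by (simp add: v_def \<psi>_def max_def)
  then show thesis
    using that[OF R(1,2) v_ge _ _ v_cont v_sub] by (simp add: v_def)
qed

text \<open>If \<open>-U\<close> fails to be subharmonic for the dual at \<open>z \<noteq> 0\<close>, then \<open>U\<close> can be raised near \<open>z\<close>, within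
  a small ball, to another subharmonic function. Its spherical mean over the sphere through \<open>z\<close>
  exceeds that of \<open>U\<close>, while the means over larger spheres and the value at the origin are
  unchanged. Since the means of \<open>U\<close> are exactly a multiple of \<open>R\<^sup>2\<^sup>-\<^sup>p\<close>, they are already as large as
  the growth bound allows.\<close>

lemma tangent_harmonic:
  assumes u: "subharmonic F X u" and X: "0 \<in> X" and r: "\<And>j. 0 < r j" "r \<longlonglongrightarrow> 0"
    and U: "converges_locally_uniformly (\<lambda>k. rescale p u (r k)) U"
  shows "harmonic F (- {0}) (\<lambda>x. ereal (U x))"
proof -
  note U_cont = tangent_subharmonic(1)[OF u X r U] and U_sub = tangent_subharmonic(2)[OF u X r U]
  obtain \<Theta> where \<Theta>: "\<forall>R>0. sphere_mean U R = \<Theta> * R powr (2 - p)"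
    by (rule tangent_sphere_mean[OF u X r U]) (rule that)
  have "(\<lambda>k. rescale p u (r k) 0) \<longlonglongrightarrow> U 0"
    using U[unfolded converges_locally_uniformly_def, rule_format, of "{0}"] by simp
  then have U0: "U 0 = 0"
    by (simp add: rescale_def LIMSEQ_const_iff)
  have op: "open (- {0 :: real^'n})" by auto
  have "subharmonic F (- {0}) (\<lambda>x. ereal (U x))"
    by (rule subharmonic_subset[OF U_sub U_cont subset_UNIV op])
  moreover have "subharmonic (dual F) (- {0}) (\<lambda>x. ereal (- U x))"
  proof -
    have cont: "continuous_on (- {0}) (\<lambda>x. - U x)"
      by (intro continuous_intros continuous_on_subset[OF U_cont subset_UNIV])
    show ?thesis
      unfolding subharmonic_ereal_iff[OF cont]
    proof (intro conjI allI impI; (elim conjE)?)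
      fix z V \<phi> H
      assume C2: "C2_with_hessian_on V \<phi> H" and z: "z \<in> V" and V: "V \<subseteq> - {0}"
        and le: "\<forall>y\<in>V. - U y \<le> \<phi> y" and eq: "- U z = \<phi> z"
      show "H z \<in> dual F"
      proof (rule ccontr)
        assume "H z \<notin> dual F"
        then have "- H z \<in> (top_of_set Sym2) interior_of F"
          using C2_hessian_symmetric[OF C2 z] by (simp add: dual_def)
        then have int: "(-1) *\<^sub>R H z \<in> (top_of_set Sym2) interior_of F" by simp
        have le': "(-1) * \<phi> y \<le> U y" if "y \<in> V" for y using le that by force
        have eq': "(-1) * \<phi> z = U z" using eq by simp
        obtain R v where R: "0 < R" "ball z R \<subseteq> V" and v_ge: "\<And>x. U x \<le> v x"
          and v_out: "\<And>x. x \<notin> ball z R \<Longrightarrow> v x = U x" and v_z: "U z < v z"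
          and v_cont: "continuous_on UNIV v" and v_sub: "subharmonic F UNIV (\<lambda>x. ereal (v x))"
          by (rule raise_subharmonic[OF U_sub U_cont C2_scale[OF C2] z le' eq' int]) (assumption | rule that)+
        have zV: "z \<noteq> 0" using z V by blast
        define s where "s = norm z"
        have s: "0 < s" using zV by (simp add: s_def)
        have "0 \<notin> ball z R" using R(2) V by blast
        then have Rs: "R \<le> s" by (simp add: s_def dist_norm)
        define b where "b = s + R"
        have b: "0 < b" "s \<le> b" using s R(1) by (auto simp: b_def)
        have v0: "v 0 = 0" using \<open>0 \<notin> ball z R\<close> by (simp add: v_out U0)
        have vb: "v x = U x" if "x \<in> sphere 0 b" for x
        proof -
          have "R \<le> norm (z - x)"
            using that norm_triangle_ineq2[of x z] by (simp add: b_def s_def norm_minus_commute)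
          then show ?thesis by (simp add: v_out dist_norm)
        qed
        have "sphere_mean v s - v 0 \<le> (s / b) powr (2 - p) * (sphere_mean v b - v 0)"
          by (rule sphere_mean_growth(2)[of "b + 1"])
            (use subharmonic_subset[OF v_sub v_cont] continuous_on_subset[OF v_cont] b s in auto)
        also have "\<dots> = (s / b) powr (2 - p) * (\<Theta> * b powr (2 - p))"
          using sphere_mean_cong[where f = v and h = U, OF b(1) vb] \<Theta>[rule_format, OF b(1)] v0 by simp
        also have "\<dots> = sphere_mean U s"
          using \<Theta>[rule_format, OF s] s b(1) by (simp add: powr_divide)
        finally have "sphere_mean v s \<le> sphere_mean U s" using v0 by simp
        moreover have "0 < sphere_mean (\<lambda>x. v x + (-1) * U x) s"
        proof (rule sphere_mean_pos[OF s])
          show "continuous_on (sphere 0 s) (\<lambda>x. v x + (-1) * U x)"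
            by (intro continuous_intros continuous_on_subset[OF U_cont subset_UNIV]
                continuous_on_subset[OF v_cont subset_UNIV])
          show "0 \<le> v x + (-1) * U x" for x using v_ge[of x] by simp
          show "z \<in> sphere 0 s" by (simp add: s_def)
          show "0 < v z + (-1) * U z" using v_z by simp
        qed
        moreover have "sphere_mean (\<lambda>x. v x + (-1) * U x) s = sphere_mean v s + (-1) * sphere_mean U s"
        proof -
          have "continuous_on (sphere 0 s) (\<lambda>x. (-1) * U x)"
            by (intro continuous_intros continuous_on_subset[OF U_cont subset_UNIV])
          from sphere_mean_add[OF s continuous_on_subset[OF v_cont subset_UNIV] this]
          show ?thesis by (simp only: sphere_mean_scale)
        qed
        ultimately show False by simp
      qed
    qed (rule op)
  qed
  ultimately show ?thesis by (simp add: harmonic_def)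
qed

end

lemma m_inv_orthogonal_group:
  assumes "g \<in> carrier orthogonal_group"
  shows "m_inv orthogonal_group g = transpose g"
proof -
  have g: "transpose g ** g = mat 1" "g ** transpose g = mat 1"
    using assms by (auto simp: orthogonal_group_def orthogonal_matrix_def)
  have "y = transpose g" if "g ** y = mat 1" for y
  proof -
    have "transpose g ** (g ** y) = transpose g" using that by simp
    then show ?thesis by (simp add: matrix_mul_assoc g)
  qed
  note uniq = this
  show ?thesis
    unfolding m_inv_def
  proof (rule the_equality)
    show "transpose g \<in> carrier orthogonal_group \<and> g \<otimes>\<^bsub>orthogonal_group\<^esub> transpose g = \<one>\<^bsub>orthogonal_group\<^esub>
        \<and> transpose g \<otimes>\<^bsub>orthogonal_group\<^esub> g = \<one>\<^bsub>orthogonal_group\<^esub>"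
      using g by (simp add: orthogonal_group_def orthogonal_matrix_def)
    show "y = transpose g" if "y \<in> carrier orthogonal_group \<and> g \<otimes>\<^bsub>orthogonal_group\<^esub> y = \<one>\<^bsub>orthogonal_group\<^esub>
        \<and> y \<otimes>\<^bsub>orthogonal_group\<^esub> g = \<one>\<^bsub>orthogonal_group\<^esub>" for y
      using that uniq by (simp add: orthogonal_group_def)
  qed
qed

theorem theorem1p10:
  fixes F :: "(real^'n^'n) set" and p :: real and e :: "real^'n"
  assumes "CARD('n) \<ge> 2"
    and "subequation F" and "cone F" and "ST_invariant F"
    and "norm e = 1" and "riesz_characteristic F e = ereal p"
    and "1 \<le> p" and "p < 2"
  shows "(\<forall>X u. subharmonic F X u \<longrightarrow> locally_holder (2 - p) X u)
    \<and> (\<forall>X u (r :: nat \<Rightarrow> real).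
         subharmonic F X u \<and> 0 \<in> X \<and> (\<forall>j. r j > 0) \<and> decseq r \<and> r \<longlonglongrightarrow> 0 \<longrightarrow>
         (\<exists>s U. strict_mono s
            \<and> converges_locally_uniformly (\<lambda>k. rescale p u (r (s k))) U
            \<and> subharmonic F UNIV (\<lambda>x. ereal (U x)))
       \<and> (\<forall>\<beta>. 0 < \<beta> \<and> \<beta> < 2 - p \<longrightarrow>
            (\<exists>s U. strict_mono s
               \<and> converges_locally_holder \<beta> (\<lambda>k. rescale p u (r (s k))) U
               \<and> subharmonic F UNIV (\<lambda>x. ereal (U x))))
       \<and> (convex F \<longrightarrow>
            (\<forall>s U. strict_mono s
               \<and> converges_locally_uniformly (\<lambda>k. rescale p u (r (s k))) U
               \<longrightarrow> harmonic F (- {0}) (\<lambda>x. ereal (U x)))))"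
proof -
  interpret riesz_cone F p
  proof
    fix q and e' :: "real^'n" assume q: "p < q" and e': "norm e' = 1"
    show "mat 1 - q *\<^sub>R line_proj e' \<notin> F"
    proof
      assume "mat 1 - q *\<^sub>R line_proj e' \<in> F"
      then have "ereal q \<le> riesz_characteristic F e'"
        unfolding riesz_characteristic_def riesz_matrix_eq by (intro SUP_upper) simp
      also have "\<dots> = ereal p"
        using riesz_characteristic_indep[OF assms(4) e' assms(5)] assms(6) by simp
      finally show False using q by simp
    qed
  qed (use assms in auto)
  have rs: "(\<lambda>k. r (s k)) \<longlonglongrightarrow> 0" if "r \<longlonglongrightarrow> 0" "strict_mono s" for r :: "nat \<Rightarrow> real" and s
    using LIMSEQ_subseq_LIMSEQ[OF that] by (simp add: o_def)
  have tangents: "\<exists>s U. strict_mono s \<and> converges_locally_uniformly (\<lambda>k. rescale p u (r (s k))) U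
      \<and> (\<forall>\<beta>. 0 < \<beta> \<longrightarrow> \<beta> < 2 - p \<longrightarrow> converges_locally_holder \<beta> (\<lambda>k. rescale p u (r (s k))) U)
      \<and> subharmonic F UNIV (\<lambda>x. ereal (U x))"
    if u: "subharmonic F X u" "0 \<in> X" and r: "\<And>j. 0 < r j" "r \<longlonglongrightarrow> 0" for X u and r :: "nat \<Rightarrow> real"
  proof -
    obtain s U where s: "strict_mono s"
      "converges_locally_uniformly (\<lambda>k. rescale p u (r (s k))) U"
      "\<And>\<beta>. 0 < \<beta> \<Longrightarrow> \<beta> < 2 - p \<Longrightarrow> converges_locally_holder \<beta> (\<lambda>k. rescale p u (r (s k))) U"
      by (rule tangent_exists[OF u r]) (rule that)
    moreover have "subharmonic F UNIV (\<lambda>x. ereal (U x))"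
      by (rule tangent_subharmonic(2)[OF u, of "\<lambda>k. r (s k)"]) (use r(1) rs[OF r(2) s(1)] s(2) in auto)
    ultimately show ?thesis by blast
  qed
  have harm: "harmonic F (- {0}) (\<lambda>x. ereal (U x))"
    if conv: "convex F" and u: "subharmonic F X u" "0 \<in> X" and r: "\<And>j. 0 < r j" "r \<longlonglongrightarrow> 0"
      and s: "strict_mono s" and U: "converges_locally_uniformly (\<lambda>k. rescale p u (r (s k))) U"
    for X u s U and r :: "nat \<Rightarrow> real"
  proof -
    obtain G where G: "subgroup G orthogonal_group"
      and tr: "\<forall>x\<in>sphere 0 1. \<forall>y\<in>sphere 0 1. \<exists>g\<in>G. g *v x = y"
      and inv: "\<forall>g\<in>G. \<forall>A\<in>F. g ** A ** transpose g \<in> F"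
      using assms(4) unfolding ST_invariant_def by blast
    interpret convex_riesz_cone F p G
    proof
      show "orthogonal_matrix g" if "g \<in> G" for g
        using subgroup.subset[OF G] that by (auto simp: orthogonal_group_def)
      show "g ** h \<in> G" if "g \<in> G" "h \<in> G" for g h
        using subgroup.m_closed[OF G that] by (simp add: orthogonal_group_def)
      show "\<exists>g\<in>G. g *v x = y" if "norm x = 1" "norm y = 1" for x y
        using tr that by simp
      show "transpose g \<in> G" if "g \<in> G" for g
        using subgroup.m_inv_closed[OF G that] m_inv_orthogonal_group[OF subsetD[OF subgroup.subset[OF G] that]]
        by simp
    qed (use conv inv in auto)
    show ?thesis
      by (rule tangent_harmonic[OF u, of "\<lambda>k. r (s k)"]) (use r(1) rs[OF r(2) s] U in auto)
  qed
  show ?thesis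
  proof (intro conjI allI impI; (elim conjE)?)
    show "locally_holder (2 - p) X u" if "subharmonic F X u" for X u
      by (rule subharmonic_locally_holder[OF that])
  next
    fix X u and r :: "nat \<Rightarrow> real"
    assume *: "subharmonic F X u" "0 \<in> X" "\<forall>j. r j > 0" "r \<longlonglongrightarrow> 0"
    show "\<exists>s U. strict_mono s \<and> converges_locally_uniformly (\<lambda>k. rescale p u (r (s k))) U
            \<and> subharmonic F UNIV (\<lambda>x. ereal (U x))"
      using tangents[OF *(1,2) _ *(4)] *(3) by blast
    show "\<exists>s U. strict_mono s \<and> converges_locally_holder \<beta> (\<lambda>k. rescale p u (r (s k))) U
            \<and> subharmonic F UNIV (\<lambda>x. ereal (U x))" if "0 < \<beta>" "\<beta> < 2 - p" for \<beta>
      using tangents[OF *(1,2) _ *(4)] *(3) that by blast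
    show "harmonic F (- {0}) (\<lambda>x. ereal (U x))"
      if "convex F" "strict_mono s" "converges_locally_uniformly (\<lambda>k. rescale p u (r (s k))) U" for s U
      using harm[OF that(1) *(1,2) _ *(4) that(2,3)] *(3) by blast
  qed
qed

end
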